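(* Let $\mathcal{T}=(T(t))_{t\ge0}$ be a bounded $C_0$-semigroup on a Banach space $X$ with infinitesimal generator $A$, and let $x\in X$ be such that $\sigma_{PF}(A,x)$ is countable. The orbit $\{T(t)x: t\ge0\}$ is relatively compact in $X$ if and only if $\lim_{\alpha\to0^+}\alpha R(\alpha+i\xi,A)x$ exists (in the norm of $X$) for each $i\xi\in\sigma_{PF}(A,x)$.
   Context: Vector-valued distributions: for a Banach space $Z$ and an open set $I\subseteq\mathbb{R}$, $\mathcal{D}'(I;Z)$ is the space of continuous linear maps $\mathcal{D}(I)=C_c^\infty(I)\to Z$, and $\mathcal{S}'(\mathbb{R};Z)$ is the space of continuous linear maps $\mathcal{S}(\mathbb{R})\to Z$ (Schwartz space). The Fourier transform is $\widehat{\varphi}(\xi)=\int_{-\infty}^{\infty}e^{-i\xi t}\varphi(t)\,dt$ on $\mathcal{S}(\mathbb{R})$, extended to $\mathcal{S}'(\mathbb{R};Z)$ by $\langle\widehat f,\varphi\rangle=\langle f,\widehat\varphi\rangle$. $C_0(\mathbb{R};Z)$ is the space of continuous $Z$-valued functions vanishing at infinity, and $PF(\mathbb{R};Z)=\{\widehat g: g\in C_0(\mathbb{R};Z)\}$. A distribution $f\in\mathcal{D}'(I;Z)$ is a local pseudofunction on $I$ if each $\xi_0\in I$ has an open neighborhood $I'\subseteq I$ on which $f$ coincides with an element of $PF(\mathbb{R};Z)$. For $f\in\mathcal{D}'(\mathbb{R};Z)$, $\operatorname{sing\,supp}_{PF}f$ is the complement in $\mathbb{R}$ of the largest open set on which $f$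 is a local pseudofunction. Semigroups: $\mathcal{T}$ is bounded if $\sup_{t\ge0}\|T(t)\|_{L(X)}<\infty$; $R(\lambda,A)=(\lambda-A)^{-1}$ is the resolvent. For bounded $\mathcal{T}$ and $x\in X$, the limit $\langle R(i\xi,A)x,\varphi(\xi)\rangle=\lim_{\alpha\to0^+}\int_{-\infty}^\infty\varphi(\xi)R(\alpha+i\xi,A)x\,d\xi$ defines $R(i\,\cdot,A)x\in\mathcal{S}'(\mathbb{R};X)$ (it is the Fourier transform of $t\mapsto T(t)x$, extended by $0$ to $t<0$). The local pseudofunction spectrum of $A$ at $x$ is $\sigma_{PF}(A,x)=i\operatorname{sing\,supp}_{PF}R(i\,\cdot,A)x\subseteq i\mathbb{R}$. Countable includes finite and empty. *)

theory Defs
  imports "HOL-Analysis.Analysis"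
begin

section \<open>Complex Banach spaces\<close>

class complex_banach = banach +
  fixes scaleC :: "complex \<Rightarrow> 'a \<Rightarrow> 'a" (infixr "*\<^sub>C" 75)
  assumes scaleC_add_right: "a *\<^sub>C (u + v) = a *\<^sub>C u + a *\<^sub>C v"
    and scaleC_add_left: "(a + b) *\<^sub>C u = a *\<^sub>C u + b *\<^sub>C u"
    and scaleC_scaleC: "a *\<^sub>C b *\<^sub>C u = (a * b) *\<^sub>C u"
    and scaleR_scaleC: "r *\<^sub>R u = complex_of_real r *\<^sub>C u"
    and norm_scaleC: "norm (a *\<^sub>C u) = cmod a * norm u"


section \<open>Semigroups, generators and resolvents\<close>

definition C0_semigroup :: "(real \<Rightarrow> 'a::complex_banach \<Rightarrow> 'a) \<Rightarrow> bool" where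
  "C0_semigroup T \<longleftrightarrow>
     (\<forall>t\<ge>0. bounded_linear (T t) \<and> (\<forall>c u. T t (c *\<^sub>C u) = c *\<^sub>C T t u)) \<and>
     (\<forall>u. T 0 u = u) \<and>
     (\<forall>s\<ge>0. \<forall>t\<ge>0. \<forall>u. T (s + t) u = T s (T t u)) \<and>
     (\<forall>u. ((\<lambda>t. T t u) \<longlongrightarrow> u) (at_right 0))"

definition bounded_semigroup :: "(real \<Rightarrow> 'a::complex_banach \<Rightarrow> 'a) \<Rightarrow> bool" where
  "bounded_semigroup T \<longleftrightarrow> bdd_above ((\<lambda>t. onorm (T t)) ` {0..})"

text \<open>An unbounded operator is a partial function; its domain is \<^term>\<open>dom A\<close>.\<close>

definition generator :: "(real \<Rightarrow> 'a::complex_banach \<Rightarrow> 'a) \<Rightarrow> ('a \<rightharpoonup> 'a)" where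
  "generator T u =
     (if \<exists>v. ((\<lambda>t. (1 / t) *\<^sub>R (T t u - u)) \<longlongrightarrow> v) (at_right 0)
      then Some (Lim (at_right 0) (\<lambda>t. (1 / t) *\<^sub>R (T t u - u)))
      else None)"

text \<open>Meaningful only for \<open>\<lambda>\<close> in the resolvent set of \<open>A\<close>. The generator of a bounded semigroup
  has every \<open>\<lambda>\<close> with positive real part in its resolvent set, and only such \<open>\<lambda>\<close> are used below.\<close>

definition resolvent :: "complex \<Rightarrow> ('a::complex_banach \<rightharpoonup> 'a) \<Rightarrow> 'a \<Rightarrow> 'a" where
  "resolvent z A = the_inv_into (dom A) (\<lambda>u. z *\<^sub>C u - the (A u))"


section \<open>Vector-valued distributions and local pseudofunctions\<close>

definition nth_deriv :: "nat \<Rightarrow> (real \<Rightarrow> complex) \<Rightarrow> real \<Rightarrow> complex" where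
  "nth_deriv k \<phi> = ((\<lambda>g t. vector_derivative g (at t)) ^^ k) \<phi>"

definition smooth :: "(real \<Rightarrow> complex) \<Rightarrow> bool" where
  "smooth \<phi> \<longleftrightarrow> (\<forall>k t. nth_deriv k \<phi> differentiable (at t))"

definition supp :: "(real \<Rightarrow> complex) \<Rightarrow> real set" where
  "supp \<phi> = closure {t. \<phi> t \<noteq> 0}"

definition test_functions :: "real set \<Rightarrow> (real \<Rightarrow> complex) set" where
  "test_functions I = {\<phi>. smooth \<phi> \<and> compact (supp \<phi>) \<and> supp \<phi> \<subseteq> I}"

text \<open>A distribution on \<open>I\<close> is a total function on \<^typ>\<open>real \<Rightarrow> complex\<close> of which only the values
  on \<^term>\<open>test_functions I\<close> matter; restriction to a smaller open set does not change the function.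
  Continuity for the inductive limit topology of the test functions on \<open>I\<close> is expressed by
  the usual seminorm estimate on each compact \<open>K \<subseteq> I\<close>.\<close>

definition distribution_on :: "real set \<Rightarrow> ((real \<Rightarrow> complex) \<Rightarrow> 'a::complex_banach) \<Rightarrow> bool" where
  "distribution_on I f \<longleftrightarrow>
     (\<forall>\<phi>\<in>test_functions I. \<forall>\<psi>\<in>test_functions I. f (\<lambda>t. \<phi> t + \<psi> t) = f \<phi> + f \<psi>) \<and>
     (\<forall>c. \<forall>\<phi>\<in>test_functions I. f (\<lambda>t. c * \<phi> t) = c *\<^sub>C f \<phi>) \<and>
     (\<forall>K. compact K \<and> K \<subseteq> I \<longrightarrow>
        (\<exists>C N. \<forall>\<phi>\<in>test_functions I. supp \<phi> \<subseteq> K \<longrightarrow>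
           norm (f \<phi>) \<le> C * (\<Sum>k\<le>N. SUP t. cmod (nth_deriv k \<phi> t))))"

text \<open>The integrals below are Henstock--Kurzweil integrals because the Bochner integral of the
  library is restricted to separable spaces. All integrands are continuous and absolutely
  integrable, so the two integrals agree.\<close>

definition fourier :: "(real \<Rightarrow> complex) \<Rightarrow> real \<Rightarrow> complex" where
  "fourier \<phi> \<xi> = integral UNIV (\<lambda>t. exp (- \<i> * of_real \<xi> * of_real t) * \<phi> t)"

definition C0_functions :: "(real \<Rightarrow> 'a::complex_banach) set" where
  "C0_functions = {g. continuous_on UNIV g \<and> (g \<longlongrightarrow> 0) at_infinity}"

definition regular_distribution :: "(real \<Rightarrow> 'a::complex_banach) \<Rightarrow> (real \<Rightarrow> complex) \<Rightarrow> 'a" where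
  "regular_distribution g \<phi> = integral UNIV (\<lambda>t. \<phi> t *\<^sub>C g t)"

definition fourier_distribution ::
    "((real \<Rightarrow> complex) \<Rightarrow> 'a::complex_banach) \<Rightarrow> (real \<Rightarrow> complex) \<Rightarrow> 'a" where
  "fourier_distribution f \<phi> = f (fourier \<phi>)"

text \<open>Pseudofunctions are tempered distributions, but only their values on compactly supported
  smooth functions enter below, so the Schwartz space is not needed explicitly.\<close>

definition PF :: "((real \<Rightarrow> complex) \<Rightarrow> 'a::complex_banach) set" where
  "PF = {fourier_distribution (regular_distribution g) | g. g \<in> C0_functions}"

definition local_pseudofunction_on ::
    "real set \<Rightarrow> ((real \<Rightarrow> complex) \<Rightarrow> 'a::complex_banach) \<Rightarrow> bool" where
  "local_pseudofunction_on I f \<longleftrightarrow>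
     distribution_on I f \<and>
     (\<forall>\<xi>\<in>I. \<exists>J. open J \<and> \<xi> \<in> J \<and> J \<subseteq> I \<and> (\<exists>h\<in>PF. \<forall>\<phi>\<in>test_functions J. f \<phi> = h \<phi>))"

definition sing_supp_PF :: "((real \<Rightarrow> complex) \<Rightarrow> 'a::complex_banach) \<Rightarrow> real set" where
  "sing_supp_PF f = - \<Union>{U. open U \<and> local_pseudofunction_on U f}"

text \<open>The union in this definition is itself one of the sets, hence the largest one.\<close>

lemma distribution_on_subset:
  assumes "distribution_on I f" "J \<subseteq> I"
  shows "distribution_on J f"
proof -
  have sub: "\<phi> \<in> test_functions I" if "\<phi> \<in> test_functions J" for \<phi>
    using that assms(2) unfolding test_functions_def by auto
  have K: "K \<subseteq> I" if "K \<subseteq> J" for K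
    using that assms(2) by auto
  show ?thesis
    using assms(1) sub K unfolding distribution_on_def by meson
qed

lemma local_pseudofunction_on_compl_sing_supp_PF:
  assumes "distribution_on UNIV f"
  shows "local_pseudofunction_on (- sing_supp_PF f) f"
  unfolding local_pseudofunction_on_def
proof (intro conjI ballI)
  show "distribution_on (- sing_supp_PF f) f"
    using assms by (rule distribution_on_subset) simp
next
  fix \<xi> assume "\<xi> \<in> - sing_supp_PF f"
  then obtain U where U: "open U" "local_pseudofunction_on U f" "\<xi> \<in> U"
    unfolding sing_supp_PF_def by auto
  then obtain J where J: "open J" "\<xi> \<in> J" "J \<subseteq> U"
      "\<exists>h\<in>PF. \<forall>\<phi>\<in>test_functions J. f \<phi> = h \<phi>"
    unfolding local_pseudofunction_on_def by meson
  have "U \<subseteq> - sing_supp_PF f"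
    using U unfolding sing_supp_PF_def by auto
  with J show "\<exists>J. open J \<and> \<xi> \<in> J \<and> J \<subseteq> - sing_supp_PF f \<and>
      (\<exists>h\<in>PF. \<forall>\<phi>\<in>test_functions J. f \<phi> = h \<phi>)"
    by blast
qed


section \<open>The local pseudofunction spectrum\<close>

definition boundary_resolvent ::
    "('a::complex_banach \<rightharpoonup> 'a) \<Rightarrow> 'a \<Rightarrow> (real \<Rightarrow> complex) \<Rightarrow> 'a" where
  "boundary_resolvent A x \<phi> =
     Lim (at_right 0) (\<lambda>\<alpha>::real. integral UNIV
       (\<lambda>\<xi>. \<phi> \<xi> *\<^sub>C resolvent (of_real \<alpha> + \<i> * of_real \<xi>) A x))"

definition sigma_PF :: "('a::complex_banach \<rightharpoonup> 'a) \<Rightarrow> 'a \<Rightarrow> complex set" where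
  "sigma_PF A x = (\<lambda>\<xi>. \<i> * of_real \<xi>) ` sing_supp_PF (boundary_resolvent A x)"

end

theory Submission
  imports Defs
begin

text \<open>
  Write \<open>A\<close> for the generator and \<open>K\<^sub>\<phi>(s) = \<integral>\<^sub>0\<^sup>\<infinity> \<phi>^(t - s) T(t)x dt\<close> for the orbit smoothed by the Fourier
  transform \<open>\<phi>^\<close> of a test function \<open>\<phi>\<close>; in the code \<open>K\<^sub>\<phi>(s)\<close> is \<open>smoothing \<phi> x s\<close>. By Fubini's theorem and
  Abel summation, \<open>K\<^sub>\<phi>(s)\<close> is the value of the boundary resolvent at the test function \<open>e\<^sup>i\<^sup>s\<^sup>\<xi> \<phi>(\<xi>)\<close>
  (\<open>boundary_resolvent_modulated\<close>). So \<open>K\<^sub>\<phi>\<close> depends only on the boundary resolvent near the support of \<open>\<phi>\<close>.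
  Call \<open>\<phi>\<close> good if \<open>{K\<^sub>\<phi>(s) | s \<ge> 0}\<close> is relatively compact (\<open>smooth_precompact\<close>).

  Suppose that the spectrum is countable and that the Abel means converge on it.

  \<^item> Goodness is a local property, by a partition of unity (\<open>test_functions_localize\<close>). Off the spectrum
    the boundary resolvent is locally the Fourier transform of a \<open>C\<^sub>0\<close> function \<open>g\<close>, and then \<open>K\<^sub>\<phi>\<close> consists
    of averages of \<open>g\<close>. A continuous function with relatively compact range has relatively compact
    averages (\<open>relatively_compact_averages\<close>), so every \<open>\<phi>\<close> supported off the spectrum is good
    (\<open>smooth_precompact_off_spectrum\<close>).

  \<^item> Let \<open>U\<close> be the largest open set on which all test functions are good. Its complement is a closed
    subset of the spectrum, hence countable, and if it were nonempty, then it would have an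
    isolated point \<open>\<omega>\<close> by Baire's theorem. Let \<open>\<phi>\<close> be supported near \<open>\<omega>\<close>. Then \<open>(\<xi> - \<omega>) \<phi>\<close> is good, because
    removing an \<open>\<epsilon>\<close>-neighbourhood of \<open>\<omega>\<close> changes its transform by \<open>O(\<epsilon>)\<close> in \<open>L\<^sup>1\<close>
    (\<open>smooth_precompact_vanishing\<close>). Put \<open>w = \<alpha> R(\<alpha> + i\<omega>, A) x\<close>. Since \<open>d/dt T(t)w = (\<alpha> + i\<omega>) T(t)w - \<alpha> T(t)x\<close>,
    an integration by parts (\<open>smoothing_R_identity\<close>) shows that the difference between \<open>K\<^sub>\<phi>\<close> and the smoothed
    orbit of \<open>w\<close> has relatively compact range, because \<open>(\<xi> - \<omega>) \<phi>\<close> is good. As \<open>\<alpha> \<rightarrow> 0\<close>, \<open>w\<close> tends to some \<open>y\<close>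
    with \<open>T(t)y = e\<^sup>i\<^sup>\<omega>\<^sup>t y\<close>, whose smoothed orbit is a bounded subset of a line. So \<open>\<phi>\<close> itself is good
    (\<open>smooth_precompact_ergodic\<close>), and \<open>\<omega>\<close> belongs to \<open>U\<close>. This contradiction shows \<open>U = \<real>\<close>.

  \<^item> The orbit is uniformly continuous, so that it is a uniform limit of smoothed orbits with an
    approximate identity (\<open>orbit_relatively_compact\<close>).

  The converse is the mean ergodic theorem for the semigroup \<open>e\<^sup>-\<^sup>i\<^sup>\<omega>\<^sup>t T(t)\<close> at an arbitrary frequency \<open>\<omega>\<close>: the
  Abel means of a relatively compact orbit are again relatively compact, so they have a cluster point,
  which is an eigenvector, and the resolvent identity forces convergence to it (\<open>mean_ergodic\<close>).
\<close>


section \<open>Complex scalar multiplication\<close>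

interpretation scaleC: bounded_bilinear "scaleC :: complex \<Rightarrow> 'a::complex_banach \<Rightarrow> 'a"
proof
  fix a b :: complex and u v :: 'a and r :: real
  show "(a + b) *\<^sub>C u = a *\<^sub>C u + b *\<^sub>C u" by (rule scaleC_add_left)
  show "a *\<^sub>C (u + v) = a *\<^sub>C u + a *\<^sub>C v" by (rule scaleC_add_right)
  show "(r *\<^sub>R a) *\<^sub>C u = r *\<^sub>R (a *\<^sub>C u)"
    by (simp add: scaleR_scaleC scaleC_scaleC scaleR_conv_of_real)
  show "a *\<^sub>C (r *\<^sub>R u) = r *\<^sub>R (a *\<^sub>C u)"
    by (simp add: scaleR_scaleC scaleC_scaleC mult.commute)
  show "\<exists>K. \<forall>(a::complex) (u::'a). norm (a *\<^sub>C u) \<le> norm a * norm u * K"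
    by (rule exI[of _ 1]) (simp add: norm_scaleC)
qed

lemma scaleC_one [simp]: "1 *\<^sub>C (u::'a::complex_banach) = u"
  using scaleR_scaleC[of 1 u] by simp

text \<open>With this instance, scalar integrals are a special case of vector-valued ones.\<close>

instantiation complex :: complex_banach
begin

definition scaleC_complex :: "complex \<Rightarrow> complex \<Rightarrow> complex" where
  "scaleC_complex = (*)"

instance
  by standard (auto simp: scaleC_complex_def algebra_simps norm_mult scaleR_conv_of_real)

end


section \<open>Relatively compact families\<close>

text \<open>Containment in a compact set is stable under sums, products and continuous images by inspection,
  whereas closures of images are awkward to handle.\<close>

definition relatively_compact :: "'a::real_normed_vector set \<Rightarrow> bool" where
  "relatively_compact S \<longleftrightarrow> (\<exists>K. compact K \<and> S \<subseteq> K)"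

lemma relatively_compact_iff_compact_closure:
  "relatively_compact S \<longleftrightarrow> compact (closure S)"
proof
  assume "relatively_compact S"
  then obtain K where K: "compact K" "S \<subseteq> K"
    unfolding relatively_compact_def by blast
  then have "closure S \<subseteq> K"
    by (simp add: closure_minimal compact_imp_closed)
  then have "closure S = K \<inter> closure S" by blast
  then show "compact (closure S)"
    using K(1) by (metis closed_closure compact_Int_closed)
next
  assume "compact (closure S)"
  then show "relatively_compact S"
    unfolding relatively_compact_def using closure_subset by blast
qed

lemma relatively_compact_continuous_image:
  assumes "relatively_compact S" "continuous_on UNIV f"
  shows "relatively_compact (f ` S)"
proof -
  obtain K where "compact K" "S \<subseteq> K"
    using assms(1) unfolding relatively_compact_def by blast
  then show ?thesis
    using assms(2) unfolding relatively_compact_def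
    by (meson compact_continuous_image continuous_on_subset image_mono subset_UNIV)
qed

lemma relatively_compact_add:
  assumes "relatively_compact (f ` I)" "relatively_compact (g ` I)"
  shows "relatively_compact ((\<lambda>i. f i + g i) ` I)"
proof -
  obtain K L where KL: "compact K" "f ` I \<subseteq> K" "compact L" "g ` I \<subseteq> L"
    using assms unfolding relatively_compact_def by blast
  have "compact ((\<lambda>p. fst p + snd p) ` (K \<times> L))"
    by (intro compact_continuous_image continuous_intros compact_Times KL)
  moreover have "(\<lambda>i. f i + g i) ` I \<subseteq> (\<lambda>p. fst p + snd p) ` (K \<times> L)"
    using KL by force
  ultimately show ?thesis unfolding relatively_compact_def by blast
qed

lemma relatively_compact_sum:
  assumes "finite X" "\<And>x. x \<in> X \<Longrightarrow> relatively_compact (f x ` I)"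
  shows "relatively_compact ((\<lambda>i. \<Sum>x\<in>X. f x i) ` I)"
  using assms
proof (induction X)
  case empty
  have "(\<lambda>i. 0) ` I \<subseteq> {0}" by auto
  then show ?case unfolding relatively_compact_def by (auto intro!: exI[of _ "{0}"])
next
  case (insert x X)
  then show ?case by (simp add: relatively_compact_add)
qed

lemma relatively_compact_scaleC:
  fixes f :: "'i \<Rightarrow> 'a::complex_banach"
  assumes "\<And>i. i \<in> I \<Longrightarrow> norm (c i) \<le> C" "relatively_compact (f ` I)"
  shows "relatively_compact ((\<lambda>i. c i *\<^sub>C f i) ` I)"
proof -
  obtain K where K: "compact K" "f ` I \<subseteq> K"
    using assms unfolding relatively_compact_def by blast
  have "compact ((\<lambda>p. fst p *\<^sub>C snd p) ` (cball 0 C \<times> K))"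
    by (intro compact_continuous_image continuous_intros compact_Times K compact_cball
        scaleC.continuous_on)
  moreover have "(\<lambda>i. c i *\<^sub>C f i) ` I \<subseteq> (\<lambda>p. fst p *\<^sub>C snd p) ` (cball 0 C \<times> K)"
  proof
    fix z assume "z \<in> (\<lambda>i. c i *\<^sub>C f i) ` I"
    then obtain i where "i \<in> I" "z = c i *\<^sub>C f i" by blast
    then show "z \<in> (\<lambda>p. fst p *\<^sub>C snd p) ` (cball 0 C \<times> K)"
      using assms(1)[of i] K(2) by (intro image_eqI[of _ _ "(c i, f i)"]) auto
  qed
  ultimately show ?thesis unfolding relatively_compact_def by blast
qed

lemma relatively_compact_const: "relatively_compact ((\<lambda>i. a) ` I)"
  unfolding relatively_compact_def by (rule exI[of _ "{a}"]) auto

text \<open>In a complete space relative compactness is total boundedness, and therefore stable under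
  uniform approximation.\<close>

lemma relatively_compact_approx:
  fixes f :: "'i \<Rightarrow> 'a::banach"
  assumes "\<And>e. e > 0 \<Longrightarrow> \<exists>g. relatively_compact (g ` I) \<and> (\<forall>i\<in>I. norm (f i - g i) \<le> e)"
  shows "relatively_compact (f ` I)"
proof -
  have "\<exists>k. finite k \<and> closure (f ` I) \<subseteq> (\<Union>x\<in>k. ball x e)" if "e > 0" for e
  proof -
    obtain g where g: "relatively_compact (g ` I)" "\<forall>i\<in>I. norm (f i - g i) \<le> e/4"
      using assms[of "e/4"] \<open>e > 0\<close> by auto
    obtain K where "compact K" and K: "g ` I \<subseteq> K"
      using g(1) unfolding relatively_compact_def by blast
    then obtain k where k: "finite k" "K \<subseteq> (\<Union>x\<in>k. ball x (e/4))"
      using compact_eq_totally_bounded[of K] \<open>e > 0\<close> by (meson zero_less_divide_iff zero_less_numeral)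
    have "f ` I \<subseteq> (\<Union>x\<in>k. cball x (e/2))"
    proof
      fix z assume "z \<in> f ` I"
      then obtain i where i: "i \<in> I" "z = f i" by blast
      then have "g i \<in> (\<Union>x\<in>k. ball x (e/4))" using K k by blast
      then obtain x where "x \<in> k" "dist x (g i) < e/4" by auto
      moreover have "dist (g i) z \<le> e/4"
        using g(2) i by (metis dist_commute dist_norm)
      ultimately show "z \<in> (\<Union>x\<in>k. cball x (e/2))"
        using dist_triangle[of x z "g i"] by (intro UN_I[of x]) auto
    qed
    then have "closure (f ` I) \<subseteq> (\<Union>x\<in>k. cball x (e/2))"
      by (rule closure_minimal) (use k in auto)
    also have "\<dots> \<subseteq> (\<Union>x\<in>k. ball x e)"
      using \<open>e > 0\<close> by (intro UN_mono) auto
    finally show ?thesis using k(1) by blast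
  qed
  then show ?thesis
    unfolding relatively_compact_iff_compact_closure compact_eq_totally_bounded
    by (simp add: complete_eq_closed)
qed

text \<open>Clamping the argument to a long compact interval changes the function little.\<close>

lemma C0_function_relatively_compact:
  fixes g :: "real \<Rightarrow> 'a::complex_banach"
  assumes "g \<in> C0_functions"
  shows "relatively_compact (range g)"
proof (rule relatively_compact_approx)
  fix e :: real assume "e > 0"
  have g: "continuous_on UNIV g" "(g \<longlongrightarrow> 0) at_infinity"
    using assms by (auto simp: C0_functions_def)
  from tendstoD[OF g(2), of "e/2"] \<open>e > 0\<close>
  obtain N where N: "\<And>t. norm t \<ge> N \<Longrightarrow> norm (g t) < e/2"
    unfolding eventually_at_infinity by auto
  define h where "h = (\<lambda>t. g (max (- \<bar>N\<bar>) (min \<bar>N\<bar> t)))"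
  have "range h \<subseteq> g ` {- \<bar>N\<bar>..\<bar>N\<bar>}" by (auto simp: h_def)
  moreover have "compact (g ` {- \<bar>N\<bar>..\<bar>N\<bar>})"
    by (intro compact_continuous_image continuous_on_subset[OF g(1)]) auto
  ultimately have "relatively_compact (range h)" unfolding relatively_compact_def by blast
  moreover have "norm (g t - h t) \<le> e" for t
  proof (cases "\<bar>t\<bar> \<le> \<bar>N\<bar>")
    case True
    then have "max (- \<bar>N\<bar>) (min \<bar>N\<bar> t) = t" by auto
    then show ?thesis using \<open>e > 0\<close> by (simp add: h_def)
  next
    case False
    then have "norm (g t) < e/2" by (intro N) auto
    moreover have "norm (h t) < e/2"
      unfolding h_def using False by (intro N) (auto simp: max_def min_def abs_if split: if_splits)
    ultimately show ?thesis using norm_triangle_ineq4[of "g t" "h t"] by simp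
  qed
  ultimately show "\<exists>h. relatively_compact (range h) \<and> (\<forall>t\<in>UNIV. norm (g t - h t) \<le> e)" by blast
qed


section \<open>Absolutely convergent integrals over intervals\<close>

text \<open>Continuity gives integrability on bounded intervals, and \<open>g\<close> controls the tails.\<close>

lemma integrable_dominated:
  fixes f :: "real \<Rightarrow> 'a::banach"
  assumes S: "closed S" "is_interval S" and f: "continuous_on S f"
    and g: "g integrable_on S" "\<And>t. t \<in> S \<Longrightarrow> norm (f t) \<le> g t"
  shows "f integrable_on S"
proof (rule integrable_on_all_intervals_integrable_bound[OF _ g(2) g(1)])
  fix a b :: real
  have "compact (S \<inter> cbox a b)" "is_interval (S \<inter> cbox a b)"
    using S by (auto intro: closed_Int_compact is_interval_Int is_interval_cbox)
  then obtain c d where cd: "S \<inter> cbox a b = cbox c d"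
    using is_interval_compact by metis
  have "f integrable_on (S \<inter> cbox a b)"
    unfolding cd using f cd by (intro integrable_continuous) (metis continuous_on_subset inf_le1)
  then show "(\<lambda>x. if x \<in> S then f x else 0) integrable_on cbox a b"
    by (simp add: integrable_restrict_Int)
qed

lemma norm_integral_dominated:
  fixes f :: "real \<Rightarrow> 'a::banach"
  assumes "closed S" "is_interval S" "continuous_on S f"
    and "g integrable_on S" "\<And>t. t \<in> S \<Longrightarrow> norm (f t) \<le> g t"
  shows "norm (integral S f) \<le> integral S g"
  by (rule integral_norm_bound_integral[OF integrable_dominated[OF assms] assms(4,5)])

lemma tendsto_integral_half_line:
  fixes f :: "real \<Rightarrow> 'a::banach"
  assumes "f integrable_on {0..}"
  shows "((\<lambda>N. integral {0..N} f) \<longlongrightarrow> integral {0..} f) at_top"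
proof (rule tendstoI)
  fix e :: real assume "e > 0"
  have "(f has_integral integral {0..} f) {0..}" using assms by (simp add: integrable_integral)
  then obtain B where B: "B > 0" "\<And>a b. ball 0 B \<subseteq> cbox a b \<Longrightarrow>
      norm (integral (cbox a b) (\<lambda>x. if x \<in> {0..} then f x else 0) - integral {0..} f) < e"
    using \<open>e > 0\<close> unfolding has_integral_alt' by meson
  show "\<forall>\<^sub>F N in at_top. dist (integral {0..N} f) (integral {0..} f) < e"
    using eventually_ge_at_top[of B]
  proof eventually_elim
    case (elim N)
    have "ball 0 B \<subseteq> cbox (-N) N" using elim by (auto simp: dist_real_def)
    moreover have "integral (cbox (-N) N) (\<lambda>x. if x \<in> {0..} then f x else 0) = integral {0..N} f"
    proof -
      have "{0..} \<inter> cbox (-N) N = {0..N}" using B(1) elim by auto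
      then show ?thesis by (simp only: integral_restrict_Int)
    qed
    ultimately show ?case using B(2)[of "-N" N] by (simp add: dist_norm)
  qed
qed

text \<open>A translation or reflection of the line moves the large intervals that define an integral over
  an unbounded set to intervals that are still large.\<close>

lemma has_integral_real_isometry:
  fixes f :: "real \<Rightarrow> 'a::banach"
  assumes f: "(f has_integral i) S" and m: "m = 1 \<or> m = -1"
  shows "((\<lambda>t. f (m * t + c)) has_integral i) {t. m * t + c \<in> S}"
proof -
  define F where "F = (\<lambda>t. if t \<in> S then f t else 0)"
  have *: "(F has_integral i) UNIV" unfolding F_def by (simp add: has_integral_restrict_UNIV f)
  have no: "\<not> (\<exists>a b. UNIV = cbox a (b::real))"
    by (metis bounded_cbox not_bounded_UNIV)
  have alt: "(G has_integral i) UNIV \<longleftrightarrow> (\<forall>e>0. \<exists>B>0. \<forall>a b. ball 0 B \<subseteq> cbox a b \<longrightarrow>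
      (\<exists>z. (G has_integral z) (cbox a b) \<and> norm (z - i) < e))" for G :: "real \<Rightarrow> 'a"
    by (subst has_integral_alt) (use no in simp)
  have "((\<lambda>t. F (m * t + c)) has_integral i) UNIV"
    unfolding alt
  proof (intro allI impI)
    fix e :: real assume "e > 0"
    then obtain B where B: "B > 0" "\<And>a b. ball 0 B \<subseteq> cbox a b \<Longrightarrow>
        \<exists>z. (F has_integral z) (cbox a b) \<and> norm (z - i) < e"
      using * unfolding alt by blast
    have "\<exists>z. ((\<lambda>t. F (m * t + c)) has_integral z) (cbox a b) \<and> norm (z - i) < e"
      if ab: "ball 0 (B + \<bar>c\<bar>) \<subseteq> cbox a b" for a b
    proof -
      have lt: "t \<in> cbox a b" if "\<bar>t\<bar> < B + \<bar>c\<bar>" for t :: real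
        using ab that by auto
      show ?thesis
      proof (cases "m = 1")
        case True
        have "ball 0 B \<subseteq> cbox (a + c) (b + c)"
        proof
          fix t :: real assume "t \<in> ball 0 B"
          then have "\<bar>t - c\<bar> < B + \<bar>c\<bar>" by auto
          from lt[OF this] show "t \<in> cbox (a + c) (b + c)" by auto
        qed
        then obtain z where z: "(F has_integral z) (cbox (a + c) (b + c))" "norm (z - i) < e"
          using B(2) by blast
        have "((\<lambda>t. F (t + c)) has_integral z) (cbox a b)"
          using has_integral_shift_real_ivl[of F z "a + c" "b + c" c] z(1) by simp
        then show ?thesis using z(2) True by (intro exI[of _ z]) (simp only: mult_1 simp_thms)
      next
        case False
        then have m: "m = -1" using assms by simp
        have "ball 0 B \<subseteq> cbox (c - b) (c - a)"
        proof
          fix t :: real assume "t \<in> ball 0 B"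
          then have "\<bar>c - t\<bar> < B + \<bar>c\<bar>" by auto
          from lt[OF this] show "t \<in> cbox (c - b) (c - a)" by auto
        qed
        then obtain z where z: "(F has_integral z) (cbox (c - b) (c - a))" "norm (z - i) < e"
          using B(2) by blast
        have "((\<lambda>t. F (t + c)) has_integral z) {-b..-a}"
          using has_integral_shift_real_ivl[of F z "c - b" "c - a" c] z(1) by simp
        then have "((\<lambda>t. F (- t + c)) has_integral z) {a..b}"
          using has_integral_reflect_lemma_real[of "\<lambda>t. F (t + c)" z "-b" "-a"] by (simp only: minus_minus)
        then show ?thesis using z(2) m by (intro exI[of _ z]) (simp only: mult_minus1 box_real simp_thms)
      qed
    qed
    then show "\<exists>B>0. \<forall>a b. ball 0 B \<subseteq> cbox a b \<longrightarrow>
        (\<exists>z. ((\<lambda>t. F (m * t + c)) has_integral z) (cbox a b) \<and> norm (z - i) < e)"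
      using B(1) by (intro exI[of _ "B + \<bar>c\<bar>"]) auto
  qed
  moreover have "(\<lambda>t. F (m * t + c)) = (\<lambda>t. if t \<in> {t. m * t + c \<in> S} then f (m * t + c) else 0)"
    unfolding F_def by auto
  ultimately show ?thesis by (simp only: has_integral_restrict_UNIV)
qed

text \<open>The kernel that majorises all transforms of test functions below. Its primitive is an arctangent.
  The factor \<open>1 / r\<close> gives \<open>\<epsilon>\<^sup>2 / (1 + (\<epsilon> t)\<^sup>2)\<close> an integral of order \<open>\<epsilon>\<close>.\<close>

lemma has_integral_cauchy_kernel:
  assumes "r > 0"
  shows "((\<lambda>t::real. 1 / (1 + (r * (t - s))\<^sup>2)) has_integral pi / r) UNIV"
proof -
  let ?f = "\<lambda>t::real. 1 / (1 + (r * (t - s))\<^sup>2)"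
  define F where "F = (\<lambda>t. arctan (r * (t - s)) / r)"
  have F: "(?f has_integral (F b - F a)) {a..b}" if "a \<le> b" for a b
  proof (rule fundamental_theorem_of_calculus[OF that])
    fix t
    have "(F has_real_derivative ?f t) (at t)"
      unfolding F_def using assms
      by (auto intro!: derivative_eq_intros simp: divide_simps)
    then show "(F has_vector_derivative ?f t) (at t within {a..b})"
      by (simp add: has_real_derivative_iff_has_vector_derivative has_vector_derivative_at_within)
  qed
  have top: "(F \<longlongrightarrow> (pi/2) / r) at_top" unfolding F_def
    by (intro tendsto_divide tendsto_const filterlim_compose[OF tendsto_arctan_at_top]
        filterlim_tendsto_pos_mult_at_top[OF tendsto_const])
       (use assms in \<open>auto intro!: filterlim_tendsto_add_at_top[of "\<lambda>_. - s" "- s", simplified]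
          simp: filterlim_ident\<close>)
  have "filterlim (\<lambda>t. r * (t - s)) at_bot at_bot"
    unfolding filterlim_at_bot eventually_at_bot_linorder
  proof
    fix Z
    have "r * (t - s) \<le> Z" if "t \<le> Z / r + s" for t
      using that assms by (simp add: field_simps)
    then show "\<exists>N. \<forall>t\<le>N. r * (t - s) \<le> Z" by blast
  qed
  then have bot: "(F \<longlongrightarrow> - (pi/2) / r) at_bot" unfolding F_def
    using filterlim_compose[OF tendsto_arctan_at_bot]
    by (intro tendsto_divide tendsto_const) (use assms in auto)
  show ?thesis
    unfolding has_integral_alt'
  proof (intro conjI allI impI)
    fix a b
    show "(\<lambda>x. if x \<in> UNIV then ?f x else 0) integrable_on cbox a b"
      using F[of a b] by (cases "a \<le> b") auto
  next
    fix e :: real assume "e > 0"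
    obtain N where N: "\<And>t. t \<ge> N \<Longrightarrow> dist (F t) ((pi/2)/r) < e/2"
      using tendstoD[OF top, of "e/2"] \<open>e > 0\<close> unfolding eventually_at_top_linorder by auto
    obtain M where M: "\<And>t. t \<le> M \<Longrightarrow> dist (F t) (- (pi/2)/r) < e/2"
      using tendstoD[OF bot, of "e/2"] \<open>e > 0\<close> unfolding eventually_at_bot_linorder by auto
    define B where "B = \<bar>N\<bar> + \<bar>M\<bar> + 1"
    have "norm (integral (cbox a b) ?f - pi / r) < e" if ab: "ball 0 B \<subseteq> cbox a b" for a b
    proof -
      have "\<And>t. \<bar>t\<bar> < B \<Longrightarrow> a \<le> t \<and> t \<le> b" using ab by force
      from this[of "\<bar>N\<bar> + \<bar>M\<bar>"] this[of "-(\<bar>N\<bar> + \<bar>M\<bar>)"]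
      have "a \<le> M" "N \<le> b" "a \<le> b" unfolding B_def by auto
      moreover define P where "P = pi / (2 * r)"
      ultimately have "\<bar>F b - P\<bar> < e/2" "\<bar>F a + P\<bar> < e/2" "integral (cbox a b) ?f = F b - F a"
        using N[of b] M[of a] integral_unique[OF F[of a b]] by (simp_all add: dist_real_def)
      moreover have "pi / r = 2 * P" by (simp add: P_def)
      ultimately show ?thesis by (simp only: real_norm_def)
    qed
    then show "\<exists>B>0. \<forall>a b. ball 0 B \<subseteq> cbox a b \<longrightarrow>
        norm (integral (cbox a b) (\<lambda>x. if x \<in> UNIV then ?f x else 0) - pi / r) < e"
      by (intro exI[of _ B]) (auto simp: B_def)
  qed
qed

lemma cauchy_kernel_integrable:
  assumes "r > 0" "closed S"
  shows "(\<lambda>t::real. 1 / (1 + (r * (t - s))\<^sup>2)) integrable_on S"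
    and "integral S (\<lambda>t::real. 1 / (1 + (r * (t - s))\<^sup>2)) \<le> pi / r"
proof -
  let ?f = "\<lambda>t::real. 1 / (1 + (r * (t - s))\<^sup>2)"
  have I: "?f integrable_on UNIV" "integral UNIV ?f = pi / r"
    using has_integral_cauchy_kernel[OF assms(1)] by (auto simp: has_integral_iff)
  have "?f absolutely_integrable_on UNIV"
    by (rule nonnegative_absolutely_integrable_1[OF I(1)]) auto
  then have "?f absolutely_integrable_on S"
    by (rule set_integrable_subset) (use assms in auto)
  then show *: "?f integrable_on S"
    by (rule set_lebesgue_integral_eq_integral)
  show "integral S ?f \<le> pi / r"
    unfolding I(2)[symmetric] by (rule integral_subset_le[OF _ * I(1)]) auto
qed

text \<open>A partition of unity subordinate to a finite cover of the range of \<open>h\<close> by small balls replaces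
  \<open>h\<close> uniformly by \<open>\<Sum>x\<in>X. q x t *\<^sub>C x\<close> with finitely many vectors \<open>x\<close>, and the averages of this sum are
  bounded combinations of these vectors. Like Mazur's theorem on closed convex hulls, this passes
  relative compactness to averages; it applies to Abel means and to convolutions alike.\<close>

lemma relatively_compact_averages:
  fixes h :: "real \<Rightarrow> 'a::complex_banach" and k :: "'i \<Rightarrow> real \<Rightarrow> complex"
  assumes S: "closed S" "is_interval S"
    and h: "continuous_on S h" "relatively_compact (h ` S)"
    and k: "\<And>i. i \<in> I \<Longrightarrow> continuous_on S (k i)" "\<And>i t. i \<in> I \<Longrightarrow> t \<in> S \<Longrightarrow> norm (k i t) \<le> g i t"
    and g: "\<And>i. i \<in> I \<Longrightarrow> g i integrable_on S" "\<And>i. i \<in> I \<Longrightarrow> integral S (g i) \<le> C"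
  shows "relatively_compact ((\<lambda>i. integral S (\<lambda>t. k i t *\<^sub>C h t)) ` I)"
proof (rule relatively_compact_approx)
  fix e :: real assume "e > 0"
  define d where "d = e / (\<bar>C\<bar> + 1)"
  have d: "d > 0" "C * d \<le> e"
  proof -
    show "d > 0" using \<open>e > 0\<close> by (simp add: d_def)
    have "C * d \<le> (\<bar>C\<bar> + 1) * d" using \<open>d > 0\<close> by (intro mult_right_mono) auto
    then show "C * d \<le> e" by (simp add: d_def)
  qed
  obtain K where "compact K" and K: "h ` S \<subseteq> K"
    using h(2) unfolding relatively_compact_def by blast
  then obtain X where X: "finite X" "K \<subseteq> (\<Union>x\<in>X. ball x d)"
    using compact_eq_totally_bounded[of K] d(1) by meson
  define p where "p = (\<lambda>x t. max 0 (d - dist (h t) x))"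
  define P where "P = (\<lambda>t. \<Sum>x\<in>X. p x t)"
  define q where "q = (\<lambda>x t. complex_of_real (p x t / P t))"
  have p0: "0 \<le> p x t" for x t by (simp add: p_def)
  have P0: "P t > 0" if t: "t \<in> S" for t
  proof -
    have "h t \<in> (\<Union>x\<in>X. ball x d)" using X(2) K t by blast
    then obtain x where "x \<in> X" "dist x (h t) < d" by auto
    then have "p x t > 0" by (simp add: p_def dist_commute)
    then show ?thesis unfolding P_def using X(1) \<open>x \<in> X\<close> p0 by (meson sum_pos2)
  qed
  have pcont: "continuous_on S (p x)" for x
    unfolding p_def by (intro continuous_intros h)
  have qcont: "continuous_on S (q x)" for x
    unfolding q_def P_def using P0 unfolding P_def
    by (intro continuous_intros pcont) (auto simp: less_imp_neq[THEN not_sym])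
  have pP: "p x t \<le> P t" if "x \<in> X" for x t
    unfolding P_def using X(1) that p0 by (meson member_le_sum)
  have q1: "norm (q x t) \<le> 1" if "x \<in> X" "t \<in> S" for x t
    using pP[OF that(1), of t] P0[OF that(2)] p0[of x t] by (simp add: q_def norm_divide)
  have sumq: "(\<Sum>x\<in>X. q x t) = 1" if "t \<in> S" for t
    using P0[OF that] by (simp add: q_def P_def flip: of_real_sum sum_divide_distrib)
  have hq: "norm (h t - (\<Sum>x\<in>X. q x t *\<^sub>C x)) \<le> d" if t: "t \<in> S" for t
  proof -
    have "h t - (\<Sum>x\<in>X. q x t *\<^sub>C x) = (\<Sum>x\<in>X. q x t *\<^sub>C (h t - x))"
      using sumq[OF t] by (simp add: scaleC.diff_right sum_subtractf flip: scaleC.sum_left)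
    also have "norm \<dots> \<le> (\<Sum>x\<in>X. p x t / P t * d)"
    proof (rule sum_norm_le)
      fix x assume "x \<in> X"
      have "p x t * norm (h t - x) \<le> p x t * d"
        by (cases "norm (h t - x) \<le> d") (auto simp: p_def dist_norm intro: mult_left_mono)
      then show "norm (q x t *\<^sub>C (h t - x)) \<le> p x t / P t * d"
        using P0[OF t] p0[of x t] by (simp add: q_def norm_scaleC norm_divide divide_right_mono)
    qed
    also have "\<dots> = d"
      using P0[OF t] by (simp add: P_def flip: sum_distrib_right sum_divide_distrib)
    finally show ?thesis .
  qed
  define J where "J = (\<lambda>i. \<Sum>x\<in>X. integral S (\<lambda>t. k i t * q x t) *\<^sub>C x)"
  have kq: "(\<lambda>t. k i t * q x t) integrable_on S" "norm (integral S (\<lambda>t. k i t * q x t)) \<le> C"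
    if "i \<in> I" "x \<in> X" for i x
  proof -
    have b: "norm (k i t * q x t) \<le> g i t" if "t \<in> S" for t
    proof -
      have "norm (k i t * q x t) \<le> norm (k i t) * 1"
        unfolding norm_mult by (intro mult_left_mono q1) (use that \<open>x \<in> X\<close> in auto)
      then show ?thesis using k(2)[OF \<open>i \<in> I\<close> that] by simp
    qed
    have c: "continuous_on S (\<lambda>t. k i t * q x t)"
      by (intro continuous_intros k qcont that)
    show "(\<lambda>t. k i t * q x t) integrable_on S"
      by (rule integrable_dominated[OF S c g(1) b]) (use that in auto)
    show "norm (integral S (\<lambda>t. k i t * q x t)) \<le> C"
      using norm_integral_dominated[OF S c g(1) b] g(2) that by (meson order_trans)
  qed
  have "relatively_compact (J ` I)"
    unfolding J_def
    by (intro relatively_compact_sum X relatively_compact_scaleC[where C = C]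
        relatively_compact_const kq)
  moreover have "norm (integral S (\<lambda>t. k i t *\<^sub>C h t) - J i) \<le> e" if i: "i \<in> I" for i
  proof -
    obtain D where D: "\<And>t. t \<in> S \<Longrightarrow> norm (h t) \<le> D"
      using \<open>compact K\<close> K by (meson bounded_iff compact_imp_bounded image_subset_iff)
    have c: "continuous_on S (\<lambda>t. k i t *\<^sub>C h t)" by (intro scaleC.continuous_on k h i)
    have I1: "(\<lambda>t. k i t *\<^sub>C h t) integrable_on S"
    proof (rule integrable_dominated[OF S c, of "\<lambda>t. g i t * D"])
      show "(\<lambda>t. g i t * D) integrable_on S" using g(1)[OF i] by (rule integrable_on_mult_left)
      show "norm (k i t *\<^sub>C h t) \<le> g i t * D" if "t \<in> S" for t
        unfolding norm_scaleC using k(2)[OF i that] D[OF that]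
        by (intro mult_mono) (auto intro: order_trans[OF norm_ge_zero])
    qed
    have Jx: "((\<lambda>t. (k i t * q x t) *\<^sub>C x) has_integral integral S (\<lambda>t. k i t * q x t) *\<^sub>C x) S"
      if "x \<in> X" for x
      using has_integral_linear[OF integrable_integral[OF kq(1)[OF i that]] scaleC.bounded_linear_left]
      by (simp add: o_def)
    have "((\<lambda>t. \<Sum>x\<in>X. (k i t * q x t) *\<^sub>C x) has_integral J i) S"
      unfolding J_def by (intro has_integral_sum X Jx)
    then have J2: "((\<lambda>t. k i t *\<^sub>C (\<Sum>x\<in>X. q x t *\<^sub>C x)) has_integral J i) S"
      by (simp add: scaleC.sum_right scaleC_scaleC)
    have "integral S (\<lambda>t. k i t *\<^sub>C h t) - J i
        = integral S (\<lambda>t. k i t *\<^sub>C (h t - (\<Sum>x\<in>X. q x t *\<^sub>C x)))"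
      using integral_unique[OF has_integral_diff[OF integrable_integral[OF I1] J2]]
      by (simp add: scaleC.diff_right)
    also have "norm \<dots> \<le> integral S (\<lambda>t. g i t * d)"
    proof (rule norm_integral_dominated[OF S])
      show "continuous_on S (\<lambda>t. k i t *\<^sub>C (h t - (\<Sum>x\<in>X. q x t *\<^sub>C x)))"
        by (intro scaleC.continuous_on k h i continuous_intros qcont)
      show "(\<lambda>t. g i t * d) integrable_on S" using g(1)[OF i] by (rule integrable_on_mult_left)
      show "norm (k i t *\<^sub>C (h t - (\<Sum>x\<in>X. q x t *\<^sub>C x))) \<le> g i t * d" if "t \<in> S" for t
        unfolding norm_scaleC using k(2)[OF i that] hq[OF that]
        by (intro mult_mono) (auto intro: order_trans[OF norm_ge_zero])
    qed
    also have "\<dots> = integral S (g i) * d" by simp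
    also have "\<dots> \<le> C * d" using g(2)[OF i] d(1) by (intro mult_right_mono) auto
    finally show ?thesis using d(2) by simp
  qed
  ultimately show "\<exists>f. relatively_compact (f ` I) \<and>
      (\<forall>i\<in>I. norm (integral S (\<lambda>t. k i t *\<^sub>C h t) - f i) \<le> e)"
    by blast
qed


section \<open>Smooth functions and cutoffs\<close>

abbreviation deriv_fun :: "(real \<Rightarrow> complex) \<Rightarrow> real \<Rightarrow> complex" where
  "deriv_fun f \<equiv> (\<lambda>t. vector_derivative f (at t))"

lemma nth_deriv_0 [simp]: "nth_deriv 0 f = f"
  and nth_deriv_Suc: "nth_deriv (Suc k) f = deriv_fun (nth_deriv k f)"
  by (simp_all add: nth_deriv_def)

lemma nth_deriv_Suc': "nth_deriv (Suc k) f = nth_deriv k (deriv_fun f)"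
  unfolding nth_deriv_def by (simp only: funpow_Suc_right o_apply)

lemma smooth_has_vector_derivative:
  assumes "smooth f"
  shows "(f has_vector_derivative deriv_fun f t) (at t)" "smooth (deriv_fun f)"
proof -
  have "nth_deriv 0 f differentiable (at t)" for t
    using assms unfolding smooth_def by blast
  then show "(f has_vector_derivative deriv_fun f t) (at t)"
    using vector_derivative_works by auto
  show "smooth (deriv_fun f)"
    using assms unfolding smooth_def nth_deriv_Suc'[symmetric] by blast
qed

lemma deriv_fun_eq_0:
  assumes "\<forall>\<^sub>F s in nhds t. f s = 0"
  shows "deriv_fun f t = 0"
proof (rule vector_derivative_at)
  show "(f has_vector_derivative 0) (at t)"
    using assms eventually_nhds_x_imp_x[OF assms]
    by (subst has_vector_derivative_cong_ev[of UNIV f "\<lambda>_. 0" t]) auto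
qed

lemma smooth_coinduct:
  assumes "f \<in> F"
    and step: "\<And>f. f \<in> F \<Longrightarrow> \<exists>f'\<in>F. \<forall>t. (f has_vector_derivative f' t) (at t)"
  shows "smooth f"
proof -
  have "nth_deriv k f \<in> F" for k
  proof (induction k)
    case (Suc k)
    then obtain f' where f': "f' \<in> F" "\<forall>t. (nth_deriv k f has_vector_derivative f' t) (at t)"
      using step by blast
    then have "nth_deriv (Suc k) f = f'"
      by (auto simp: nth_deriv_Suc vector_derivative_at)
    then show ?case using f' by simp
  qed (use assms in simp)
  then show ?thesis
    unfolding smooth_def using step by (meson differentiableI_vector)
qed

text \<open>The algebra of functions generated by \<^term>\<open>F\<close> and all smooth functions. If the derivatives of
  the generators lie in it, then it is closed under differentiation, so that all its members
  are smooth. This gives the closure properties of smoothness without Leibniz formulas.\<close>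

inductive_set smooth_algebra :: "(real \<Rightarrow> complex) set \<Rightarrow> (real \<Rightarrow> complex) set"
  for F where
  generator: "f \<in> F \<Longrightarrow> f \<in> smooth_algebra F"
| smooth: "smooth f \<Longrightarrow> f \<in> smooth_algebra F"
| add: "f \<in> smooth_algebra F \<Longrightarrow> g \<in> smooth_algebra F \<Longrightarrow> (\<lambda>t. f t + g t) \<in> smooth_algebra F"
| mult: "f \<in> smooth_algebra F \<Longrightarrow> g \<in> smooth_algebra F \<Longrightarrow> (\<lambda>t. f t * g t) \<in> smooth_algebra F"
| affine: "f \<in> smooth_algebra F \<Longrightarrow> (\<lambda>t. f (a * t + b)) \<in> smooth_algebra F"
| inverse: "f \<in> smooth_algebra F \<Longrightarrow> (\<And>t. f t \<noteq> 0) \<Longrightarrow> (\<lambda>t. inverse (f t)) \<in> smooth_algebra F"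

lemma smooth_const: "smooth (\<lambda>t. c)"
  by (rule smooth_coinduct[of _ "range (\<lambda>c t. c)"]) (auto intro!: derivative_eq_intros)

lemma smooth_algebra_closed:
  assumes "\<And>f. f \<in> F \<Longrightarrow> \<exists>f'\<in>smooth_algebra F. \<forall>t. (f has_vector_derivative f' t) (at t)"
    and "f \<in> smooth_algebra F"
  shows "\<exists>f'\<in>smooth_algebra F. \<forall>t. (f has_vector_derivative f' t) (at t)"
  using assms(2)
proof induction
  case (generator f)
  then show ?case by (rule assms(1))
next
  case (smooth f)
  then show ?case
    by (intro bexI[of _ "deriv_fun f"] allI smooth_has_vector_derivative smooth_algebra.smooth)
next
  case (add f g)
  then obtain f' g' where "f' \<in> smooth_algebra F" "g' \<in> smooth_algebra F"
    "\<forall>t. (f has_vector_derivative f' t) (at t)" "\<forall>t. (g has_vector_derivative g' t) (at t)"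
    by blast
  then show ?case
    by (intro bexI[of _ "\<lambda>t. f' t + g' t"] smooth_algebra.add)
       (auto intro: has_vector_derivative_add)
next
  case (mult f g)
  then obtain f' g' where fg: "f' \<in> smooth_algebra F" "g' \<in> smooth_algebra F"
    "\<forall>t. (f has_vector_derivative f' t) (at t)" "\<forall>t. (g has_vector_derivative g' t) (at t)"
    by blast
  show ?case
    using mult.hyps fg
    by (intro bexI[of _ "\<lambda>t. f t * g' t + f' t * g t"] smooth_algebra.add smooth_algebra.mult)
       (auto intro: has_vector_derivative_mult)
next
  case (affine f a b)
  then obtain f' where f': "f' \<in> smooth_algebra F" "\<forall>t. (f has_vector_derivative f' t) (at t)"
    by blast
  have "((\<lambda>t. f (a * t + b)) has_vector_derivative complex_of_real a * f' (a * t + b)) (at t)" for t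
  proof -
    have "((\<lambda>t. a * t + b) has_vector_derivative a) (at t)"
      by (auto intro!: derivative_eq_intros)
    from vector_diff_chain_at[OF this f'(2)[rule_format]]
    show ?thesis by (simp add: o_def scaleR_conv_of_real)
  qed
  then show ?case
    using f'(1) by (intro bexI[of _ "\<lambda>t. of_real a * f' (a * t + b)"] smooth_algebra.mult
        smooth_algebra.smooth[OF smooth_const] smooth_algebra.affine) auto
next
  case (inverse f)
  then obtain f' where f': "f' \<in> smooth_algebra F" "\<forall>t. (f has_vector_derivative f' t) (at t)"
    by blast
  have "((\<lambda>t. inverse (f t)) has_vector_derivative (- 1) * (f' t * (inverse (f t) * inverse (f t)))) (at t)" for t
  proof -
    have "(inverse has_field_derivative - (inverse (f t) * inverse (f t))) (at (f t))"
      using inverse.hyps by (auto intro!: derivative_eq_intros)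
    from field_vector_diff_chain_at[OF f'(2)[rule_format] this]
    show ?thesis by (simp add: o_def)
  qed
  then show ?case
    using f'(1) inverse.hyps
    by (intro bexI[of _ "\<lambda>t. (- 1) * (f' t * (inverse (f t) * inverse (f t)))"] smooth_algebra.mult
        smooth_algebra.smooth[OF smooth_const] smooth_algebra.inverse) auto
qed

lemma smooth_algebra_smooth:
  assumes "\<And>f. f \<in> F \<Longrightarrow> \<exists>f'\<in>smooth_algebra F. \<forall>t. (f has_vector_derivative f' t) (at t)"
    and "f \<in> smooth_algebra F"
  shows "smooth f"
  using smooth_coinduct[of f "smooth_algebra F"] assms smooth_algebra_closed by blast

lemma smooth_add: "smooth f \<Longrightarrow> smooth g \<Longrightarrow> smooth (\<lambda>t. f t + g t)"
  and smooth_mult: "smooth f \<Longrightarrow> smooth g \<Longrightarrow> smooth (\<lambda>t. f t * g t)"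
  and smooth_affine: "smooth f \<Longrightarrow> smooth (\<lambda>t. f (a * t + b))"
  and smooth_inverse: "smooth f \<Longrightarrow> (\<And>t. f t \<noteq> 0) \<Longrightarrow> smooth (\<lambda>t. inverse (f t))"
  by (rule smooth_algebra_smooth[of "{}"];
      auto intro: smooth_algebra.add smooth_algebra.mult smooth_algebra.affine
        smooth_algebra.inverse smooth_algebra.smooth)+

lemma smooth_of_real: "smooth complex_of_real"
  by (rule smooth_coinduct[of _ "insert complex_of_real (range (\<lambda>c t. c))"])
     (auto intro!: derivative_eq_intros has_vector_derivative_of_real)

lemma smooth_cis: "smooth (\<lambda>t. exp (\<i> * of_real (s * t)))"
proof (rule smooth_coinduct[of _ "range (\<lambda>c t. c * exp (\<i> * of_real (s * t)))"])
  show "(\<lambda>t. exp (\<i> * of_real (s * t))) \<in> range (\<lambda>c t. c * exp (\<i> * of_real (s * t)))"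
    by (rule image_eqI[of _ _ 1]) auto
next
  fix f :: "real \<Rightarrow> complex" assume "f \<in> range (\<lambda>c t. c * exp (\<i> * of_real (s * t)))"
  then obtain c where f: "f = (\<lambda>t. c * exp (\<i> * of_real (s * t)))" by blast
  have "(f has_vector_derivative (c * (\<i> * of_real s)) * exp (\<i> * of_real (s * t))) (at t)" for t
  proof -
    have "((\<lambda>z. c * exp (\<i> * (of_real s * z))) has_field_derivative
        (c * (\<i> * of_real s)) * exp (\<i> * (of_real s * of_real t))) (at (of_real t))"
      by (auto intro!: derivative_eq_intros)
    from has_vector_derivative_real_field[OF this] show ?thesis by (simp add: f)
  qed
  then show "\<exists>f'\<in>range (\<lambda>c t. c * exp (\<i> * of_real (s * t))). \<forall>t. (f has_vector_derivative f' t) (at t)"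
    by (intro bexI[of _ "\<lambda>t. (c * (\<i> * of_real s)) * exp (\<i> * of_real (s * t))"]) auto
qed

text \<open>The function \<open>x\<^sup>-\<^sup>k exp(-1/x)\<close>, continued by \<open>0\<close>. The derivative of each member of this family is a
  combination of two others, so \<open>smooth_algebra\<close> yields smoothness of all of them at once.\<close>

definition flat :: "nat \<Rightarrow> real \<Rightarrow> real" where
  "flat k x = (if x > 0 then (1 / x) ^ k * exp (- (1 / x)) else 0)"

text \<open>The exponential series dominates each of its terms. The quadratic bound makes the derivative
  at \<open>0\<close> vanish.\<close>

lemma flat_bound: "\<bar>flat k x\<bar> \<le> fact (k + 2) * x\<^sup>2"
proof (cases "x > 0")
  case True
  define u where "u = 1 / x"
  have u: "u > 0" "x = 1 / u" using True by (auto simp: u_def)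
  define F :: real where "F = fact (k + 2)"
  have "F > 0" by (simp add: F_def)
  have "u ^ (k + 2) / F \<le> exp u"
    using sum_le_suminf[OF sums_summable[OF exp_converges[of u]], of "{k + 2}"]
      sums_unique[OF exp_converges[of u]] u(1)
    by (simp add: F_def divide_inverse mult.commute del: fact_Suc power_Suc)
  then have "u ^ (k + 2) * exp (- u) \<le> F"
    using \<open>F > 0\<close> by (simp add: exp_minus field_simps)
  then have "u ^ k * exp (- u) \<le> F * (1 / u)\<^sup>2"
    using u by (simp add: field_simps power_add power2_eq_square)
  then show ?thesis using True u by (simp add: flat_def F_def)
qed (simp add: flat_def)

lemma flat_derivative:
  "(flat k has_real_derivative flat (k + 2) x + (- real k) * flat (k + 1) x) (at x)"
proof -
  consider "x > 0" | "x < 0" | "x = 0" by linarith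
  then show ?thesis
  proof cases
    case 1
    have "((\<lambda>x. (1 / x) ^ k * exp (- (1 / x))) has_real_derivative
        flat (k + 2) x + (- real k) * flat (k + 1) x) (at x)"
    proof -
      have "((\<lambda>x. (1 / x) ^ k * exp (- (1 / x))) has_real_derivative
          real k * (1 / x) ^ (k - 1) * (- (1 / x)\<^sup>2) * exp (- (1 / x)) +
          (1 / x) ^ k * (exp (- (1 / x)) * (1 / x)\<^sup>2)) (at x)"
        using 1 by (auto intro!: derivative_eq_intros simp: power2_eq_square)
      moreover have "real k * u ^ (k - 1) * (- u\<^sup>2) = - real k * u ^ (k + 1)" for u :: real
        by (cases k) (simp_all add: power2_eq_square algebra_simps)
      moreover have "- real k * (1 / x) ^ (k + 1) * exp (- (1 / x)) +
          (1 / x) ^ k * (exp (- (1 / x)) * (1 / x)\<^sup>2) = flat (k + 2) x + (- real k) * flat (k + 1) x"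
        using 1 by (simp add: flat_def power_add power2_eq_square)
      ultimately show ?thesis by (simp only:)
    qed
    moreover have "\<forall>\<^sub>F y in nhds x. flat k y = (1 / y) ^ k * exp (- (1 / y))"
      using eventually_nhds_in_open[of "{0<..}" x] 1
      by (auto elim!: eventually_mono simp: flat_def)
    ultimately show ?thesis by (subst DERIV_cong_ev) auto
  next
    case 2
    have "\<forall>\<^sub>F y in nhds x. flat k y = 0"
      using eventually_nhds_in_open[of "{..<0}" x] 2
      by (auto elim!: eventually_mono simp: flat_def)
    then show ?thesis using 2 by (subst DERIV_cong_ev[of x x _ "\<lambda>_. 0"]) (auto simp: flat_def)
  next
    case 3
    have "((\<lambda>h. (flat k (0 + h) - flat k 0) / h) \<longlongrightarrow> 0) (at 0)"
    proof (rule Lim_null_comparison)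
      show "\<forall>\<^sub>F h in at 0. norm ((flat k (0 + h) - flat k 0) / h) \<le> fact (k + 2) * \<bar>h\<bar>"
      proof (rule eventually_at_filter[THEN iffD2], rule always_eventually, intro allI impI)
        fix h :: real assume "h \<noteq> 0"
        then show "norm ((flat k (0 + h) - flat k 0) / h) \<le> fact (k + 2) * \<bar>h\<bar>"
          using flat_bound[of k h]
          by (simp add: flat_def[of k 0] field_simps power2_eq_square abs_mult[symmetric] del: fact_Suc)
      qed
      show "((\<lambda>h::real. fact (k + 2) * \<bar>h\<bar>) \<longlongrightarrow> 0) (at 0)"
        by (auto intro!: tendsto_eq_intros)
    qed
    then show ?thesis using 3 by (simp add: DERIV_def flat_def)
  qed
qed

lemma smooth_flat: "smooth (\<lambda>t. of_real (flat k t))"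
proof (rule smooth_algebra_smooth[of "range (\<lambda>k t. complex_of_real (flat k t))"])
  fix f :: "real \<Rightarrow> complex" assume "f \<in> range (\<lambda>k t. complex_of_real (flat k t))"
  then obtain k where f: "f = (\<lambda>t. of_real (flat k t))" by blast
  have "(f has_vector_derivative (of_real (flat (k + 2) t) + of_real (- real k) * of_real (flat (k + 1) t))) (at t)" for t
    using has_vector_derivative_of_real[OF flat_derivative[of k t]]
    unfolding f by simp
  then show "\<exists>f'\<in>smooth_algebra (range (\<lambda>k t. complex_of_real (flat k t))).
      \<forall>t. (f has_vector_derivative f' t) (at t)"
    by (intro bexI[of _ "\<lambda>t. of_real (flat (k + 2) t) + of_real (- real k) * of_real (flat (k + 1) t)"]
        smooth_algebra.add smooth_algebra.mult smooth_algebra.smooth[OF smooth_const]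
        smooth_algebra.generator) auto
qed (auto intro: smooth_algebra.generator)

text \<open>The denominator never vanishes because \<open>t\<close> and \<open>1 - t\<close> are not both nonpositive.\<close>

definition smooth_step :: "real \<Rightarrow> real" where
  "smooth_step t = flat 0 t / (flat 0 t + flat 0 (1 - t))"

lemma smooth_step_denominator: "flat 0 t + flat 0 (1 - t) > 0"
  by (cases "t > 0") (auto simp: flat_def add_pos_nonneg)

lemma smooth_step_values:
  "0 \<le> smooth_step t" "smooth_step t \<le> 1" "t \<le> 0 \<Longrightarrow> smooth_step t = 0" "1 \<le> t \<Longrightarrow> smooth_step t = 1"
proof -
  have "flat 0 t \<ge> 0" "flat 0 (1 - t) \<ge> 0" by (auto simp: flat_def)
  then show "0 \<le> smooth_step t" "smooth_step t \<le> 1"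
    using smooth_step_denominator[of t] by (auto simp: smooth_step_def)
  show "t \<le> 0 \<Longrightarrow> smooth_step t = 0" by (simp add: smooth_step_def flat_def)
  show "1 \<le> t \<Longrightarrow> smooth_step t = 1"
    using smooth_step_denominator[of t] by (simp add: smooth_step_def flat_def)
qed

lemma smooth_smooth_step: "smooth (\<lambda>t. of_real (smooth_step (a * t + b)))"
proof -
  have "smooth (\<lambda>t. of_real (flat 0 t) * inverse (of_real (flat 0 t) + of_real (flat 0 ((- 1) * t + 1))))"
  proof (intro smooth_mult smooth_inverse smooth_add smooth_flat
      smooth_affine[of "\<lambda>t. of_real (flat 0 t)"])
    fix t show "complex_of_real (flat 0 t) + of_real (flat 0 ((- 1) * t + 1)) \<noteq> 0"
      using smooth_step_denominator[of t]
      by (metis add.commute mult_minus1 of_real_add of_real_eq_0_iff order_less_irrefl uminus_add_conv_diff)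
  qed
  then have "smooth (\<lambda>t. complex_of_real (smooth_step t))"
    by (simp add: smooth_step_def divide_inverse)
  from smooth_affine[OF this] show ?thesis .
qed

definition cutoff :: "real \<Rightarrow> real" where
  "cutoff t = smooth_step (2 + t) * smooth_step (2 - t)"

lemma cutoff_values:
  "0 \<le> cutoff t" "cutoff t \<le> 1" "\<bar>t\<bar> \<le> 1 \<Longrightarrow> cutoff t = 1" "2 \<le> \<bar>t\<bar> \<Longrightarrow> cutoff t = 0"
  "cutoff (- t) = cutoff t"
  using smooth_step_values[of "2 + t"] smooth_step_values[of "2 - t"]
  by (auto simp: cutoff_def mult_le_one abs_if split: if_splits)

lemma smooth_cutoff: "smooth (\<lambda>t. of_real (cutoff (a * t + b)))"
proof -
  have "smooth (\<lambda>t. of_real (smooth_step (1 * t + 2)) * of_real (smooth_step ((- 1) * t + 2)))"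
    by (intro smooth_mult smooth_smooth_step)
  then have "smooth (\<lambda>t. complex_of_real (cutoff t))"
    by (simp add: cutoff_def add.commute)
  from smooth_affine[OF this] show ?thesis .
qed

lemma smooth_continuous: "smooth f \<Longrightarrow> continuous_on S f"
  using smooth_has_vector_derivative(1)
  by (meson continuous_at_imp_continuous_on has_vector_derivative_continuous)

lemma deriv_fun_mult:
  assumes "smooth f" "smooth g"
  shows "deriv_fun (\<lambda>t. f t * g t) t = f t * deriv_fun g t + deriv_fun f t * g t"
  by (rule vector_derivative_at)
     (intro has_vector_derivative_mult smooth_has_vector_derivative assms)

lemma deriv_fun_add:
  assumes "smooth f" "smooth g"
  shows "deriv_fun (\<lambda>t. f t + g t) t = deriv_fun f t + deriv_fun g t"
  by (rule vector_derivative_at)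
     (intro has_vector_derivative_add smooth_has_vector_derivative assms)

lemma deriv_fun_affine:
  assumes "smooth f"
  shows "deriv_fun (\<lambda>t. f (a * t + b)) t = of_real a * deriv_fun f (a * t + b)"
proof (rule vector_derivative_at)
  have "((\<lambda>t. a * t + b) has_vector_derivative a) (at t)"
    by (auto intro!: derivative_eq_intros)
  from vector_diff_chain_at[OF this smooth_has_vector_derivative(1)[OF assms]]
  show "((\<lambda>t. f (a * t + b)) has_vector_derivative of_real a * deriv_fun f (a * t + b)) (at t)"
    by (simp add: o_def scaleR_conv_of_real)
qed

lemma deriv_fun_const_mult:
  assumes "smooth f"
  shows "deriv_fun (\<lambda>t. c * f t) t = c * deriv_fun f t"
  by (rule vector_derivative_at)
     (intro has_vector_derivative_mult_right smooth_has_vector_derivative assms)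

lemma nth_deriv_2_affine:
  assumes "smooth f"
  shows "nth_deriv 2 (\<lambda>t. f (a * t + b)) = (\<lambda>t. of_real a ^ 2 * nth_deriv 2 f (a * t + b))"
proof -
  note f' = smooth_has_vector_derivative(2)[OF assms]
  show ?thesis
    by (simp add: numeral_2_eq_2 nth_deriv_Suc deriv_fun_affine[OF assms] deriv_fun_affine[OF f'] f' deriv_fun_const_mult[OF smooth_affine[OF f']] mult.assoc)
qed

lemma nth_deriv_2_mult:
  assumes "smooth f" "smooth g"
  shows "nth_deriv 2 (\<lambda>t. f t * g t) =
    (\<lambda>t. f t * nth_deriv 2 g t + 2 * (deriv_fun f t * deriv_fun g t) + nth_deriv 2 f t * g t)"
proof -
  note s = assms smooth_has_vector_derivative(2)[OF assms(1)] smooth_has_vector_derivative(2)[OF assms(2)]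
  show ?thesis
    unfolding numeral_2_eq_2 nth_deriv_Suc nth_deriv_0 deriv_fun_mult[OF s(1,2)]
      deriv_fun_add[OF smooth_mult[OF s(1,4)] smooth_mult[OF s(3,2)]]
      deriv_fun_mult[OF s(1,4)] deriv_fun_mult[OF s(3,2)]
    by (simp add: algebra_simps)
qed


section \<open>Test functions and their localisation\<close>

lemma test_functionsI:
  assumes "smooth \<phi>" "compact K" "K \<subseteq> I" "\<And>t. \<phi> t \<noteq> 0 \<Longrightarrow> t \<in> K"
  shows "\<phi> \<in> test_functions I"
proof -
  have "supp \<phi> \<subseteq> K"
    unfolding supp_def using assms by (intro closure_minimal) (auto intro: compact_imp_closed)
  then have "supp \<phi> = K \<inter> supp \<phi>" by blast
  then have "compact (supp \<phi>)"
    unfolding supp_def by (metis assms(2) closed_closure compact_Int_closed)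
  with \<open>supp \<phi> \<subseteq> K\<close> show ?thesis using assms by (auto simp: test_functions_def)
qed

lemma test_functionsD:
  assumes "\<phi> \<in> test_functions I"
  shows "smooth \<phi>" "compact (supp \<phi>)" "supp \<phi> \<subseteq> I" "\<phi> t \<noteq> 0 \<Longrightarrow> t \<in> supp \<phi>"
  using assms closure_subset[of "{t. \<phi> t \<noteq> 0}"] by (auto simp: test_functions_def supp_def)

lemma test_functions_bounded_support:
  assumes "\<phi> \<in> test_functions I"
  obtains N where "N > 0" "\<And>t. \<bar>t\<bar> \<ge> N \<Longrightarrow> \<phi> t = 0"
proof -
  obtain N where "N > 0" "\<And>t. t \<in> supp \<phi> \<Longrightarrow> \<bar>t\<bar> < N"
    using compact_imp_bounded[OF test_functionsD(2)[OF assms]] bounded_pos_less[of "supp \<phi>"] by auto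
  then show ?thesis using that[of N] test_functionsD(4)[OF assms] by (meson not_less)
qed

lemma test_functions_mult:
  assumes "\<phi> \<in> test_functions I" "smooth w"
  shows "(\<lambda>t. w t * \<phi> t) \<in> test_functions I"
  using test_functionsD[OF assms(1)] assms(2)
  by (intro test_functionsI[of _ "supp \<phi>"] smooth_mult) auto

lemma test_functions_mono: "I \<subseteq> J \<Longrightarrow> test_functions I \<subseteq> test_functions J"
  by (auto simp: test_functions_def)

lemma test_functions_deriv:
  assumes "\<phi> \<in> test_functions I"
  shows "deriv_fun \<phi> \<in> test_functions I"
proof (rule test_functionsI)
  show "smooth (deriv_fun \<phi>)" "compact (supp \<phi>)" "supp \<phi> \<subseteq> I"
    using test_functionsD[OF assms] smooth_has_vector_derivative(2) by auto
  show "t \<in> supp \<phi>" if "deriv_fun \<phi> t \<noteq> 0" for t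
  proof (rule ccontr)
    assume "t \<notin> supp \<phi>"
    then have "t \<in> - supp \<phi>" by simp
    moreover have "open (- supp \<phi>)" unfolding supp_def by (rule open_Compl) simp
    ultimately have "\<forall>\<^sub>F s in nhds t. s \<in> - supp \<phi>"
      by (rule_tac eventually_nhds_in_open)
    then have "\<forall>\<^sub>F s in nhds t. \<phi> s = 0"
      by eventually_elim (use test_functionsD(4)[OF assms] in blast)
    then show False using that by (simp add: deriv_fun_eq_0)
  qed
qed

lemma test_function_bounded:
  assumes "\<phi> \<in> test_functions I"
  obtains B where "B \<ge> 0" "\<And>\<xi>. norm (\<phi> \<xi>) \<le> B"
proof -
  obtain N where N: "N > 0" "\<And>t. \<bar>t\<bar> \<ge> N \<Longrightarrow> \<phi> t = 0"
    using test_functions_bounded_support[OF assms] by blast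
  have "compact (\<phi> ` {-N..N})"
    using smooth_continuous[OF test_functionsD(1)[OF assms]] by (intro compact_continuous_image) auto
  then obtain B where B: "B > 0" "\<And>z. z \<in> \<phi> ` {-N..N} \<Longrightarrow> norm z \<le> B"
    using compact_imp_bounded bounded_pos by metis
  have "norm (\<phi> \<xi>) \<le> B" for \<xi>
  proof (cases "\<bar>\<xi>\<bar> \<ge> N")
    case False
    then have "\<xi> \<in> {-N..N}" by auto
    then show ?thesis using B(2) by blast
  qed (use B(1) N(2) in auto)
  then show ?thesis using that[of B] B(1) by simp
qed

text \<open>A property of test functions that is local and additive holds globally. The partition of unity
  consists of the differences of consecutive translates of a smooth step; their sum telescopes,
  and their supports are shorter than the Lebesgue number of the covering of the support.\<close>

lemma test_functions_localize:
  assumes \<phi>: "\<phi> \<in> test_functions U"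
    and zero: "P (\<lambda>t. 0)"
    and loc: "\<And>\<xi>. \<xi> \<in> U \<Longrightarrow> \<exists>J. open J \<and> \<xi> \<in> J \<and> (\<forall>\<psi>\<in>test_functions J. P \<psi>)"
    and add: "\<And>\<psi> \<eta>. \<psi> \<in> test_functions U \<Longrightarrow> \<eta> \<in> test_functions U \<Longrightarrow> P \<psi> \<Longrightarrow> P \<eta> \<Longrightarrow> P (\<lambda>t. \<psi> t + \<eta> t)"
  shows "P \<phi>"
proof -
  define \<C> where "\<C> = {J. open J \<and> (\<forall>\<psi>\<in>test_functions J. P \<psi>)}"
  show ?thesis
  proof (cases "supp \<phi> = {}")
    case True
    then have "\<phi> = (\<lambda>t. 0)" using test_functionsD(4)[OF \<phi>] by blast
    then show ?thesis using zero by simp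
  next
    case False
    have "supp \<phi> \<subseteq> \<Union>\<C>" using loc test_functionsD(3)[OF \<phi>] unfolding \<C>_def by blast
    moreover from this False have "\<C> \<noteq> {}" by blast
    ultimately obtain \<delta> where \<delta>: "\<delta> > 0" "\<And>T. T \<subseteq> supp \<phi> \<Longrightarrow> diameter T < \<delta> \<Longrightarrow> \<exists>J\<in>\<C>. T \<subseteq> J"
      using Lebesgue_number_lemma[OF test_functionsD(2)[OF \<phi>]] unfolding \<C>_def by (metis (no_types, lifting) mem_Collect_eq)
    \<comment> \<open>The windows \<open>w c\<close> below are supported in intervals of length \<open>2 * d\<close>, shorter than \<open>\<delta>\<close>.\<close>
    define d where "d = \<delta> / 4"
    have d: "d > 0" "2 * d < \<delta>" using \<delta>(1) by (auto simp: d_def)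
    define w where "w = (\<lambda>c t. complex_of_real (smooth_step ((1/d) * t + c)) - of_real (smooth_step ((1/d) * t + (c - 1))))"
    have sw: "smooth (\<lambda>t. of_real (smooth_step ((1/d) * t + c)) + (- 1) * complex_of_real (smooth_step ((1/d) * t + c')))" for c c'
      by (intro smooth_add smooth_mult smooth_const smooth_smooth_step)
    have w\<phi>: "(\<lambda>t. w c t * \<phi> t) \<in> test_functions U" for c
      using test_functions_mult[OF \<phi> sw[of c "c - 1"]] by (simp add: w_def)
    have Pw: "P (\<lambda>t. w c t * \<phi> t)" for c
    proof -
      define T where "T = supp \<phi> \<inter> {- c * d..(2 - c) * d}"
      have "diameter T \<le> 2 * d"
        by (rule diameter_le) (use d in \<open>auto simp: T_def algebra_simps\<close>)
      then obtain J where J: "J \<in> \<C>" "T \<subseteq> J" using \<delta>(2)[of T] d by (auto simp: T_def)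
      have "(\<lambda>t. w c t * \<phi> t) \<in> test_functions J"
      proof (rule test_functionsI[OF _ _ J(2)])
        show "smooth (\<lambda>t. w c t * \<phi> t)" by (rule test_functionsD(1)[OF w\<phi>])
        show "compact T" unfolding T_def using test_functionsD(2)[OF \<phi>] by (intro compact_Int_closed) auto
        fix t assume t: "w c t * \<phi> t \<noteq> 0"
        have "- c \<le> (1/d) * t"
        proof (rule ccontr)
          assume "\<not> - c \<le> (1/d) * t"
          then have "w c t = 0" by (simp add: w_def smooth_step_values(3))
          then show False using t by simp
        qed
        moreover have "(1/d) * t \<le> 2 - c"
        proof (rule ccontr)
          assume "\<not> (1/d) * t \<le> 2 - c"
          then have "w c t = 0" by (simp add: w_def smooth_step_values(4))
          then show False using t by simp
        qed
        ultimately show "t \<in> T" using t test_functionsD(4)[OF \<phi>, of t] d(1) by (simp add: T_def field_simps)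
      qed
      then show ?thesis using J(1) by (simp add: \<C>_def)
    qed
    \<comment> \<open>\<open>W m n\<close> is the telescoping sum of the \<open>n\<close> windows \<open>w m, w (m - 1), \<dots>\<close>\<close>
    define W where "W = (\<lambda>(m::nat) n t. complex_of_real (smooth_step ((1/d) * t + m)) - of_real (smooth_step ((1/d) * t + (real m - real n))))"
    have W: "P (\<lambda>t. W m n t * \<phi> t)" for m n
    proof (induction n)
      case 0
      then show ?case using zero by (simp add: W_def)
    next
      case (Suc n)
      have "(\<lambda>t. W m n t * \<phi> t) \<in> test_functions U"
        using test_functions_mult[OF \<phi> sw[of m "real m - real n"]] by (simp add: W_def)
      from add[OF this w\<phi> Suc Pw, of "real m - real n"]
      have "P (\<lambda>t. W m n t * \<phi> t + w (real m - real n) t * \<phi> t)" .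
      moreover have "(\<lambda>t. W m n t * \<phi> t + w (real m - real n) t * \<phi> t) = (\<lambda>t. W m (Suc n) t * \<phi> t)"
        by (rule ext) (simp add: W_def w_def algebra_simps)
      ultimately show ?case by simp
    qed
    obtain N where N: "N > 0" "\<And>t. \<bar>t\<bar> \<ge> N \<Longrightarrow> \<phi> t = 0"
      using test_functions_bounded_support[OF \<phi>] by blast
    obtain m :: nat where m: "real m \<ge> N / d + 1" using real_arch_simple by blast
    have "W m (2 * m) t * \<phi> t = \<phi> t" for t
    proof (cases "\<bar>t\<bar> \<ge> N")
      case False
      then have "\<bar>(1/d) * t\<bar> \<le> N / d" using d(1) by (simp add: abs_mult divide_right_mono)
      then have "1 \<le> (1/d) * t + m" "(1/d) * t + (real m - real (2 * m)) \<le> 0"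
        using m unfolding abs_le_iff by linarith+
      then have "W m (2 * m) t = 1" unfolding W_def by (simp only: smooth_step_values(3,4)) simp
      then show ?thesis by simp
    qed (use N(2) in simp)
    then have "(\<lambda>t. W m (2 * m) t * \<phi> t) = \<phi>" by (rule ext)
    then show ?thesis using W[of m "2 * m"] by (simp only:)
  qed
qed


section \<open>Fourier transforms of test functions\<close>

lemma integral_UNIV_eq:
  fixes f :: "real \<Rightarrow> 'a::banach"
  assumes "\<And>t. t \<notin> S \<Longrightarrow> f t = 0"
  shows "integral UNIV f = integral S f"
proof -
  have "f = (\<lambda>t. if t \<in> S then f t else 0)" using assms by auto
  then show ?thesis by (metis integral_restrict_UNIV)
qed

lemma norm_exp_ii [simp]: "norm (exp (- \<i> * of_real x * of_real y)) = 1"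
proof -
  have "exp (- \<i> * of_real x * of_real y) = exp (\<i> * of_real (- (x * y)))"
    by (simp add: mult.assoc)
  then show ?thesis by (metis norm_exp_i_times)
qed

lemma fourier_eq:
  assumes "\<And>\<xi>. \<xi> \<notin> {a<..<b} \<Longrightarrow> \<phi> \<xi> = 0"
  shows "fourier \<phi> t = integral {a..b} (\<lambda>\<xi>. exp (- \<i> * of_real t * of_real \<xi>) * \<phi> \<xi>)"
  unfolding fourier_def by (rule integral_UNIV_eq) (use assms in auto)

lemma continuous_on_fourier_integrand [continuous_intros]:
  assumes "smooth \<phi>"
  shows "continuous_on S (\<lambda>\<xi>. exp (- \<i> * of_real t * of_real \<xi>) * \<phi> \<xi>)"
  by (intro continuous_intros smooth_continuous assms)

lemma fourier_cong_zero:
  assumes "\<And>\<xi>. \<bar>\<xi>\<bar> \<ge> N \<Longrightarrow> \<phi> \<xi> = 0"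
  shows "fourier \<phi> t = integral {-N..N} (\<lambda>\<xi>. exp (- \<i> * of_real t * of_real \<xi>) * \<phi> \<xi>)"
  by (rule fourier_eq) (use assms in force)

text \<open>Through this identity the values of a distribution on modulated test functions form a
  convolution.\<close>

lemma fourier_modulate:
  "fourier (\<lambda>\<xi>. exp (\<i> * of_real (s * \<xi>)) * \<phi> \<xi>) t = fourier \<phi> (t - s)"
proof -
  have "exp (- \<i> * of_real t * of_real \<xi>) * (exp (\<i> * of_real (s * \<xi>)) * \<phi> \<xi>)
      = exp (- \<i> * of_real (t - s) * of_real \<xi>) * \<phi> \<xi>" for \<xi> :: real
    unfolding mult.assoc[symmetric] exp_add[symmetric] by (simp add: algebra_simps)
  then show ?thesis unfolding fourier_def by (simp only:)
qed

lemma continuous_on_fourier: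
  assumes "\<phi> \<in> test_functions I"
  shows "continuous_on S (fourier \<phi>)"
proof -
  obtain N where N: "N > 0" "\<And>t. \<bar>t\<bar> \<ge> N \<Longrightarrow> \<phi> t = 0"
    using test_functions_bounded_support[OF assms] by blast
  have "continuous_on (S \<times> cbox (-N) N)
      (\<lambda>(t, \<xi>). exp (- \<i> * of_real t * of_real \<xi>) * \<phi> \<xi>)"
    unfolding split_beta
    by (intro continuous_intros continuous_on_compose2[OF smooth_continuous[of \<phi> UNIV]]
        test_functionsD[OF assms]) auto
  then have "continuous_on S (\<lambda>t. integral (cbox (-N) N) (\<lambda>\<xi>. exp (- \<i> * of_real t * of_real \<xi>) * \<phi> \<xi>))"
    by (rule integral_continuous_on_param)
  then show ?thesis using fourier_cong_zero[of N \<phi>, OF N(2)] by simp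
qed

lemma fourier_add:
  assumes "\<phi> \<in> test_functions I" "\<psi> \<in> test_functions I"
  shows "fourier (\<lambda>\<xi>. \<phi> \<xi> + \<psi> \<xi>) t = fourier \<phi> t + fourier \<psi> t"
proof -
  obtain N where N: "N > 0" "\<And>t. \<bar>t\<bar> \<ge> N \<Longrightarrow> \<phi> t = 0"
    using test_functions_bounded_support[OF assms(1)] by blast
  obtain M where M: "M > 0" "\<And>t. \<bar>t\<bar> \<ge> M \<Longrightarrow> \<psi> t = 0"
    using test_functions_bounded_support[OF assms(2)] by blast
  let ?L = "max M N"
  have "fourier (\<lambda>\<xi>. \<phi> \<xi> + \<psi> \<xi>) t
      = integral {-?L..?L} (\<lambda>\<xi>. exp (- \<i> * of_real t * of_real \<xi>) * \<phi> \<xi> + exp (- \<i> * of_real t * of_real \<xi>) * \<psi> \<xi>)"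
    using N M by (subst fourier_cong_zero[of ?L]) (auto simp: algebra_simps)
  also have "\<dots> = integral {-?L..?L} (\<lambda>\<xi>. exp (- \<i> * of_real t * of_real \<xi>) * \<phi> \<xi>)
      + integral {-?L..?L} (\<lambda>\<xi>. exp (- \<i> * of_real t * of_real \<xi>) * \<psi> \<xi>)"
    using test_functionsD(1) assms
    by (intro Henstock_Kurzweil_Integration.integral_add integrable_continuous_interval
        continuous_on_fourier_integrand)
  also have "\<dots> = fourier \<phi> t + fourier \<psi> t"
    using N M by (simp add: fourier_cong_zero[of ?L])
  finally show ?thesis .
qed

lemma fourier_mult: "fourier (\<lambda>\<xi>. c * \<phi> \<xi>) t = c * fourier \<phi> t"
proof -
  have "fourier (\<lambda>\<xi>. c * \<phi> \<xi>) t = integral UNIV (\<lambda>\<xi>. c * (exp (- \<i> * of_real t * of_real \<xi>) * \<phi> \<xi>))"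
    unfolding fourier_def by (simp add: mult.left_commute)
  then show ?thesis unfolding fourier_def by simp
qed

lemma norm_fourier_le:
  assumes "\<phi> \<in> test_functions I" "a \<le> b" "\<And>\<xi>. \<xi> \<notin> {a<..<b} \<Longrightarrow> \<phi> \<xi> = 0" "\<And>\<xi>. norm (\<phi> \<xi>) \<le> A"
  shows "norm (fourier \<phi> t) \<le> (b - a) * A"
proof -
  have eq: "fourier \<phi> t = integral {a..b} (\<lambda>\<xi>. exp (- \<i> * of_real t * of_real \<xi>) * \<phi> \<xi>)"
    by (rule fourier_eq) (rule assms(3))
  have "norm (fourier \<phi> t) \<le> integral {a..b} (\<lambda>\<xi>. A)"
    unfolding eq
  proof (rule Henstock_Kurzweil_Integration.integral_norm_bound_integral)
    show "(\<lambda>\<xi>. exp (- \<i> * of_real t * of_real \<xi>) * \<phi> \<xi>) integrable_on {a..b}"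
      using test_functionsD(1)[OF assms(1)]
      by (intro integrable_continuous_interval continuous_on_fourier_integrand)
    show "norm (exp (- \<i> * of_real t * of_real \<xi>) * \<phi> \<xi>) \<le> A" for \<xi>
      using assms(4) by (simp add: norm_mult)
  qed auto
  then show ?thesis using assms(2) by (simp add: mult.commute)
qed

lemma exp_ii_has_vector_derivative:
  "((\<lambda>\<xi>. exp (- \<i> * of_real t * of_real \<xi>)) has_vector_derivative
     (- \<i> * of_real t) * exp (- \<i> * of_real t * of_real \<xi>)) (at \<xi> within S)"
proof -
  have "((\<lambda>z. exp (- \<i> * of_real t * z)) has_field_derivative
      (- \<i> * of_real t) * exp (- \<i> * of_real t * of_real \<xi>)) (at (of_real \<xi>))"
    by (auto intro!: derivative_eq_intros)
  from has_vector_derivative_real_field[OF this] show ?thesis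
    by (rule has_vector_derivative_at_within)
qed

lemma fourier_deriv:
  assumes \<phi>: "\<phi> \<in> test_functions I"
  shows "fourier (deriv_fun \<phi>) t = \<i> * of_real t * fourier \<phi> t"
proof -
  obtain N where N: "N > 0" "\<And>t. \<bar>t\<bar> \<ge> N \<Longrightarrow> \<phi> t = 0"
    using test_functions_bounded_support[OF \<phi>] by blast
  obtain M where M: "M > 0" "\<And>t. \<bar>t\<bar> \<ge> M \<Longrightarrow> deriv_fun \<phi> t = 0"
    using test_functions_bounded_support[OF test_functions_deriv[OF \<phi>]] by blast
  define L where "L = max M N"
  let ?e = "\<lambda>\<xi>. exp (- \<i> * of_real t * of_real \<xi>)"
  have "((\<lambda>\<xi>. ?e \<xi> * deriv_fun \<phi> \<xi> + ((- \<i> * of_real t) * ?e \<xi>) * \<phi> \<xi>)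
      has_integral (?e L * \<phi> L - ?e (-L) * \<phi> (-L))) {-L..L}"
    using smooth_has_vector_derivative(1)[OF test_functionsD(1)[OF \<phi>]] N(1)
    by (intro fundamental_theorem_of_calculus has_vector_derivative_mult
        exp_ii_has_vector_derivative has_vector_derivative_at_within[OF smooth_has_vector_derivative(1)]
        test_functionsD(1)[OF \<phi>]) (auto simp: L_def)
  moreover have "\<phi> L = 0" "\<phi> (-L) = 0" using N by (auto simp: L_def)
  ultimately have "((\<lambda>\<xi>. ?e \<xi> * deriv_fun \<phi> \<xi> + (- \<i> * of_real t) * (?e \<xi> * \<phi> \<xi>)) has_integral 0) {-L..L}"
    by (simp add: mult.assoc)
  then have "0 = integral {-L..L} (\<lambda>\<xi>. ?e \<xi> * deriv_fun \<phi> \<xi> + (- \<i> * of_real t) * (?e \<xi> * \<phi> \<xi>))"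
    by (simp add: integral_unique)
  also have "\<dots> = integral {-L..L} (\<lambda>\<xi>. ?e \<xi> * deriv_fun \<phi> \<xi>) +
      integral {-L..L} (\<lambda>\<xi>. (- \<i> * of_real t) * (?e \<xi> * \<phi> \<xi>))"
    using test_functionsD(1)[OF \<phi>] test_functionsD(1)[OF test_functions_deriv[OF \<phi>]]
    by (intro Henstock_Kurzweil_Integration.integral_add integrable_continuous_interval
        continuous_on_fourier_integrand continuous_on_mult_left)
  also have "integral {-L..L} (\<lambda>\<xi>. ?e \<xi> * deriv_fun \<phi> \<xi>) = fourier (deriv_fun \<phi>) t"
    by (rule fourier_cong_zero[symmetric]) (use M in \<open>auto simp: L_def\<close>)
  also have "integral {-L..L} (\<lambda>\<xi>. (- \<i> * of_real t) * (?e \<xi> * \<phi> \<xi>)) = (- \<i> * of_real t) * fourier \<phi> t"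
    by (subst fourier_cong_zero[of L]) (use N in \<open>auto simp: L_def\<close>)
  finally show ?thesis by (simp add: eq_neg_iff_add_eq_0 add_eq_0_iff)
qed

text \<open>Two integrations by parts give quadratic decay. The parameter \<^term>\<open>\<rho>\<close> balances the bounds for
  \<^term>\<open>\<phi>\<close> and its second derivative; a good choice makes the \<open>L\<^sup>1\<close> norm of the transform of a function
  concentrated on a short interval small.\<close>

lemma fourier_decay:
  assumes \<phi>: "\<phi> \<in> test_functions I" and ab: "a \<le> b" "\<And>\<xi>. \<xi> \<notin> {a<..<b} \<Longrightarrow> \<phi> \<xi> = 0"
    and A: "\<And>\<xi>. norm (\<phi> \<xi>) \<le> A" and B: "\<And>\<xi>. norm (nth_deriv 2 \<phi> \<xi>) \<le> B"
  shows "norm (fourier \<phi> t) \<le> (b - a) * (A + \<rho>\<^sup>2 * B) / (1 + (\<rho> * t)\<^sup>2)"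
proof -
  let ?\<phi>2 = "nth_deriv 2 \<phi>"
  have \<phi>2_def: "?\<phi>2 = deriv_fun (deriv_fun \<phi>)"
    by (simp add: numeral_2_eq_2 nth_deriv_Suc)
  have \<phi>2: "?\<phi>2 \<in> test_functions I" unfolding \<phi>2_def by (intro test_functions_deriv \<phi>)
  have "deriv_fun \<psi> \<xi> = 0" if \<psi>: "\<psi> \<in> test_functions I" "\<And>\<xi>. \<xi> \<notin> {a<..<b} \<Longrightarrow> \<psi> \<xi> = 0" and "\<xi> \<notin> {a<..<b}" for \<psi> \<xi>
  proof -
    have c: "continuous_on UNIV (deriv_fun \<psi>)"
      using test_functionsD(1)[OF test_functions_deriv[OF \<psi>(1)]] by (rule smooth_continuous)
    have "deriv_fun \<psi> \<eta> = 0" if "\<eta> \<notin> {a..b}" for \<eta>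
    proof -
      have "\<eta> \<in> - {a..b}" using that by simp
      then have "\<forall>\<^sub>F y in nhds \<eta>. y \<in> - {a..b}"
        by (rule_tac eventually_nhds_in_open) auto
      then have "\<forall>\<^sub>F y in nhds \<eta>. \<psi> y = 0"
        by eventually_elim (use \<psi>(2) in force)
      then show ?thesis by (rule deriv_fun_eq_0)
    qed
    then have "deriv_fun \<psi> ` (- {a..b}) \<subseteq> {0}" by auto
    then have "deriv_fun \<psi> ` closure (- {a..b}) \<subseteq> {0}"
      using c by (intro image_closure_subset) (auto intro: continuous_on_subset)
    moreover have "\<xi> \<in> closure (- {a..b})"
      using \<open>\<xi> \<notin> {a<..<b}\<close> ab(1) by (cases "a = b") (auto simp: closure_complement interior_atLeastAtMost_real)
    ultimately show ?thesis by auto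
  qed
  then have z: "\<And>\<xi>. \<xi> \<notin> {a<..<b} \<Longrightarrow> ?\<phi>2 \<xi> = 0"
    unfolding \<phi>2_def using test_functions_deriv[OF \<phi>] \<phi> ab(2) by meson
  have 1: "norm (fourier \<phi> t) \<le> (b - a) * A"
    by (rule norm_fourier_le[OF \<phi> ab A])
  have "fourier ?\<phi>2 t = - (of_real (t\<^sup>2) * fourier \<phi> t)"
    unfolding \<phi>2_def by (simp add: fourier_deriv[OF \<phi>] fourier_deriv[OF test_functions_deriv[OF \<phi>]]
        power2_eq_square algebra_simps)
  then have "t\<^sup>2 * norm (fourier \<phi> t) = norm (fourier ?\<phi>2 t)"
    by (simp add: norm_mult norm_power)
  also have "\<dots> \<le> (b - a) * B"
    by (rule norm_fourier_le[OF \<phi>2 ab(1) z B])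
  finally have "\<rho>\<^sup>2 * (t\<^sup>2 * norm (fourier \<phi> t)) \<le> \<rho>\<^sup>2 * ((b - a) * B)"
    by (rule mult_left_mono) auto
  with 1 have "norm (fourier \<phi> t) * (1 + (\<rho> * t)\<^sup>2) \<le> (b - a) * (A + \<rho>\<^sup>2 * B)"
    by (simp add: algebra_simps power_mult_distrib)
  moreover have "1 + (\<rho> * t)\<^sup>2 > 0" by (simp add: add_pos_nonneg)
  ultimately show ?thesis by (simp add: pos_le_divide_eq)
qed

lemma fourier_quadratic_decay:
  assumes "\<phi> \<in> test_functions I"
  obtains C where "C \<ge> 0" "\<And>t. norm (fourier \<phi> t) \<le> C / (1 + t\<^sup>2)"
proof -
  obtain N where N: "N > 0" "\<And>t. \<bar>t\<bar> \<ge> N \<Longrightarrow> \<phi> t = 0"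
    using test_functions_bounded_support[OF assms] by blast
  obtain A where A: "A \<ge> 0" "\<And>\<xi>. norm (\<phi> \<xi>) \<le> A"
    using test_function_bounded[OF assms] by blast
  have "nth_deriv 2 \<phi> \<in> test_functions I"
    by (simp add: numeral_2_eq_2 nth_deriv_Suc test_functions_deriv assms)
  then obtain B where B: "B \<ge> 0" "\<And>\<xi>. norm (nth_deriv 2 \<phi> \<xi>) \<le> B"
    using test_function_bounded by blast
  have "norm (fourier \<phi> t) \<le> (N - (- N)) * (A + 1\<^sup>2 * B) / (1 + (1 * t)\<^sup>2)" for t
    by (rule fourier_decay[OF assms]) (use N A B in \<open>auto simp: abs_if\<close>)
  then show ?thesis using A(1) B(1) N(1) by (intro that[of "2 * N * (A + B)"]) simp_all
qed

lemma fourier_has_vector_derivative: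
  assumes "\<phi> \<in> test_functions I"
  shows "(fourier \<phi> has_vector_derivative fourier (\<lambda>\<xi>. (- \<i>) * (of_real \<xi> * \<phi> \<xi>)) t) (at t)"
proof -
  obtain N where N: "N > 0" "\<And>t. \<bar>t\<bar> \<ge> N \<Longrightarrow> \<phi> t = 0"
    using test_functions_bounded_support[OF assms] by blast
  have c: "continuous_on A (\<lambda>p. \<phi> (snd p))" for A :: "(real \<times> real) set"
    by (rule continuous_on_compose2[OF smooth_continuous[of \<phi> UNIV] continuous_on_snd[OF continuous_on_id]])
       (auto intro: test_functionsD[OF assms])
  have "((\<lambda>t. integral (cbox (-N) N) (\<lambda>\<xi>. exp (- \<i> * of_real t * of_real \<xi>) * \<phi> \<xi>))
      has_vector_derivative integral (cbox (-N) N)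
        (\<lambda>\<xi>. (- \<i> * of_real \<xi>) * exp (- \<i> * of_real t * of_real \<xi>) * \<phi> \<xi>)) (at t within UNIV)"
  proof (rule leibniz_rule_vector_derivative)
    fix t \<xi> :: real
    have "((\<lambda>t. exp (- \<i> * of_real \<xi> * of_real t) * \<phi> \<xi>) has_vector_derivative
        (- \<i> * of_real \<xi>) * exp (- \<i> * of_real \<xi> * of_real t) * \<phi> \<xi>) (at t within UNIV)"
      by (intro has_vector_derivative_mult_left exp_ii_has_vector_derivative)
    then show "((\<lambda>t. exp (- \<i> * of_real t * of_real \<xi>) * \<phi> \<xi>) has_vector_derivative
        (- \<i> * of_real \<xi>) * exp (- \<i> * of_real t * of_real \<xi>) * \<phi> \<xi>) (at t within UNIV)"
      by (simp add: mult.commute mult.left_commute)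
  next
    fix t show "(\<lambda>\<xi>. exp (- \<i> * of_real t * of_real \<xi>) * \<phi> \<xi>) integrable_on cbox (-N) N"
      by (intro integrable_continuous continuous_on_fourier_integrand test_functionsD[OF assms])
  next
    show "continuous_on (UNIV \<times> cbox (-N) N)
       (\<lambda>(t, \<xi>). (- \<i> * of_real \<xi>) * exp (- \<i> * of_real t * of_real \<xi>) * \<phi> \<xi>)"
      unfolding split_beta by (intro continuous_intros c)
  qed auto
  moreover have "(\<lambda>t. integral (cbox (-N) N) (\<lambda>\<xi>. exp (- \<i> * of_real t * of_real \<xi>) * \<phi> \<xi>)) = fourier \<phi>"
    using fourier_cong_zero[of N \<phi>, OF N(2)] by auto
  moreover have "integral (cbox (-N) N) (\<lambda>\<xi>. (- \<i> * of_real \<xi>) * exp (- \<i> * of_real t * of_real \<xi>) * \<phi> \<xi>)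
      = fourier (\<lambda>\<xi>. (- \<i>) * (of_real \<xi> * \<phi> \<xi>)) t"
    using N(2) by (subst fourier_cong_zero[of N]) (auto simp: algebra_simps)
  ultimately show ?thesis by simp
qed


section \<open>Laplace transforms and Abel summation\<close>

lemma integral_half_line_split:
  fixes f :: "real \<Rightarrow> 'a::banach"
  assumes "f integrable_on {0..}" "f integrable_on {M..}" "M \<ge> 0"
  shows "integral {0..} f = integral {0..M} f + integral {M..} f"
proof -
  have "f integrable_on {0..M}" using assms by (intro integrable_on_subinterval[OF assms(1)]) auto
  then have "(f has_integral (integral {0..M} f + integral {M..} f)) ({0..M} \<union> {M..})"
    using assms by (intro has_integral_Un integrable_integral) (auto intro: negligible_subset[of "{M}"])
  moreover have "{0..M} \<union> {M..} = {0..}" using assms(3) by auto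
  ultimately show ?thesis by (simp add: integral_unique)
qed

lemma weighted_integral:
  fixes f :: "real \<Rightarrow> 'a::complex_banach"
  assumes S: "closed S" "is_interval S" and k: "continuous_on S k" and f: "continuous_on S f"
    and r: "r > 0" and kC: "\<And>t. t \<in> S \<Longrightarrow> norm (k t) \<le> C / (1 + (r * (t - s))\<^sup>2)"
    and fB: "\<And>t. t \<in> S \<Longrightarrow> norm (f t) \<le> B" and CB: "0 \<le> C" "0 \<le> B"
  shows "(\<lambda>t. k t *\<^sub>C f t) integrable_on S"
    and "norm (integral S (\<lambda>t. k t *\<^sub>C f t)) \<le> C * B * pi / r"
proof -
  let ?g = "\<lambda>t::real. C * B * (1 / (1 + (r * (t - s))\<^sup>2))"
  have g: "?g integrable_on S"
    by (rule integrable_on_mult_right) (rule cauchy_kernel_integrable[OF r S(1)])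
  have c: "continuous_on S (\<lambda>t. k t *\<^sub>C f t)" by (intro scaleC.continuous_on k f)
  have b: "norm (k t *\<^sub>C f t) \<le> ?g t" if "t \<in> S" for t
  proof -
    have "norm (k t) * norm (f t) \<le> C / (1 + (r * (t - s))\<^sup>2) * B"
      using kC[OF that] fB[OF that] CB by (intro mult_mono) auto
    then show ?thesis by (simp add: norm_scaleC)
  qed
  show "(\<lambda>t. k t *\<^sub>C f t) integrable_on S" by (rule integrable_dominated[OF S c g b])
  have "norm (integral S (\<lambda>t. k t *\<^sub>C f t)) \<le> integral S ?g"
    by (rule norm_integral_dominated[OF S c g b])
  also have "\<dots> = C * B * integral S (\<lambda>t. 1 / (1 + (r * (t - s))\<^sup>2))"
    by (rule Henstock_Kurzweil_Integration.integral_mult_right)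
  also have "\<dots> \<le> C * B * (pi / r)"
    by (intro mult_left_mono cauchy_kernel_integrable r S) (use CB in auto)
  finally show "norm (integral S (\<lambda>t. k t *\<^sub>C f t)) \<le> C * B * pi / r" by simp
qed

definition laplace :: "(real \<Rightarrow> 'a::complex_banach) \<Rightarrow> complex \<Rightarrow> 'a" where
  "laplace f z = integral {0..} (\<lambda>t. exp (- z * of_real t) *\<^sub>C f t)"

lemma laplace_integrable:
  fixes f :: "real \<Rightarrow> 'a::complex_banach"
  assumes f: "continuous_on {0..} f" "\<And>t. t \<ge> 0 \<Longrightarrow> norm (f t) \<le> B" and z: "Re z > 0" and M: "M \<ge> 0"
  shows "(\<lambda>t. exp (- z * of_real t) *\<^sub>C f t) integrable_on {M..}"
    and "norm (integral {M..} (\<lambda>t. exp (- z * of_real t) *\<^sub>C f t)) \<le> B * exp (- Re z * M) / Re z"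
proof -
  let ?g = "\<lambda>t::real. B * exp (- Re z * t)"
  have g: "(?g has_integral B * (exp (- Re z * M) / Re z)) {M..}"
    by (rule has_integral_mult_right) (rule has_integral_exp_minus_to_infinity[OF z])
  have c: "continuous_on {M..} (\<lambda>t. exp (- z * of_real t) *\<^sub>C f t)"
    by (intro scaleC.continuous_on continuous_intros continuous_on_subset[OF f(1)]) (use M in auto)
  have b: "norm (exp (- z * of_real t) *\<^sub>C f t) \<le> ?g t" if "t \<in> {M..}" for t
  proof -
    have "exp (- Re z * t) * norm (f t) \<le> exp (- Re z * t) * B"
      using f(2)[of t] that M by (intro mult_left_mono) auto
    then show ?thesis by (simp add: norm_scaleC mult.commute)
  qed
  show "(\<lambda>t. exp (- z * of_real t) *\<^sub>C f t) integrable_on {M..}"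
    by (rule integrable_dominated[OF _ _ c has_integral_integrable[OF g] b]) (auto simp: is_interval_ci)
  have "norm (integral {M..} (\<lambda>t. exp (- z * of_real t) *\<^sub>C f t)) \<le> integral {M..} ?g"
    by (rule norm_integral_dominated[OF _ _ c has_integral_integrable[OF g] b]) (auto simp: is_interval_ci)
  then show "norm (integral {M..} (\<lambda>t. exp (- z * of_real t) *\<^sub>C f t)) \<le> B * exp (- Re z * M) / Re z"
    using integral_unique[OF g] by simp
qed

lemma norm_laplace_le:
  fixes f :: "real \<Rightarrow> 'a::complex_banach"
  assumes "continuous_on {0..} f" "\<And>t. t \<ge> 0 \<Longrightarrow> norm (f t) \<le> B" "Re z > 0"
  shows "norm (laplace f z) \<le> B / Re z"
  using laplace_integrable(2)[OF assms, of 0] by (simp add: laplace_def)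

lemma laplace_has_integral:
  fixes f :: "real \<Rightarrow> 'a::complex_banach"
  assumes "continuous_on {0..} f" "\<And>t. t \<ge> 0 \<Longrightarrow> norm (f t) \<le> B" "Re z > 0"
  shows "((\<lambda>t. exp (- z * of_real t) *\<^sub>C f t) has_integral laplace f z) {0..}"
  using laplace_integrable(1)[OF assms, of 0] by (simp add: laplace_def integrable_integral)

text \<open>Besides the resolvent at an eigenvector this contains the scalar Laplace transform of a
  constant, by \<open>\<omega> = 0\<close>.\<close>

lemma laplace_exponential:
  fixes u :: "'a::complex_banach"
  assumes "Re z > 0"
  shows "laplace (\<lambda>t. exp (\<i> * of_real (\<omega> * t)) *\<^sub>C u) z = (1 / (z - \<i> * of_real \<omega>)) *\<^sub>C u"
proof -
  let ?w = "z - \<i> * of_real \<omega>"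
  have w: "?w \<noteq> 0" "Re ?w > 0" using assms by (auto simp: complex_eq_iff)
  have e: "exp (- z * of_real t) *\<^sub>C exp (\<i> * of_real (\<omega> * t)) *\<^sub>C u = exp (- ?w * of_real t) *\<^sub>C u" for t :: real
    by (simp add: scaleC_scaleC mult_exp_exp algebra_simps)
  let ?F = "\<lambda>t. (- exp (- ?w * of_real t) / ?w) *\<^sub>C u"
  have F: "((\<lambda>t. exp (- ?w * of_real t) *\<^sub>C u) has_integral ?F N - ?F 0) {0..N}" if "N \<ge> 0" for N
  proof (rule fundamental_theorem_of_calculus[OF that])
    fix t
    have "((\<lambda>z. - exp (- v * z) / v) has_field_derivative exp (- v * of_real t)) (at (of_real t))"
      if "v \<noteq> 0" for v
      using that by (auto intro!: derivative_eq_intros)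
    note this[OF w(1)]
    from has_vector_derivative_real_field[OF this]
    have "((\<lambda>t. - exp (- ?w * of_real t) / ?w) has_vector_derivative exp (- ?w * of_real t)) (at t within {0..N})"
      by (rule has_vector_derivative_at_within)
    from bounded_linear.has_vector_derivative[OF scaleC.bounded_linear_left this]
    show "(?F has_vector_derivative exp (- ?w * of_real t) *\<^sub>C u) (at t within {0..N})" .
  qed
  have i: "(\<lambda>t. exp (- ?w * of_real t) *\<^sub>C u) integrable_on {0..}"
    by (rule laplace_integrable(1)[of "\<lambda>_. u" "norm u"]) (use w in auto)
  have "((\<lambda>N. integral {0..N} (\<lambda>t. exp (- ?w * of_real t) *\<^sub>C u)) \<longlongrightarrow>
      integral {0..} (\<lambda>t. exp (- ?w * of_real t) *\<^sub>C u)) at_top"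
    by (rule tendsto_integral_half_line[OF i])
  moreover have "((\<lambda>N. integral {0..N} (\<lambda>t. exp (- ?w * of_real t) *\<^sub>C u)) \<longlongrightarrow> 0 - ?F 0) at_top"
  proof (rule Lim_transform_eventually)
    show "\<forall>\<^sub>F N in at_top. ?F N - ?F 0 = integral {0..N} (\<lambda>t. exp (- ?w * of_real t) *\<^sub>C u)"
      using eventually_ge_at_top[of 0] by eventually_elim (rule integral_unique[OF F, symmetric])
    have "((\<lambda>N. norm (?F N)) \<longlongrightarrow> 0) at_top"
    proof -
      have "((\<lambda>N. exp (- (Re ?w * N))) \<longlongrightarrow> 0) at_top"
        using w(2) by (intro filterlim_compose[OF exp_at_bot]
            filterlim_compose[OF filterlim_uminus_at_bot_at_top]
            filterlim_tendsto_pos_mult_at_top[OF tendsto_const]) (auto simp: filterlim_ident)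
      then have "((\<lambda>N. exp (- (Re ?w * N)) / norm ?w * norm u) \<longlongrightarrow> 0 / norm ?w * norm u) at_top"
        by (intro tendsto_intros) (use w in auto)
      then show ?thesis by (simp add: norm_scaleC norm_divide)
    qed
    then have "(?F \<longlongrightarrow> 0) at_top" by (simp add: tendsto_norm_zero_iff)
    then show "((\<lambda>N. ?F N - ?F 0) \<longlongrightarrow> 0 - ?F 0) at_top" by (intro tendsto_intros)
  qed
  ultimately have "integral {0..} (\<lambda>t. exp (- ?w * of_real t) *\<^sub>C u) = 0 - ?F 0"
    by (intro tendsto_unique) auto
  then show ?thesis
    unfolding laplace_def e by (simp add: scaleC.minus_left)
qed

text \<open>Fubini's theorem moves the Fourier transform onto the test function. It is applied on compact
  rectangles; the truncated Laplace transforms converge uniformly on the vertical segment.\<close>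

lemma integral_laplace_vertical:
  fixes f :: "real \<Rightarrow> 'a::complex_banach"
  assumes \<phi>: "\<phi> \<in> test_functions I"
    and f: "continuous_on {0..} f" "\<And>t. t \<ge> 0 \<Longrightarrow> norm (f t) \<le> B" and \<alpha>: "\<alpha> > 0"
  shows "((\<lambda>\<xi>. \<phi> \<xi> *\<^sub>C laplace f (of_real \<alpha> + \<i> * of_real \<xi>)) has_integral
     integral {0..} (\<lambda>t. (of_real (exp (- \<alpha> * t)) * fourier \<phi> t) *\<^sub>C f t)) UNIV"
proof -
  obtain N where N: "N > 0" "\<And>t. \<bar>t\<bar> \<ge> N \<Longrightarrow> \<phi> t = 0"
    using test_functions_bounded_support[OF \<phi>] by blast
  obtain D where D: "D \<ge> 0" "\<And>\<xi>. norm (\<phi> \<xi>) \<le> D" using test_function_bounded[OF \<phi>] by blast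
  have B: "B \<ge> 0" using f(2)[of 0] norm_ge_zero order_trans by blast
  have \<phi>c: "continuous_on A (\<lambda>p. \<phi> (g p))" if "continuous_on A g" for A and g :: "'b::topological_space \<Rightarrow> real"
    by (rule continuous_on_compose2[OF smooth_continuous[of \<phi> UNIV] that])
       (auto intro: test_functionsD[OF \<phi>])
  define z where "z = (\<lambda>\<xi>::real. complex_of_real \<alpha> + \<i> * of_real \<xi>)"
  have z: "Re (z \<xi>) = \<alpha>" for \<xi> by (simp add: z_def)
  define G where "G = (\<lambda>\<xi> t::real. \<phi> \<xi> *\<^sub>C exp (- z \<xi> * of_real t) *\<^sub>C f t)"
  define L where "L = (\<lambda>M \<xi>. integral {0..M} (G \<xi>))"
  have Gc: "continuous_on (A \<times> {0..M}) (\<lambda>(\<xi>, t). G \<xi> t)" for A M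
    unfolding G_def z_def split_beta
    by (intro scaleC.continuous_on continuous_intros \<phi>c continuous_on_compose2[OF f(1)]) auto
  have LG: "L M \<xi> = \<phi> \<xi> *\<^sub>C integral {0..M} (\<lambda>t. exp (- z \<xi> * of_real t) *\<^sub>C f t)" for M \<xi>
  proof -
    have i: "(\<lambda>t. exp (- z \<xi> * of_real t) *\<^sub>C f t) integrable_on {0..M}"
      by (intro integrable_continuous_interval scaleC.continuous_on continuous_intros
          continuous_on_subset[OF f(1)]) auto
    show ?thesis
      unfolding L_def G_def
      using integral_linear[OF i scaleC.bounded_linear_right[of "\<phi> \<xi>"]] by (simp add: o_def)
  qed
  have Lc: "continuous_on {-N..N} (L M)" for M
    unfolding L_def using integral_continuous_on_param[of "{-N..N}" 0 M G] Gc[of "{-N..N}" M] by simp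
  have "uniform_limit {-N..N} L (\<lambda>\<xi>. \<phi> \<xi> *\<^sub>C laplace f (z \<xi>)) at_top"
  proof (rule uniform_limitI)
    fix e :: real assume "e > 0"
    have "((\<lambda>M. D * (B * exp (- (\<alpha> * M)) / \<alpha>)) \<longlongrightarrow> D * (B * 0 / \<alpha>)) at_top"
      using \<alpha> by (intro tendsto_intros filterlim_compose[OF exp_at_bot]
          filterlim_compose[OF filterlim_uminus_at_bot_at_top]
          filterlim_tendsto_pos_mult_at_top[OF tendsto_const]) (auto simp: filterlim_ident)
    then have "\<forall>\<^sub>F M in at_top. D * (B * exp (- (\<alpha> * M)) / \<alpha>) < e"
      using \<open>e > 0\<close> by (intro order_tendstoD(2)) auto
    with eventually_ge_at_top[of 0]
    show "\<forall>\<^sub>F M in at_top. \<forall>\<xi>\<in>{-N..N}. dist (L M \<xi>) (\<phi> \<xi> *\<^sub>C laplace f (z \<xi>)) < e"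
    proof eventually_elim
      case (elim M)
      show ?case
      proof
        fix \<xi>
        let ?h = "\<lambda>t. exp (- z \<xi> * of_real t) *\<^sub>C f t"
        have "laplace f (z \<xi>) = integral {0..M} ?h + integral {M..} ?h"
          unfolding laplace_def
          by (rule integral_half_line_split) (use laplace_integrable(1)[OF f] z \<alpha> elim in auto)
        then have "dist (L M \<xi>) (\<phi> \<xi> *\<^sub>C laplace f (z \<xi>)) = norm (\<phi> \<xi>) * norm (integral {M..} ?h)"
          by (simp add: LG dist_norm scaleC.add_right norm_scaleC)
        also have "\<dots> \<le> D * (B * exp (- \<alpha> * M) / \<alpha>)"
          using laplace_integrable(2)[OF f, of "z \<xi>" M] z \<alpha> elim D
          by (intro mult_mono) auto
        finally show "dist (L M \<xi>) (\<phi> \<xi> *\<^sub>C laplace f (z \<xi>)) < e" using elim by simp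
      qed
    qed
  qed
  then obtain IL J where IJ: "\<And>M. (L M has_integral IL M) {-N..N}"
    "((\<lambda>\<xi>. \<phi> \<xi> *\<^sub>C laplace f (z \<xi>)) has_integral J) {-N..N}" "(IL \<longlongrightarrow> J) at_top"
    by (rule uniform_limit_integral[OF _ Lc]) auto
  define k where "k = (\<lambda>t. of_real (exp (- \<alpha> * t)) * fourier \<phi> t)"
  have IL: "IL M = integral {0..M} (\<lambda>t. k t *\<^sub>C f t)" for M
  proof -
    have "IL M = integral {-N..N} (L M)" using IJ(1)[of M] by (simp add: integral_unique)
    also have "\<dots> = integral {0..M} (\<lambda>t. integral {-N..N} (\<lambda>\<xi>. G \<xi> t))"
      unfolding L_def using integral_swap_continuous[of "-N" 0 N M G] Gc[of "{-N..N}" M]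
      by (simp add: cbox_Pair_eq)
    also have "\<dots> = integral {0..M} (\<lambda>t. k t *\<^sub>C f t)"
    proof (rule integral_cong)
      fix t
      have i: "(\<lambda>\<xi>. exp (- \<i> * of_real t * of_real \<xi>) * \<phi> \<xi>) integrable_on {-N..N}"
        by (intro integrable_continuous_interval continuous_on_fourier_integrand test_functionsD[OF \<phi>])
      have "G \<xi> t = of_real (exp (- \<alpha> * t)) *\<^sub>C ((exp (- \<i> * of_real t * of_real \<xi>) * \<phi> \<xi>) *\<^sub>C f t)" for \<xi>
        unfolding G_def z_def
        by (simp add: scaleC_scaleC mult_exp_exp algebra_simps exp_of_real[symmetric] exp_diff exp_add)
      then have "integral {-N..N} (\<lambda>\<xi>. G \<xi> t)
          = of_real (exp (- \<alpha> * t)) *\<^sub>C (integral {-N..N} (\<lambda>\<xi>. exp (- \<i> * of_real t * of_real \<xi>) * \<phi> \<xi>) *\<^sub>C f t)"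
        using integral_linear[OF i bounded_linear_compose[OF scaleC.bounded_linear_right[of "of_real (exp (- \<alpha> * t))"] scaleC.bounded_linear_left[of "f t"]]]
        by (simp add: o_def)
      also have "\<dots> = k t *\<^sub>C f t"
      proof -
        have "fourier \<phi> t = integral {-N..N} (\<lambda>\<xi>. exp (- \<i> * of_real t * of_real \<xi>) * \<phi> \<xi>)"
          by (rule fourier_cong_zero) (rule N(2))
        then show ?thesis unfolding k_def by (simp add: scaleC_scaleC)
      qed
      finally show "integral {-N..N} (\<lambda>\<xi>. G \<xi> t) = k t *\<^sub>C f t" .
    qed
    finally show ?thesis .
  qed
  have "(\<lambda>t. k t *\<^sub>C f t) integrable_on {0..}"
  proof -
    obtain C where C: "C \<ge> 0" "\<And>t. norm (fourier \<phi> t) \<le> C / (1 + t\<^sup>2)"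
      using fourier_quadratic_decay[OF \<phi>] by blast
    have "norm (k t) \<le> C / (1 + (1 * (t - 0))\<^sup>2)" if "t \<in> {0..}" for t
    proof -
      have "norm (k t) \<le> 1 * norm (fourier \<phi> t)"
        unfolding k_def norm_mult using that \<alpha> by (intro mult_right_mono) auto
      then show ?thesis using C(2)[of t] by simp
    qed
    then show ?thesis
      using C(1) B f
      by (intro weighted_integral(1)[where B = B and C = C and r = 1 and s = 0])
         (auto simp: is_interval_ci k_def intro!: continuous_intros continuous_on_fourier[OF \<phi>])
  qed
  from tendsto_integral_half_line[OF this] IJ(3)
  have "J = integral {0..} (\<lambda>t. k t *\<^sub>C f t)"
    unfolding IL by (intro tendsto_unique) auto
  moreover have "((\<lambda>\<xi>. \<phi> \<xi> *\<^sub>C laplace f (z \<xi>)) has_integral J) UNIV"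
    by (rule has_integral_on_superset[OF IJ(2)]) (use N(2) in \<open>auto simp: scaleC.zero_left\<close>)
  ultimately show ?thesis unfolding k_def z_def by simp
qed

text \<open>Abel summation: the convergence factor is removed at the cost of an error of order \<open>\<surd>\<alpha>\<close>.\<close>

lemma abel_summation:
  fixes f :: "real \<Rightarrow> 'a::complex_banach"
  assumes \<phi>: "\<phi> \<in> test_functions I"
    and f: "continuous_on {0..} f" "\<And>t. t \<ge> 0 \<Longrightarrow> norm (f t) \<le> B"
  shows "((\<lambda>\<alpha>. integral UNIV (\<lambda>\<xi>. \<phi> \<xi> *\<^sub>C laplace f (of_real \<alpha> + \<i> * of_real \<xi>))) \<longlongrightarrow>
     integral {0..} (\<lambda>t. fourier \<phi> t *\<^sub>C f t)) (at_right 0)"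
proof -
  have B: "B \<ge> 0" using f(2)[of 0] norm_ge_zero order_trans by blast
  obtain C where C: "C \<ge> 0" "\<And>t. norm (fourier \<phi> t) \<le> C / (1 + t\<^sup>2)"
    using fourier_quadratic_decay[OF \<phi>] by blast
  have S: "closed {0::real..}" "is_interval {0::real..}" by (auto simp: is_interval_ci)
  let ?I = "integral {0..} (\<lambda>t. fourier \<phi> t *\<^sub>C f t)"
  let ?J = "\<lambda>\<alpha>. integral {0..} (\<lambda>t. (of_real (exp (- \<alpha> * t)) * fourier \<phi> t) *\<^sub>C f t)"
  have fc: "continuous_on {0..} (fourier \<phi>)" by (rule continuous_on_fourier[OF \<phi>])
  have bound: "norm (?J \<alpha> - ?I) \<le> 3 * C * B * pi * sqrt \<alpha>" if \<alpha>: "\<alpha> > 0" for \<alpha>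
  proof -
    \<comment> \<open>The error factor \<open>1 - exp (- \<alpha> t)\<close> is at most \<open>min 1 (\<beta>\<^sup>2 t)\<close>. For \<open>t \<le> 1 / \<beta>\<close> the first kernel in \<open>K\<close>
      below dominates, beyond it the second one; both have integral \<open>O(\<beta>)\<close>.\<close>
    define \<beta> where "\<beta> = sqrt \<alpha>"
    have \<beta>: "\<beta> > 0" "\<beta>\<^sup>2 = \<alpha>" using \<alpha> by (auto simp: \<beta>_def)
    have e0: "0 \<le> exp (- \<alpha> * t)" "exp (- \<alpha> * t) \<le> 1" "1 - exp (- \<alpha> * t) \<le> \<beta>\<^sup>2 * t" if "t \<ge> 0" for t
      using that \<alpha> exp_ge_add_one_self[of "- \<alpha> * t"] \<beta> by auto
    have i1: "(\<lambda>t. (of_real (exp (- \<alpha> * t)) * fourier \<phi> t) *\<^sub>C f t) integrable_on {0..}"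
    proof (rule weighted_integral(1)[OF S, where B = B and C = C and r = 1 and s = 0])
      fix t :: real assume "t \<in> {0..}"
      then have "norm (of_real (exp (- \<alpha> * t)) * fourier \<phi> t) \<le> 1 * norm (fourier \<phi> t)"
        unfolding norm_mult using e0 by (intro mult_right_mono) auto
      then show "norm (of_real (exp (- \<alpha> * t)) * fourier \<phi> t) \<le> C / (1 + (1 * (t - 0))\<^sup>2)"
        using C(2)[of t] by simp
    qed (use f C B in \<open>auto intro!: continuous_intros fc\<close>)
    have i2: "(\<lambda>t. fourier \<phi> t *\<^sub>C f t) integrable_on {0..}"
      by (rule weighted_integral(1)[OF S, where B = B and C = C and r = 1 and s = 0])
         (use f C B in \<open>auto intro!: fc\<close>)
    define h where "h = (\<lambda>t. (of_real (exp (- \<alpha> * t)) * fourier \<phi> t) *\<^sub>C f t - fourier \<phi> t *\<^sub>C f t)"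
    define K where "K = (\<lambda>t::real. (C * B) * (\<beta> * (1 / (1 + (1 * (t - 0))\<^sup>2)) + 2 * \<beta>\<^sup>2 * (1 / (1 + (\<beta> * (t - 0))\<^sup>2))))"
    have Ki: "K integrable_on {0..}"
      unfolding K_def by (intro integrable_on_mult_right integrable_add
          cauchy_kernel_integrable) (use \<beta> in auto)
    have Kb: "integral {0..} K \<le> (C * B) * (\<beta> * (pi / 1) + 2 * \<beta>\<^sup>2 * (pi / \<beta>))"
    proof -
      have "integral {0..} K = (C * B) * (\<beta> * integral {0..} (\<lambda>t. 1 / (1 + (1 * (t - 0))\<^sup>2)) +
          2 * \<beta>\<^sup>2 * integral {0..} (\<lambda>t. 1 / (1 + (\<beta> * (t - 0))\<^sup>2)))"
        unfolding K_def
        by (intro integral_unique has_integral_mult_right has_integral_add integrable_integral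
            cauchy_kernel_integrable) (use \<beta> in auto)
      also have "\<dots> \<le> (C * B) * (\<beta> * (pi / 1) + 2 * \<beta>\<^sup>2 * (pi / \<beta>))"
        using \<beta> B C by (intro mult_left_mono add_mono cauchy_kernel_integrable) auto
      finally show ?thesis .
    qed
    have hK: "norm (h t) \<le> K t" if t: "t \<in> {0..}" for t
    proof -
      have "h t = ((of_real (exp (- \<alpha> * t)) - 1) * fourier \<phi> t) *\<^sub>C f t"
        by (simp add: h_def scaleC.diff_left[symmetric] algebra_simps)
      moreover have "norm (complex_of_real (exp (- \<alpha> * t)) - 1) = 1 - exp (- \<alpha> * t)"
        using e0[of t] t by (metis abs_minus_commute abs_of_nonneg atLeast_iff diff_ge_0_iff_ge norm_of_real of_real_1 of_real_diff)
      ultimately have "norm (h t) = (1 - exp (- \<alpha> * t)) * norm (fourier \<phi> t) * norm (f t)"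
        by (simp add: norm_scaleC norm_mult)
      also have "\<dots> \<le> (1 - exp (- \<alpha> * t)) * (C / (1 + t\<^sup>2)) * B"
      proof -
        have "0 \<le> C / (1 + t\<^sup>2)" using C(1) by (simp add: divide_nonneg_pos add_pos_nonneg)
        then show ?thesis
          using e0[of t] t C(2)[of t] f(2)[of t]
          by (intro mult_mono mult_left_mono mult_nonneg_nonneg) auto
      qed
      also have "\<dots> = (C * B) * ((1 - exp (- \<alpha> * t)) / (1 + t\<^sup>2))" by simp
      also have "\<dots> \<le> (C * B) * (\<beta> * (1 / (1 + t\<^sup>2)) + 2 * \<beta>\<^sup>2 * (1 / (1 + (\<beta> * t)\<^sup>2)))"
      proof (rule mult_left_mono)
        show "(1 - exp (- \<alpha> * t)) / (1 + t\<^sup>2) \<le> \<beta> * (1 / (1 + t\<^sup>2)) + 2 * \<beta>\<^sup>2 * (1 / (1 + (\<beta> * t)\<^sup>2))"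
        proof (cases "\<beta> * t \<le> 1")
          case True
          have "\<beta> * (\<beta> * t) \<le> \<beta> * 1" using True \<beta>(1) by (intro mult_left_mono) auto
          then have "1 - exp (- \<alpha> * t) \<le> \<beta>" using e0(3)[of t] t by (simp add: power2_eq_square)
          then have "(1 - exp (- \<alpha> * t)) / (1 + t\<^sup>2) \<le> \<beta> / (1 + t\<^sup>2)"
            by (intro divide_right_mono) auto
          moreover have "0 \<le> 2 * \<beta>\<^sup>2 / (1 + (\<beta> * t)\<^sup>2)" by (simp add: add_nonneg_nonneg)
          ultimately have "(1 - exp (- \<alpha> * t)) / (1 + t\<^sup>2) + 0 \<le> \<beta> / (1 + t\<^sup>2) + 2 * \<beta>\<^sup>2 / (1 + (\<beta> * t)\<^sup>2)"
            by (rule add_mono)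
          then show ?thesis by simp
        next
          case False
          then have t0: "t > 0" using \<beta>(1) t by (cases "t = 0") auto
          have "1 \<le> (\<beta> * t)\<^sup>2" using False by (simp add: one_le_power)
          then have "\<beta>\<^sup>2 * t\<^sup>2 + 1 \<le> 2 * (\<beta>\<^sup>2 * t\<^sup>2)" by (simp add: power_mult_distrib)
          have "(1 - exp (- \<alpha> * t)) / (1 + t\<^sup>2) \<le> 1 / t\<^sup>2"
            using t0 by (intro frac_le) auto
          also have "\<dots> \<le> 2 * \<beta>\<^sup>2 * (1 / (1 + (\<beta> * t)\<^sup>2))"
            using t0 \<open>\<beta>\<^sup>2 * t\<^sup>2 + 1 \<le> 2 * (\<beta>\<^sup>2 * t\<^sup>2)\<close>
            by (simp add: field_simps power_mult_distrib add_pos_nonneg)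
          also have "\<dots> \<le> \<beta> * (1 / (1 + t\<^sup>2)) + 2 * \<beta>\<^sup>2 * (1 / (1 + (\<beta> * t)\<^sup>2))"
            using \<beta>(1) by simp
          finally show ?thesis .
        qed
      qed (use C B in auto)
      finally show ?thesis by (simp add: K_def)
    qed
    have "?J \<alpha> - ?I = integral {0..} h"
      unfolding h_def by (rule Henstock_Kurzweil_Integration.integral_diff[OF i1 i2, symmetric])
    also have "norm \<dots> \<le> integral {0..} K"
      by (rule Henstock_Kurzweil_Integration.integral_norm_bound_integral[OF _ Ki hK])
         (unfold h_def, rule Henstock_Kurzweil_Integration.integrable_diff[OF i1 i2])
    also have "\<dots> \<le> 3 * C * B * pi * sqrt \<alpha>"
      using Kb \<beta> by (simp add: \<beta>_def[symmetric] power2_eq_square algebra_simps)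
    finally show ?thesis .
  qed
  have "((\<lambda>\<alpha>. norm (?J \<alpha> - ?I)) \<longlongrightarrow> 0) (at_right 0)"
  proof (rule tendsto_sandwich[OF _ _ tendsto_const])
    show "\<forall>\<^sub>F \<alpha> in at_right 0. norm (?J \<alpha> - ?I) \<le> 3 * C * B * pi * sqrt \<alpha>"
      using eventually_at_right_less[of 0] by eventually_elim (rule bound)
    show "((\<lambda>\<alpha>. 3 * C * B * pi * sqrt \<alpha>) \<longlongrightarrow> 0) (at_right 0)"
      by (auto intro!: tendsto_eq_intros)
  qed auto
  then have "(?J \<longlongrightarrow> ?I) (at_right 0)" by (simp add: LIM_zero_iff tendsto_norm_zero_iff)
  then show ?thesis
  proof (rule Lim_transform_eventually)
    show "\<forall>\<^sub>F \<alpha> in at_right 0. ?J \<alpha> = integral UNIV (\<lambda>\<xi>. \<phi> \<xi> *\<^sub>C laplace f (of_real \<alpha> + \<i> * of_real \<xi>))"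
      using eventually_at_right_less[of 0]
      by eventually_elim (rule integral_unique[OF integral_laplace_vertical[OF \<phi> f], symmetric])
  qed
qed

text \<open>Abel summation turns the mass on the half line into the integral of \<open>p\<close> against the Poisson kernel
  \<open>\<alpha> / (\<alpha>\<^sup>2 + \<xi>\<^sup>2)\<close>, which is positive and has mass at least \<open>\<pi>/2\<close> on \<open>[-1, 1]\<close> when \<open>\<alpha> \<le> 1\<close>.\<close>

lemma fourier_half_mass:
  fixes p :: "real \<Rightarrow> real"
  assumes \<phi>: "(\<lambda>\<xi>. of_real (p \<xi>)) \<in> test_functions I" (is "?\<phi> \<in> _")
    and p: "\<And>\<xi>. p \<xi> \<ge> 0" "\<And>\<xi>. \<bar>\<xi>\<bar> \<le> 1 \<Longrightarrow> p \<xi> \<ge> 1"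
  shows "Re (integral {0..} (fourier ?\<phi>)) \<ge> pi / 2"
proof -
  let ?L = "laplace (\<lambda>t. 1 :: complex)"
  have L: "?L (of_real \<alpha> + \<i> * of_real \<xi>) = 1 / (of_real \<alpha> + \<i> * of_real \<xi>)" if "\<alpha> > 0" for \<alpha> \<xi>
    using laplace_exponential[of "of_real \<alpha> + \<i> * of_real \<xi>" 0 "1::complex"] that
    by (simp add: scaleC_complex_def)
  have lim: "((\<lambda>\<alpha>. integral UNIV (\<lambda>\<xi>. ?\<phi> \<xi> *\<^sub>C ?L (of_real \<alpha> + \<i> * of_real \<xi>))) \<longlongrightarrow>
     integral {0..} (\<lambda>t. fourier ?\<phi> t *\<^sub>C 1)) (at_right 0)"
    by (rule abel_summation[OF \<phi>, where B = 1]) auto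
  have "pi / 2 \<le> Re (integral UNIV (\<lambda>\<xi>. ?\<phi> \<xi> *\<^sub>C ?L (of_real \<alpha> + \<i> * of_real \<xi>)))" if \<alpha>: "0 < \<alpha>" "\<alpha> < 1" for \<alpha>
  proof -
    have "((\<lambda>\<xi>. ?\<phi> \<xi> *\<^sub>C ?L (of_real \<alpha> + \<i> * of_real \<xi>)) has_integral
        integral UNIV (\<lambda>\<xi>. ?\<phi> \<xi> *\<^sub>C ?L (of_real \<alpha> + \<i> * of_real \<xi>))) UNIV"
      using has_integral_integrable[OF integral_laplace_vertical[OF \<phi>, of "\<lambda>_. 1 :: complex" 1 \<alpha>]] \<alpha>
      by (intro integrable_integral) simp
    from has_integral_linear[OF this bounded_linear_Re]
    have 1: "((\<lambda>\<xi>. p \<xi> * (\<alpha> / (\<alpha>\<^sup>2 + \<xi>\<^sup>2))) has_integral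
        Re (integral UNIV (\<lambda>\<xi>. ?\<phi> \<xi> *\<^sub>C ?L (of_real \<alpha> + \<i> * of_real \<xi>)))) UNIV"
      using \<alpha>(1) by (simp add: o_def L scaleC_complex_def Re_divide power2_eq_square)
    have 2: "((\<lambda>\<xi>. \<alpha> / (\<alpha>\<^sup>2 + \<xi>\<^sup>2)) has_integral (arctan (1 / \<alpha>) - arctan (- 1 / \<alpha>))) {-1..1}"
    proof (rule fundamental_theorem_of_calculus)
      fix \<xi>
      have "((\<lambda>\<xi>. arctan (\<xi> / \<alpha>)) has_real_derivative \<alpha> / (\<alpha>\<^sup>2 + \<xi>\<^sup>2)) (at \<xi>)"
        using \<alpha>(1) by (auto intro!: derivative_eq_intros simp: divide_simps power2_eq_square add_nonneg_eq_0_iff)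
      then show "((\<lambda>\<xi>. arctan (\<xi> / \<alpha>)) has_vector_derivative \<alpha> / (\<alpha>\<^sup>2 + \<xi>\<^sup>2)) (at \<xi> within {-1..1})"
        by (simp add: has_real_derivative_iff_has_vector_derivative has_vector_derivative_at_within)
    qed auto
    have "pi / 4 \<le> arctan (1 / \<alpha>)"
      using \<alpha> by (subst arctan_one[symmetric], subst arctan_le_iff) simp
    then have "pi / 2 \<le> arctan (1 / \<alpha>) - arctan (- 1 / \<alpha>)" by (simp add: arctan_minus)
    also have "\<dots> \<le> Re (integral UNIV (\<lambda>\<xi>. ?\<phi> \<xi> *\<^sub>C ?L (of_real \<alpha> + \<i> * of_real \<xi>)))"
    proof -
      have 3: "((\<lambda>\<xi>. if \<xi> \<in> {-1..1} then \<alpha> / (\<alpha>\<^sup>2 + \<xi>\<^sup>2) else 0) has_integral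
          (arctan (1 / \<alpha>) - arctan (- 1 / \<alpha>))) UNIV"
        using 2 by (simp only: has_integral_restrict_UNIV)
      show ?thesis
      proof (rule has_integral_le[OF 3 1])
        fix \<xi> :: real
        have "0 \<le> \<alpha> / (\<alpha>\<^sup>2 + \<xi>\<^sup>2)" using \<alpha>(1) by simp
        then show "(if \<xi> \<in> {-1..1} then \<alpha> / (\<alpha>\<^sup>2 + \<xi>\<^sup>2) else 0) \<le> p \<xi> * (\<alpha> / (\<alpha>\<^sup>2 + \<xi>\<^sup>2))"
          using p(1)[of \<xi>] mult_right_mono[OF p(2)[of \<xi>]] mult_nonneg_nonneg[OF p(1)[of \<xi>]]
          by (auto simp: abs_le_iff simp del: times_divide_eq_right)
      qed
    qed
    finally show ?thesis .
  qed
  then have "\<forall>\<^sub>F \<alpha> in at_right 0. pi / 2 \<le> Re (integral UNIV (\<lambda>\<xi>. ?\<phi> \<xi> *\<^sub>C ?L (of_real \<alpha> + \<i> * of_real \<xi>)))"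
    unfolding eventually_at_right_field by (intro exI[of _ 1]) auto
  moreover have "((\<lambda>\<alpha>. Re (integral UNIV (\<lambda>\<xi>. ?\<phi> \<xi> *\<^sub>C ?L (of_real \<alpha> + \<i> * of_real \<xi>)))) \<longlongrightarrow>
     Re (integral {0..} (fourier ?\<phi>))) (at_right 0)"
    using tendsto_Re[OF lim] by (simp add: scaleC_complex_def)
  ultimately show ?thesis
    by (intro tendsto_lowerbound) auto
qed

text \<open>The transform of a real function takes conjugate values at \<open>t\<close> and \<open>-t\<close>, so the total mass is
  twice the real part of the mass on the half line.\<close>

lemma fourier_total_mass:
  fixes p :: "real \<Rightarrow> real"
  assumes \<phi>: "(\<lambda>\<xi>. of_real (p \<xi>)) \<in> test_functions I" (is "?\<phi> \<in> _")
    and p: "\<And>\<xi>. p \<xi> \<ge> 0" "\<And>\<xi>. \<bar>\<xi>\<bar> \<le> 1 \<Longrightarrow> p \<xi> \<ge> 1"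
  obtains c :: real where "c \<ge> pi" "\<And>s. ((\<lambda>t. fourier ?\<phi> (t - s)) has_integral of_real c) UNIV"
proof -
  obtain C where C: "C \<ge> 0" "\<And>t. norm (fourier ?\<phi> t) \<le> C / (1 + t\<^sup>2)"
    using fourier_quadratic_decay[OF \<phi>] by blast
  have "(\<lambda>t. fourier ?\<phi> t *\<^sub>C (1::complex)) integrable_on {0..}"
    by (rule weighted_integral(1)[where B = 1 and C = C and r = 1 and s = 0])
       (use C in \<open>auto simp: is_interval_ci intro!: continuous_on_fourier[OF \<phi>]\<close>)
  then have i: "(fourier ?\<phi> has_integral integral {0..} (fourier ?\<phi>)) {0..}"
    by (simp add: scaleC_complex_def integrable_integral)
  define J where "J = integral {0..} (fourier ?\<phi>)"
  have cnj: "fourier ?\<phi> (- t) = cnj (fourier ?\<phi> t)" for t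
  proof -
    obtain N where N: "N > 0" "\<And>t. \<bar>t\<bar> \<ge> N \<Longrightarrow> ?\<phi> t = 0"
      using test_functions_bounded_support[OF \<phi>] by blast
    have "((\<lambda>\<xi>. exp (- \<i> * of_real t * of_real \<xi>) * ?\<phi> \<xi>) has_integral fourier ?\<phi> t) {-N..N}"
    proof -
      have "fourier ?\<phi> t = integral {-N..N} (\<lambda>\<xi>. exp (- \<i> * of_real t * of_real \<xi>) * ?\<phi> \<xi>)"
        by (rule fourier_cong_zero) (rule N(2))
      then show ?thesis
        using integrable_continuous_interval[OF continuous_on_fourier_integrand[OF test_functionsD(1)[OF \<phi>]]]
        by (metis integrable_integral)
    qed
    from has_integral_linear[OF this bounded_linear_cnj]
    have "((\<lambda>\<xi>. exp (- \<i> * of_real (- t) * of_real \<xi>) * ?\<phi> \<xi>) has_integral cnj (fourier ?\<phi> t)) {-N..N}"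
      by (simp add: o_def exp_cnj)
    moreover have "fourier ?\<phi> (- t) = integral {-N..N} (\<lambda>\<xi>. exp (- \<i> * of_real (- t) * of_real \<xi>) * ?\<phi> \<xi>)"
      by (rule fourier_cong_zero) (rule N(2))
    ultimately show ?thesis by (simp add: integral_unique)
  qed
  have "{t. (- 1) * t + 0 \<in> {0::real..}} = {..0}" by auto
  from has_integral_real_isometry[OF i, of "- 1" 0, unfolded this]
  have "((\<lambda>t. cnj (fourier ?\<phi> t)) has_integral J) {..0}" by (simp add: cnj J_def)
  from has_integral_linear[OF this bounded_linear_cnj]
  have "(fourier ?\<phi> has_integral cnj J) {..0}" by (simp add: o_def)
  then have "(fourier ?\<phi> has_integral (cnj J + J)) ({..0} \<union> {0..})"
    using i unfolding J_def[symmetric]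
    by (rule has_integral_Un) (auto intro: negligible_subset[of "{0}"])
  moreover have "{..0::real} \<union> {0..} = UNIV" by auto
  moreover have "cnj J + J = of_real (2 * Re J)" by (simp add: complex_eq_iff)
  ultimately have U: "(fourier ?\<phi> has_integral of_real (2 * Re J)) UNIV" by simp
  have "((\<lambda>t. fourier ?\<phi> (t - s)) has_integral of_real (2 * Re J)) UNIV" for s
    using has_integral_real_isometry[OF U, of 1 "- s"] by simp
  moreover have "2 * Re J \<ge> pi"
    using fourier_half_mass[OF \<phi> p] by (simp add: J_def)
  ultimately show ?thesis using that by blast
qed


section \<open>Bounded semigroups and the resolvent of the generator\<close>

locale bounded_C0_semigroup =
  fixes T :: "real \<Rightarrow> 'a::complex_banach \<Rightarrow> 'a" and M :: real
  assumes C0: "C0_semigroup T"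
    and M_nonneg: "0 \<le> M"
    and norm_T: "\<And>t u. t \<ge> 0 \<Longrightarrow> norm (T t u) \<le> M * norm u"
begin

lemma T_linear: "t \<ge> 0 \<Longrightarrow> bounded_linear (T t)"
  and T_scaleC: "t \<ge> 0 \<Longrightarrow> T t (c *\<^sub>C u) = c *\<^sub>C T t u"
  and T_0 [simp]: "T 0 u = u"
  and T_add: "s \<ge> 0 \<Longrightarrow> t \<ge> 0 \<Longrightarrow> T (s + t) u = T s (T t u)"
  and T_tendsto: "((\<lambda>t. T t u) \<longlongrightarrow> u) (at_right 0)"
  using C0 unfolding C0_semigroup_def by blast+

lemma T_diff: "t \<ge> 0 \<Longrightarrow> T t (u - v) = T t u - T t v"
  using T_linear[of t] by (simp add: bounded_linear.linear linear_diff)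

lemma T_commute: "s \<ge> 0 \<Longrightarrow> t \<ge> 0 \<Longrightarrow> T s (T t u) = T t (T s u)"
  using T_add[of s t u] T_add[of t s u] by (simp add: add.commute)

text \<open>\<open>T s u - T t u\<close> is the image of \<open>T (s - t) u - u\<close> under the bounded operator \<open>T t\<close>.\<close>

lemma orbit_uniformly_continuous:
  assumes "e > 0"
  obtains d where "d > 0" "\<And>s t. s \<ge> 0 \<Longrightarrow> t \<ge> 0 \<Longrightarrow> \<bar>s - t\<bar> < d \<Longrightarrow> norm (T s u - T t u) \<le> e"
proof -
  have "e / (M + 1) > 0" using assms M_nonneg by (intro divide_pos_pos) auto
  from tendstoD[OF T_tendsto[of u] this]
  obtain d where d: "d > 0" "\<And>h. 0 < h \<Longrightarrow> h < d \<Longrightarrow> dist (T h u) u < e / (M + 1)"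
    unfolding eventually_at_right_field by auto
  have *: "norm (T s u - T t u) \<le> e" if "0 \<le> t" "t < s" "s - t < d" for s t
  proof -
    have "T s u - T t u = T t (T (s - t) u - u)"
      using that T_add[of t "s - t" u] by (simp add: T_diff)
    also have "norm \<dots> \<le> M * norm (T (s - t) u - u)"
      using that by (intro norm_T) auto
    also have "\<dots> \<le> (M + 1) * (e / (M + 1))"
      using d(2)[of "s - t"] that M_nonneg by (intro mult_mono) (auto simp: dist_norm)
    also have "\<dots> = e" using M_nonneg by simp
    finally show ?thesis .
  qed
  show ?thesis
  proof (rule that[OF d(1)])
    fix s t :: real assume "s \<ge> 0" "t \<ge> 0" "\<bar>s - t\<bar> < d"
    then show "norm (T s u - T t u) \<le> e"
      using *[of t s] *[of s t] assms by (cases s t rule: linorder_cases) (auto simp: norm_minus_commute)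
  qed
qed

lemma orbit_continuous: "continuous_on {0..} (\<lambda>t. T t u)"
  unfolding continuous_on_iff
proof (intro ballI allI impI)
  fix s e :: real assume "s \<in> {0..}" "e > 0"
  obtain d where d: "d > 0" "\<And>s t. s \<ge> 0 \<Longrightarrow> t \<ge> 0 \<Longrightarrow> \<bar>s - t\<bar> < d \<Longrightarrow> norm (T s u - T t u) \<le> e/2"
    using orbit_uniformly_continuous[of "e/2" u] \<open>e > 0\<close> by auto
  have "dist (T t u) (T s u) < e" if "t \<in> {0..}" "dist t s < d" for t
    using d(2)[of t s] that \<open>s \<in> {0..}\<close> \<open>e > 0\<close> by (simp add: dist_norm)
  then show "\<exists>d>0. \<forall>t\<in>{0..}. dist t s < d \<longrightarrow> dist (T t u) (T s u) < e"
    using d(1) by blast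
qed

text \<open>The Laplace transform of the orbits, which will turn out to be the resolvent.\<close>

abbreviation R :: "complex \<Rightarrow> 'a \<Rightarrow> 'a" where
  "R z u \<equiv> laplace (\<lambda>t. T t u) z"

lemmas R_has_integral = laplace_has_integral[OF orbit_continuous norm_T]
lemmas norm_R = norm_laplace_le[OF orbit_continuous norm_T]

lemma R_scaleC:
  assumes z: "Re z > 0"
  shows "R z (c *\<^sub>C u) = c *\<^sub>C R z u"
proof -
  have "((\<lambda>t. c *\<^sub>C exp (- z * of_real t) *\<^sub>C T t u) has_integral c *\<^sub>C R z u) {0..}"
    using has_integral_linear[OF R_has_integral[OF _ z, of u] scaleC.bounded_linear_right[of c]]
    by (simp add: o_def)
  then have "((\<lambda>t. exp (- z * of_real t) *\<^sub>C T t (c *\<^sub>C u)) has_integral c *\<^sub>C R z u) {0..}"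
    by (rule has_integral_eq[rotated]) (simp add: T_scaleC scaleC_scaleC mult.commute)
  then show ?thesis unfolding laplace_def[of "\<lambda>t. T t (c *\<^sub>C u)"] by (rule integral_unique)
qed

lemma R_bounded_linear:
  assumes z: "Re z > 0"
  shows "bounded_linear (R z)"
proof
  fix u v and r :: real
  have "((\<lambda>t. exp (- z * of_real t) *\<^sub>C T t (u + v)) has_integral R z u + R z v) {0..}"
    by (rule has_integral_eq[OF _ has_integral_add[OF R_has_integral[OF _ z] R_has_integral[OF _ z]]])
       (auto simp: bounded_linear.linear[OF T_linear] linear_add scaleC.add_right)
  then show "R z (u + v) = R z u + R z v"
    unfolding laplace_def[of "\<lambda>t. T t (u + v)"] by (rule integral_unique)
  show "R z (r *\<^sub>R u) = r *\<^sub>R R z u" by (simp add: scaleR_scaleC R_scaleC[OF z])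
  show "\<exists>K. \<forall>u. norm (R z u) \<le> norm u * K"
    using norm_R[OF _ z] by (intro exI[of _ "M / Re z"]) (auto simp: mult.commute)
qed

lemma T_R:
  assumes z: "Re z > 0" and s: "s \<ge> 0"
  shows "T s (R z u) = R z (T s u)"
proof -
  have "((\<lambda>t. T s (exp (- z * of_real t) *\<^sub>C T t u)) has_integral T s (R z u)) {0..}"
    using has_integral_linear[OF R_has_integral[OF _ z, of u] T_linear[OF s]]
    by (simp add: o_def)
  then have "((\<lambda>t. exp (- z * of_real t) *\<^sub>C T t (T s u)) has_integral T s (R z u)) {0..}"
    by (rule has_integral_eq[rotated]) (simp add: T_scaleC s T_commute)
  then show ?thesis unfolding laplace_def[of "\<lambda>t. T t (T s u)"] by (rule integral_unique[symmetric])
qed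

text \<open>The orbit of \<open>R z u\<close> is the tail of the Laplace integral, shifted back to the origin. This
  exhibits it through a primitive, which makes it differentiable.\<close>

lemma T_R_eq:
  assumes z: "Re z > 0" and s: "s \<ge> 0"
  shows "T s (R z u) = exp (z * of_real s) *\<^sub>C
     (R z u - integral {0..s} (\<lambda>r. exp (- z * of_real r) *\<^sub>C T r u))"
proof -
  let ?h = "\<lambda>r. exp (- z * of_real r) *\<^sub>C T r u"
  have i: "?h integrable_on {s..}" "?h integrable_on {0..}"
    using laplace_integrable(1)[OF orbit_continuous norm_T, of z s u] R_has_integral[OF _ z, of u] z s
    by (auto simp: has_integral_integrable)
  have split: "R z u = integral {0..s} ?h + integral {s..} ?h"
    unfolding laplace_def by (rule integral_half_line_split[OF i(2,1) s])
  have "{t. 1 * t + s \<in> {s..}} = {0..}" by auto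
  from has_integral_real_isometry[OF integrable_integral[OF i(1)], of 1 s, unfolded this]
  have "((\<lambda>t. ?h (t + s)) has_integral integral {s..} ?h) {0..}" by simp
  from has_integral_linear[OF this scaleC.bounded_linear_right[of "exp (z * of_real s)"]]
  have "((\<lambda>t. exp (z * of_real s) *\<^sub>C ?h (t + s)) has_integral exp (z * of_real s) *\<^sub>C integral {s..} ?h) {0..}"
    by (simp add: o_def)
  then have "((\<lambda>t. exp (- z * of_real t) *\<^sub>C T t (T s u)) has_integral
      exp (z * of_real s) *\<^sub>C integral {s..} ?h) {0..}"
  proof (rule has_integral_eq[rotated])
    fix t :: real assume "t \<in> {0..}"
    then show "exp (z * of_real s) *\<^sub>C ?h (t + s) = exp (- z * of_real t) *\<^sub>C T t (T s u)"
      using T_add[of t s u] s by (simp add: scaleC_scaleC mult_exp_exp algebra_simps)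
  qed
  then have "R z (T s u) = exp (z * of_real s) *\<^sub>C integral {s..} ?h"
    unfolding laplace_def[of "\<lambda>t. T t (T s u)"] by (rule integral_unique)
  then show ?thesis using T_R[OF z s, of u] split by simp
qed

lemma orbit_R_derivative:
  assumes z: "Re z > 0" and s: "s \<in> {0..b}"
  shows "((\<lambda>t. T t (R z u)) has_vector_derivative z *\<^sub>C T s (R z u) - T s u) (at s within {0..b})"
proof -
  let ?h = "\<lambda>r. exp (- z * of_real r) *\<^sub>C T r u"
  let ?V = "\<lambda>t. exp (z * of_real t) *\<^sub>C (R z u - integral {0..t} ?h)"
  have "continuous_on {0..b} ?h"
    by (intro scaleC.continuous_on continuous_intros continuous_on_subset[OF orbit_continuous]) auto
  from integral_has_vector_derivative[OF this s]
  have 1: "((\<lambda>t. R z u - integral {0..t} ?h) has_vector_derivative 0 - ?h s) (at s within {0..b})"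
    by (intro has_vector_derivative_diff has_vector_derivative_const)
  have "((\<lambda>w. exp (z * w)) has_field_derivative exp (z * of_real s) * z) (at (of_real s))"
    by (auto intro!: derivative_eq_intros)
  from has_vector_derivative_at_within[OF has_vector_derivative_real_field[OF this]]
  have 2: "((\<lambda>t. exp (z * of_real t)) has_vector_derivative exp (z * of_real s) * z) (at s within {0..b})" .
  from scaleC.has_vector_derivative[OF 2 1]
  have "(?V has_vector_derivative exp (z * of_real s) *\<^sub>C (0 - ?h s) +
      (exp (z * of_real s) * z) *\<^sub>C (R z u - integral {0..s} ?h)) (at s within {0..b})" .
  moreover have "exp (z * of_real s) *\<^sub>C (0 - ?h s) = - T s u"
    by (simp add: scaleC.minus_right scaleC_scaleC mult_exp_exp)
  moreover have "(exp (z * of_real s) * z) *\<^sub>C (R z u - integral {0..s} ?h) = z *\<^sub>C T s (R z u)"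
    using T_R_eq[OF z, of s u] s by (simp add: scaleC_scaleC mult.commute)
  ultimately have "(?V has_vector_derivative z *\<^sub>C T s (R z u) - T s u) (at s within {0..b})"
    by simp
  then show ?thesis
    by (rule has_vector_derivative_transform[OF s, rotated]) (use T_R_eq[OF z] in auto)
qed

lemma generator_R:
  assumes z: "Re z > 0"
  shows "generator T (R z u) = Some (z *\<^sub>C R z u - u)"
proof -
  let ?D = "z *\<^sub>C R z u - u"
  have "((\<lambda>t. T t (R z u)) has_derivative (\<lambda>h. h *\<^sub>R ?D)) (at 0 within {0..1})"
    using orbit_R_derivative[OF z, of 0 1 u] by (simp add: has_vector_derivative_def)
  then have "((\<lambda>t. (1 / norm (t - 0)) *\<^sub>R (T t (R z u) - (T 0 (R z u) + (t - 0) *\<^sub>R ?D))) \<longlongrightarrow> 0) (at_right 0)"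
    unfolding has_derivative_within at_within_Icc_at_right[OF zero_less_one] by blast
  then have "((\<lambda>t. (1 / t) *\<^sub>R (T t (R z u) - R z u) - ?D) \<longlongrightarrow> 0) (at_right 0)"
  proof (rule Lim_transform_eventually)
    show "\<forall>\<^sub>F t in at_right 0. (1 / norm (t - 0)) *\<^sub>R (T t (R z u) - (T 0 (R z u) + (t - 0) *\<^sub>R ?D))
        = (1 / t) *\<^sub>R (T t (R z u) - R z u) - ?D"
      using eventually_at_right_less[of 0] by eventually_elim (simp add: algebra_simps)
  qed
  then have "((\<lambda>t. (1 / t) *\<^sub>R (T t (R z u) - R z u)) \<longlongrightarrow> ?D) (at_right 0)"
    by (simp add: LIM_zero_iff)
  then show ?thesis
    unfolding generator_def by (auto intro!: tendsto_Lim)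
qed

text \<open>\<open>R z\<close> commutes with the semigroup, hence with the difference quotients that define the
  generator.\<close>

lemma R_generator:
  assumes z: "Re z > 0" and v: "v \<in> dom (generator T)"
  shows "R z (z *\<^sub>C v - the (generator T v)) = v"
proof -
  obtain w where w: "((\<lambda>t. (1 / t) *\<^sub>R (T t v - v)) \<longlongrightarrow> w) (at_right 0)" "generator T v = Some w"
  proof -
    have "\<exists>w. ((\<lambda>t. (1 / t) *\<^sub>R (T t v - v)) \<longlongrightarrow> w) (at_right 0)"
      using v unfolding generator_def by (auto split: if_splits)
    then obtain w where w: "((\<lambda>t. (1 / t) *\<^sub>R (T t v - v)) \<longlongrightarrow> w) (at_right 0)" by blast
    then have "generator T v = Some w"
      unfolding generator_def by (auto intro!: tendsto_Lim)
    with w show ?thesis using that by blast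
  qed
  interpret R: bounded_linear "R z" by (rule R_bounded_linear[OF z])
  have "((\<lambda>t. R z ((1 / t) *\<^sub>R (T t v - v))) \<longlongrightarrow> R z w) (at_right 0)"
    by (rule R.tendsto[OF w(1)])
  then have "((\<lambda>t. (1 / t) *\<^sub>R (T t (R z v) - R z v)) \<longlongrightarrow> R z w) (at_right 0)"
  proof (rule Lim_transform_eventually)
    show "\<forall>\<^sub>F t in at_right 0. R z ((1 / t) *\<^sub>R (T t v - v)) = (1 / t) *\<^sub>R (T t (R z v) - R z v)"
      using eventually_at_right_less[of 0]
      by eventually_elim (simp add: R.scaleR R.diff T_R[OF z])
  qed
  then have "generator T (R z v) = Some (R z w)"
    unfolding generator_def by (auto intro!: tendsto_Lim)
  with generator_R[OF z, of v] have "R z w = z *\<^sub>C R z v - v" by simp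
  then show ?thesis by (simp add: w(2) R.diff R_scaleC[OF z])
qed

lemma resolvent_eq_R:
  assumes z: "Re z > 0"
  shows "resolvent z (generator T) u = R z u"
  unfolding resolvent_def
proof (rule the_inv_into_f_eq)
  show "inj_on (\<lambda>u. z *\<^sub>C u - the (generator T u)) (dom (generator T))"
    using R_generator[OF z] by (rule inj_on_inverseI)
  show "z *\<^sub>C R z u - the (generator T (R z u)) = u" by (simp add: generator_R[OF z])
  show "R z u \<in> dom (generator T)" using generator_R[OF z, of u] by auto
qed

lemma resolvent_identity:
  assumes z: "Re z > 0" and w: "Re w > 0"
  shows "R w u - R z u = (z - w) *\<^sub>C R z (R w u)"
proof -
  interpret R: bounded_linear "R z" by (rule R_bounded_linear[OF z])
  have "R w u \<in> dom (generator T)" using generator_R[OF w, of u] by auto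
  from R_generator[OF z this]
  have "R z ((z - w) *\<^sub>C R w u + u) = R w u"
    by (simp add: generator_R[OF w] scaleC.diff_left algebra_simps)
  then show ?thesis by (simp add: R.add R_scaleC[OF z] algebra_simps)
qed

end

lemma bounded_C0_semigroup_exists_bound:
  assumes "C0_semigroup T" "bounded_semigroup T"
  shows "\<exists>M. bounded_C0_semigroup T M"
proof -
  obtain M where M: "\<And>t. t \<ge> 0 \<Longrightarrow> onorm (T t) \<le> M"
    using assms(2) unfolding bounded_semigroup_def bdd_above_def by auto
  have "norm (T t u) \<le> max M 0 * norm u" if "t \<ge> 0" for t u
  proof -
    have "bounded_linear (T t)" using assms(1) that unfolding C0_semigroup_def by blast
    then have "norm (T t u) \<le> onorm (T t) * norm u" by (rule onorm)
    also have "\<dots> \<le> max M 0 * norm u" using M[OF that] by (intro mult_right_mono) auto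
    finally show ?thesis .
  qed
  then have "bounded_C0_semigroup T (max M 0)"
    using assms(1) by unfold_locales auto
  then show ?thesis by blast
qed


section \<open>Smoothed orbits\<close>

lemma half_line: "closed {0::real..}" "is_interval {0::real..}"
  by (auto simp: is_interval_ci)

context bounded_C0_semigroup
begin

text \<open>The convolution of the orbit of \<open>u\<close>, extended by \<open>0\<close>, with the reflected transform of \<open>\<phi>\<close>.\<close>

definition smoothing :: "(real \<Rightarrow> complex) \<Rightarrow> 'a \<Rightarrow> real \<Rightarrow> 'a" where
  "smoothing \<phi> u s = integral {0..} (\<lambda>t. fourier \<phi> (t - s) *\<^sub>C T t u)"

definition smooth_precompact :: "'a \<Rightarrow> (real \<Rightarrow> complex) \<Rightarrow> bool" where
  "smooth_precompact u \<phi> \<longleftrightarrow> relatively_compact (smoothing \<phi> u ` {0..})"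

lemma continuous_on_fourier_shift:
  assumes "\<phi> \<in> test_functions I"
  shows "continuous_on S (\<lambda>t. fourier \<phi> (t - s))"
  by (rule continuous_on_compose2[OF continuous_on_fourier[OF assms, of UNIV]])
     (auto intro!: continuous_intros)

lemma smoothing_bound:
  assumes \<phi>: "\<phi> \<in> test_functions I"
    and C: "C \<ge> 0" "r > 0" "\<And>t. norm (fourier \<phi> t) \<le> C / (1 + (r * t)\<^sup>2)"
  shows "(\<lambda>t. fourier \<phi> (t - s) *\<^sub>C T t u) integrable_on {0..}"
    and "norm (smoothing \<phi> u s) \<le> C * (M * norm u) * pi / r"
  unfolding smoothing_def
  by (rule weighted_integral[OF half_line continuous_on_fourier_shift[OF \<phi>] orbit_continuous C(2),
        where C = C and B = "M * norm u" and s = s];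
      use C norm_T M_nonneg in simp)+

lemma smoothing_integrable:
  assumes "\<phi> \<in> test_functions I"
  shows "(\<lambda>t. fourier \<phi> (t - s) *\<^sub>C T t u) integrable_on {0..}"
proof -
  obtain C where C: "C \<ge> 0" "\<And>t. norm (fourier \<phi> t) \<le> C / (1 + t\<^sup>2)"
    using fourier_quadratic_decay[OF assms] by blast
  show ?thesis by (rule smoothing_bound(1)[OF assms C(1) zero_less_one]) (use C in simp)
qed

lemma smoothing_has_integral:
  "\<phi> \<in> test_functions I \<Longrightarrow>
    ((\<lambda>t. fourier \<phi> (t - s) *\<^sub>C T t u) has_integral smoothing \<phi> u s) {0..}"
  unfolding smoothing_def by (intro integrable_integral smoothing_integrable)

lemma smoothing_uniform_bound:
  assumes "\<phi> \<in> test_functions I"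
  obtains D where "D \<ge> 0" "\<And>u s. norm (smoothing \<phi> u s) \<le> D * norm u"
proof -
  obtain C where C: "C \<ge> 0" "\<And>t. norm (fourier \<phi> t) \<le> C / (1 + t\<^sup>2)"
    using fourier_quadratic_decay[OF assms] by blast
  have "norm (smoothing \<phi> u s) \<le> C * (M * norm u) * pi / 1" for u s
    by (rule smoothing_bound(2)[OF assms C(1) zero_less_one]) (use C in simp)
  then show ?thesis
    using C(1) M_nonneg by (intro that[of "C * M * pi"]) (auto simp: mult_ac)
qed

lemma smoothing_add:
  assumes "\<phi> \<in> test_functions I" "\<psi> \<in> test_functions I"
  shows "smoothing (\<lambda>\<xi>. \<phi> \<xi> + \<psi> \<xi>) u s = smoothing \<phi> u s + smoothing \<psi> u s"
  unfolding smoothing_def fourier_add[OF assms] scaleC.add_left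
  by (rule Henstock_Kurzweil_Integration.integral_add[OF smoothing_integrable[OF assms(1)]
        smoothing_integrable[OF assms(2)]])

lemma smoothing_mult:
  assumes "\<phi> \<in> test_functions I"
  shows "smoothing (\<lambda>\<xi>. c * \<phi> \<xi>) u s = c *\<^sub>C smoothing \<phi> u s"
proof -
  have "((\<lambda>t. c *\<^sub>C fourier \<phi> (t - s) *\<^sub>C T t u) has_integral c *\<^sub>C smoothing \<phi> u s) {0..}"
    using has_integral_linear[OF smoothing_has_integral[OF assms] scaleC.bounded_linear_right]
    by (simp add: o_def)
  then show ?thesis
    unfolding smoothing_def[of "\<lambda>\<xi>. c * \<phi> \<xi>"] by (simp add: fourier_mult scaleC_scaleC integral_unique)
qed

text \<open>An operator that commutes with the semigroup commutes with smoothing. This covers the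
  resolvent and complex scalars.\<close>

lemma smoothing_commute:
  assumes \<phi>: "\<phi> \<in> test_functions I" and L: "bounded_linear L" "\<And>c v. L (c *\<^sub>C v) = c *\<^sub>C L v"
    and comm: "\<And>t. t \<ge> 0 \<Longrightarrow> T t (L u) = L (T t u)"
  shows "smoothing \<phi> (L u) s = L (smoothing \<phi> u s)"
proof -
  have "((\<lambda>t. L (fourier \<phi> (t - s) *\<^sub>C T t u)) has_integral L (smoothing \<phi> u s)) {0..}"
    using has_integral_linear[OF smoothing_has_integral[OF \<phi>] L(1)] by (simp add: o_def)
  then have "((\<lambda>t. fourier \<phi> (t - s) *\<^sub>C T t (L u)) has_integral L (smoothing \<phi> u s)) {0..}"
    by (rule has_integral_eq[rotated]) (simp add: L(2) comm)
  then show ?thesis unfolding smoothing_def[of \<phi> "L u"] by (rule integral_unique)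
qed

lemma smoothing_R:
  assumes "\<phi> \<in> test_functions I" "Re z > 0"
  shows "smoothing \<phi> (R z u) s = R z (smoothing \<phi> u s)"
  by (rule smoothing_commute[OF assms(1) R_bounded_linear R_scaleC T_R]) (use assms in auto)

lemma smoothing_scaleC:
  assumes "\<phi> \<in> test_functions I"
  shows "smoothing \<phi> (c *\<^sub>C u) s = c *\<^sub>C smoothing \<phi> u s"
  by (rule smoothing_commute[OF assms scaleC.bounded_linear_right])
     (auto simp: T_scaleC scaleC_scaleC mult.commute)

lemma smoothing_diff:
  assumes "\<phi> \<in> test_functions I"
  shows "smoothing \<phi> (u - v) s = smoothing \<phi> u s - smoothing \<phi> v s"
proof -
  have "((\<lambda>t. fourier \<phi> (t - s) *\<^sub>C T t u - fourier \<phi> (t - s) *\<^sub>C T t v)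
      has_integral smoothing \<phi> u s - smoothing \<phi> v s) {0..}"
    by (intro has_integral_diff smoothing_has_integral[OF assms])
  then have "((\<lambda>t. fourier \<phi> (t - s) *\<^sub>C T t (u - v)) has_integral smoothing \<phi> u s - smoothing \<phi> v s) {0..}"
    by (rule has_integral_eq[rotated]) (simp add: T_diff scaleC.diff_right)
  then show ?thesis unfolding smoothing_def[of \<phi> "u - v"] by (rule integral_unique)
qed

lemma smooth_precompact_add:
  assumes "\<phi> \<in> test_functions I" "\<psi> \<in> test_functions I" "smooth_precompact u \<phi>" "smooth_precompact u \<psi>"
  shows "smooth_precompact u (\<lambda>\<xi>. \<phi> \<xi> + \<psi> \<xi>)"
  using relatively_compact_add[OF assms(3,4)[unfolded smooth_precompact_def]]
  unfolding smooth_precompact_def by (simp add: smoothing_add[OF assms(1,2)])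

lemma smooth_precompact_zero: "smooth_precompact u (\<lambda>\<xi>. 0)"
  using relatively_compact_const[of 0 "{0..}"]
  by (simp add: smooth_precompact_def smoothing_def fourier_def scaleC.zero_left)

text \<open>The link between the boundary resolvent and the orbit, by \<open>abel_summation\<close> for the modulated
  test function.\<close>

lemma boundary_resolvent_modulated:
  assumes \<phi>: "\<phi> \<in> test_functions I"
  shows "boundary_resolvent (generator T) u (\<lambda>\<xi>. exp (\<i> * of_real (s * \<xi>)) * \<phi> \<xi>) = smoothing \<phi> u s"
proof -
  let ?\<psi> = "\<lambda>\<xi>. exp (\<i> * of_real (s * \<xi>)) * \<phi> \<xi>"
  have \<psi>: "?\<psi> \<in> test_functions I" by (rule test_functions_mult[OF \<phi> smooth_cis])
  have "((\<lambda>\<alpha>. integral UNIV (\<lambda>\<xi>. ?\<psi> \<xi> *\<^sub>C R (of_real \<alpha> + \<i> * of_real \<xi>) u)) \<longlongrightarrow>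
      integral {0..} (\<lambda>t. fourier ?\<psi> t *\<^sub>C T t u)) (at_right 0)"
    by (rule abel_summation[OF \<psi> orbit_continuous norm_T])
  then have "((\<lambda>\<alpha>. integral UNIV (\<lambda>\<xi>. ?\<psi> \<xi> *\<^sub>C resolvent (of_real \<alpha> + \<i> * of_real \<xi>) (generator T) u)) \<longlongrightarrow>
      integral {0..} (\<lambda>t. fourier ?\<psi> t *\<^sub>C T t u)) (at_right 0)"
  proof (rule Lim_transform_eventually)
    show "\<forall>\<^sub>F \<alpha> in at_right 0. integral UNIV (\<lambda>\<xi>. ?\<psi> \<xi> *\<^sub>C R (of_real \<alpha> + \<i> * of_real \<xi>) u) =
        integral UNIV (\<lambda>\<xi>. ?\<psi> \<xi> *\<^sub>C resolvent (of_real \<alpha> + \<i> * of_real \<xi>) (generator T) u)"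
      using eventually_at_right_less[of 0]
      by eventually_elim (simp add: resolvent_eq_R)
  qed
  then show ?thesis
    unfolding boundary_resolvent_def smoothing_def fourier_modulate by (intro tendsto_Lim) auto
qed

text \<open>On the set where the boundary resolvent is a local pseudofunction, smoothed orbits are averages
  of a \<^term>\<open>C0_functions\<close> function, whose range is relatively compact.\<close>

lemma smooth_precompact_off_spectrum:
  assumes "\<xi>\<^sub>0 \<notin> sing_supp_PF (boundary_resolvent (generator T) u)"
  shows "\<exists>J. open J \<and> \<xi>\<^sub>0 \<in> J \<and> (\<forall>\<phi>\<in>test_functions J. smooth_precompact u \<phi>)"
proof -
  let ?f = "boundary_resolvent (generator T) u"
  obtain U where "local_pseudofunction_on U ?f" "\<xi>\<^sub>0 \<in> U"
    using assms unfolding sing_supp_PF_def by blast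
  then obtain J h where J: "open J" "\<xi>\<^sub>0 \<in> J" and h: "h \<in> PF" "\<forall>\<phi>\<in>test_functions J. ?f \<phi> = h \<phi>"
    unfolding local_pseudofunction_on_def by meson
  then obtain g where g: "g \<in> C0_functions" "h = fourier_distribution (regular_distribution g)"
    unfolding PF_def by blast
  have "smooth_precompact u \<phi>" if \<phi>: "\<phi> \<in> test_functions J" for \<phi>
  proof -
    have eq: "smoothing \<phi> u s = integral UNIV (\<lambda>t. fourier \<phi> (t - s) *\<^sub>C g t)" for s
    proof -
      have "(\<lambda>\<xi>. exp (\<i> * of_real (s * \<xi>)) * \<phi> \<xi>) \<in> test_functions J"
        by (rule test_functions_mult[OF \<phi> smooth_cis])
      then show ?thesis
        using h(2) boundary_resolvent_modulated[OF \<phi>, of u s]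
        by (simp add: g(2) fourier_distribution_def regular_distribution_def fourier_modulate del: of_real_mult)
    qed
    obtain C where C: "C \<ge> 0" "\<And>t. norm (fourier \<phi> t) \<le> C / (1 + t\<^sup>2)"
      using fourier_quadratic_decay[OF \<phi>] by blast
    have "relatively_compact ((\<lambda>s. integral UNIV (\<lambda>t. fourier \<phi> (t - s) *\<^sub>C g t)) ` {0..})"
    proof (rule relatively_compact_averages[where C = "C * (pi / 1)" and g = "\<lambda>s t. C * (1 / (1 + (1 * (t - s))\<^sup>2))"])
      show "continuous_on UNIV g" using g(1) by (simp add: C0_functions_def)
      show "relatively_compact (range g)" by (rule C0_function_relatively_compact[OF g(1)])
      show "norm (fourier \<phi> (t - s)) \<le> C * (1 / (1 + (1 * (t - s))\<^sup>2))" for t s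
        using C(2)[of "t - s"] by simp
      fix s :: real
      show "continuous_on UNIV (\<lambda>t. fourier \<phi> (t - s))" by (rule continuous_on_fourier_shift[OF \<phi>])
      show "(\<lambda>t. C * (1 / (1 + (1 * (t - s))\<^sup>2))) integrable_on UNIV"
        by (intro integrable_on_mult_right cauchy_kernel_integrable) auto
      have "integral UNIV (\<lambda>t. 1 / (1 + (1 * (t - s))\<^sup>2)) \<le> pi / 1"
        by (rule cauchy_kernel_integrable) auto
      then show "integral UNIV (\<lambda>t. C * (1 / (1 + (1 * (t - s))\<^sup>2))) \<le> C * (pi / 1)"
        unfolding Henstock_Kurzweil_Integration.integral_mult_right using C(1) by (rule mult_left_mono)
    qed (auto simp: is_interval_univ)
    then show ?thesis unfolding smooth_precompact_def eq .
  qed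
  with J show ?thesis by blast
qed

text \<open>Spectral synthesis at a point: multiplication by \<^term>\<open>\<xi> - \<omega>\<close> makes the part of the test function
  within distance \<open>\<epsilon>\<close> of \<^term>\<open>\<omega>\<close> have a Fourier transform of \<open>L\<^sup>1\<close> norm \<open>O(\<epsilon>)\<close>.\<close>

lemma smooth_precompact_vanishing:
  assumes \<phi>: "\<phi> \<in> test_functions J"
    and off: "\<And>\<psi>. \<psi> \<in> test_functions (J - {\<omega>}) \<Longrightarrow> smooth_precompact u \<psi>"
  shows "smooth_precompact u (\<lambda>\<xi>. (of_real \<xi> - of_real \<omega>) * \<phi> \<xi>)"
  unfolding smooth_precompact_def
proof (rule relatively_compact_approx)
  fix e :: real assume "e > 0"
  \<comment> \<open>Near \<open>\<omega>\<close> the factor \<open>\<xi> - \<omega>\<close> is \<open>\<epsilon>\<close> times a fixed function of \<open>(\<xi> - \<omega>) / \<epsilon>\<close>, cut off at \<open>2\<close>.\<close>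
  define \<kappa> where "\<kappa> = (\<lambda>t. complex_of_real t * of_real (cutoff t))"
  have \<kappa>: "\<kappa> \<in> test_functions {-3<..<3}"
  proof (rule test_functionsI[of _ "{-2..2}"])
    show "smooth \<kappa>" unfolding \<kappa>_def using smooth_cutoff[of 1 0] by (intro smooth_mult smooth_of_real) simp
    show "t \<in> {-2..2}" if "\<kappa> t \<noteq> 0" for t
      using that cutoff_values(4)[of t] by (cases "2 \<le> \<bar>t\<bar>") (auto simp: \<kappa>_def)
  qed auto
  have 2: "nth_deriv 2 f \<in> test_functions I" if "f \<in> test_functions I" for f I
    using that by (simp add: numeral_2_eq_2 nth_deriv_Suc test_functions_deriv)
  obtain S where S: "S \<ge> 0" "\<And>t. norm (\<phi> t) \<le> S" "\<And>t. norm (deriv_fun \<phi> t) \<le> S" "\<And>t. norm (nth_deriv 2 \<phi> t) \<le> S"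
    "\<And>t. norm (\<kappa> t) \<le> S" "\<And>t. norm (deriv_fun \<kappa> t) \<le> S" "\<And>t. norm (nth_deriv 2 \<kappa> t) \<le> S"
  proof -
    obtain S1 where S1: "S1 \<ge> 0" "\<And>t. norm (\<phi> t) \<le> S1" using test_function_bounded[OF \<phi>] by blast
    obtain S2 where S2: "S2 \<ge> 0" "\<And>t. norm (deriv_fun \<phi> t) \<le> S2"
      using test_function_bounded[OF test_functions_deriv[OF \<phi>]] by blast
    obtain S3 where S3: "S3 \<ge> 0" "\<And>t. norm (nth_deriv 2 \<phi> t) \<le> S3" using test_function_bounded[OF 2[OF \<phi>]] by blast
    obtain S4 where S4: "S4 \<ge> 0" "\<And>t. norm (\<kappa> t) \<le> S4" using test_function_bounded[OF \<kappa>] by blast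
    obtain S5 where S5: "S5 \<ge> 0" "\<And>t. norm (deriv_fun \<kappa> t) \<le> S5"
      using test_function_bounded[OF test_functions_deriv[OF \<kappa>]] by blast
    obtain S6 where S6: "S6 \<ge> 0" "\<And>t. norm (nth_deriv 2 \<kappa> t) \<le> S6" using test_function_bounded[OF 2[OF \<kappa>]] by blast
    have le: "0 \<le> S1+S2+S3+S4+S5+S6" "S1 \<le> S1+S2+S3+S4+S5+S6" "S2 \<le> S1+S2+S3+S4+S5+S6" "S3 \<le> S1+S2+S3+S4+S5+S6"
      "S4 \<le> S1+S2+S3+S4+S5+S6" "S5 \<le> S1+S2+S3+S4+S5+S6" "S6 \<le> S1+S2+S3+S4+S5+S6"
      using S1(1) S2(1) S3(1) S4(1) S5(1) S6(1) by linarith+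
    show ?thesis
      by (rule that[OF le(1) order_trans[OF S1(2) le(2)] order_trans[OF S2(2) le(3)]
            order_trans[OF S3(2) le(4)] order_trans[OF S4(2) le(5)] order_trans[OF S5(2) le(6)]
            order_trans[OF S6(2) le(7)]])
  qed
  \<comment> \<open>\<open>Q * \<epsilon>\<close> is the bound for the smoothing of the part near \<open>\<omega>\<close>: it is supported on length \<open>4 \<epsilon>\<close>, has
    size \<open>O(\<epsilon>)\<close> and second derivative \<open>O(1 / \<epsilon>)\<close>, and \<open>fourier_decay\<close> is used with \<open>\<rho> = \<epsilon>\<close>.\<close>
  define Q where "Q = 20 * S\<^sup>2 * (M * norm u) * pi"
  have Q: "Q \<ge> 0" using M_nonneg by (simp add: Q_def)
  define \<epsilon> where "\<epsilon> = min 1 (e / (Q + 1))"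
  have \<epsilon>: "\<epsilon> > 0" "\<epsilon> \<le> 1" "Q * \<epsilon> \<le> e"
  proof -
    show "\<epsilon> > 0" "\<epsilon> \<le> 1" using \<open>e > 0\<close> Q by (auto simp: \<epsilon>_def)
    have "Q * \<epsilon> \<le> (Q + 1) * (e / (Q + 1))"
      using Q \<open>e > 0\<close> \<open>\<epsilon> > 0\<close> by (intro mult_mono) (auto simp: \<epsilon>_def)
    then show "Q * \<epsilon> \<le> e" using Q by simp
  qed
  let ?v = "\<lambda>\<xi>. complex_of_real \<xi> - of_real \<omega>"
  let ?aff = "\<lambda>\<xi>. (1/\<epsilon>) * \<xi> + - (\<omega> / \<epsilon>)"
  define \<psi> where "\<psi> = (\<lambda>\<xi>. (1 - of_real (cutoff (?aff \<xi>))) * (?v \<xi> * \<phi> \<xi>))"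
  define \<theta> where "\<theta> = (\<lambda>\<xi>. of_real \<epsilon> * (\<phi> \<xi> * \<kappa> (?aff \<xi>)))"
  have aff: "\<epsilon> * ?aff \<xi> = \<xi> - \<omega>" for \<xi> using \<epsilon>(1) by (simp add: field_simps)
  have split: "(\<lambda>\<xi>. ?v \<xi> * \<phi> \<xi>) = (\<lambda>\<xi>. \<psi> \<xi> + \<theta> \<xi>)"
  proof
    fix \<xi>
    have "\<theta> \<xi> = of_real (\<epsilon> * ?aff \<xi>) * (of_real (cutoff (?aff \<xi>)) * \<phi> \<xi>)"
      by (simp only: \<theta>_def \<kappa>_def of_real_mult mult_ac)
    also have "\<dots> = of_real (cutoff (?aff \<xi>)) * (?v \<xi> * \<phi> \<xi>)"
      unfolding aff by (simp only: of_real_diff mult_ac)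
    finally have "\<theta> \<xi> = of_real (cutoff (?aff \<xi>)) * (?v \<xi> * \<phi> \<xi>)" .
    then show "?v \<xi> * \<phi> \<xi> = \<psi> \<xi> + \<theta> \<xi>" by (simp add: \<psi>_def algebra_simps)
  qed
  have sv: "smooth (\<lambda>\<xi>. (1 + (- 1) * of_real (cutoff (?aff \<xi>))) * (complex_of_real \<xi> + (- of_real \<omega>)))"
    by (intro smooth_mult smooth_add smooth_const smooth_of_real smooth_cutoff)
  have \<psi>: "\<psi> \<in> test_functions (J - {\<omega>})"
  proof (rule test_functionsI)
    show "smooth \<psi>"
      using smooth_mult[OF sv test_functionsD(1)[OF \<phi>]] by (simp add: \<psi>_def mult.assoc)
    show "compact (supp \<phi> \<inter> - ball \<omega> \<epsilon>)"
      by (intro compact_Int_closed test_functionsD(2)[OF \<phi>]) auto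
    show "supp \<phi> \<inter> - ball \<omega> \<epsilon> \<subseteq> J - {\<omega>}" using test_functionsD(3)[OF \<phi>] \<epsilon>(1) by auto
    fix \<xi> assume nz: "\<psi> \<xi> \<noteq> 0"
    have "\<xi> \<notin> ball \<omega> \<epsilon>"
    proof
      assume "\<xi> \<in> ball \<omega> \<epsilon>"
      then have "\<bar>\<epsilon> * ?aff \<xi>\<bar> \<le> \<epsilon>" unfolding aff by (auto simp: dist_real_def)
      then have "\<bar>?aff \<xi>\<bar> \<le> 1" using \<epsilon>(1) by (simp add: abs_mult)
      then show False using nz cutoff_values(3) by (simp add: \<psi>_def)
    qed
    moreover have "\<xi> \<in> supp \<phi>" using nz test_functionsD(4)[OF \<phi>] by (auto simp: \<psi>_def)
    ultimately show "\<xi> \<in> supp \<phi> \<inter> - ball \<omega> \<epsilon>" by simp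
  qed
  have s\<kappa>: "smooth (\<lambda>\<xi>. \<kappa> (?aff \<xi>))" by (rule smooth_affine[OF test_functionsD(1)[OF \<kappa>]])
  have s\<phi>\<kappa>: "smooth (\<lambda>\<xi>. \<phi> \<xi> * \<kappa> (?aff \<xi>))" by (intro smooth_mult s\<kappa> test_functionsD(1)[OF \<phi>])
  have \<theta>: "\<theta> \<in> test_functions J"
    using test_functions_mult[OF \<phi> smooth_mult[OF smooth_const s\<kappa>, of "of_real \<epsilon>"]]
    by (simp add: \<theta>_def mult_ac)
  have "norm (fourier \<theta> t) \<le> ((\<omega> + 2 * \<epsilon>) - (\<omega> - 2 * \<epsilon>)) * (\<epsilon> * S\<^sup>2 + \<epsilon>\<^sup>2 * (4 * S\<^sup>2 / \<epsilon>)) / (1 + (\<epsilon> * t)\<^sup>2)" for t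
  proof (rule fourier_decay[OF \<theta>])
    show "\<omega> - 2 * \<epsilon> \<le> \<omega> + 2 * \<epsilon>" using \<epsilon>(1) by simp
    show "\<theta> \<xi> = 0" if "\<xi> \<notin> {\<omega> - 2 * \<epsilon><..<\<omega> + 2 * \<epsilon>}" for \<xi>
    proof -
      have "2 * \<epsilon> \<le> \<bar>\<epsilon> * ?aff \<xi>\<bar>" unfolding aff using that by auto
      then have "2 \<le> \<bar>?aff \<xi>\<bar>" using \<epsilon>(1) by (simp add: abs_mult)
      then show ?thesis by (simp add: \<theta>_def \<kappa>_def cutoff_values(4))
    qed
    show "norm (\<theta> \<xi>) \<le> \<epsilon> * S\<^sup>2" for \<xi>
      unfolding \<theta>_def norm_mult power2_eq_square using \<epsilon>(1) S(1,2,5)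
      by (intro mult_mono mult_nonneg_nonneg) auto
    have d2: "nth_deriv 2 \<theta> \<xi> = of_real \<epsilon> * (\<phi> \<xi> * (of_real (1/\<epsilon>) ^ 2 * nth_deriv 2 \<kappa> (?aff \<xi>))
        + 2 * (deriv_fun \<phi> \<xi> * (of_real (1/\<epsilon>) * deriv_fun \<kappa> (?aff \<xi>)))
        + nth_deriv 2 \<phi> \<xi> * \<kappa> (?aff \<xi>))" for \<xi>
    proof -
      have "nth_deriv 2 \<theta> \<xi> = of_real \<epsilon> * nth_deriv 2 (\<lambda>\<xi>. \<phi> \<xi> * \<kappa> (?aff \<xi>)) \<xi>"
        unfolding \<theta>_def numeral_2_eq_2 nth_deriv_Suc nth_deriv_0
        by (simp only: deriv_fun_const_mult[OF s\<phi>\<kappa>] deriv_fun_const_mult[OF smooth_has_vector_derivative(2)[OF s\<phi>\<kappa>]])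
      then show ?thesis
        by (simp only: nth_deriv_2_mult[OF test_functionsD(1)[OF \<phi>] s\<kappa>]
            nth_deriv_2_affine[OF test_functionsD(1)[OF \<kappa>]] deriv_fun_affine[OF test_functionsD(1)[OF \<kappa>]])
    qed
    show "norm (nth_deriv 2 \<theta> \<xi>) \<le> 4 * S\<^sup>2 / \<epsilon>" for \<xi>
    proof -
      have a: "norm (\<phi> \<xi> * (of_real (1/\<epsilon>) ^ 2 * nth_deriv 2 \<kappa> (?aff \<xi>))) \<le> S * ((1/\<epsilon>)^2 * S)"
        unfolding norm_mult norm_power norm_of_real using \<epsilon>(1) S
        by (intro mult_mono mult_nonneg_nonneg) auto
      have b: "norm (2 * (deriv_fun \<phi> \<xi> * (of_real (1/\<epsilon>) * deriv_fun \<kappa> (?aff \<xi>)))) \<le> 2 * (S * ((1/\<epsilon>) * S))"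
        unfolding norm_mult norm_power norm_of_real using \<epsilon>(1) S
        by (intro mult_mono mult_nonneg_nonneg) auto
      have c: "norm (nth_deriv 2 \<phi> \<xi> * \<kappa> (?aff \<xi>)) \<le> S * S"
        unfolding norm_mult using S by (intro mult_mono) auto
      have "norm (nth_deriv 2 \<theta> \<xi>) \<le> \<epsilon> * (S * ((1/\<epsilon>)^2 * S) + 2 * (S * ((1/\<epsilon>) * S)) + S * S)"
        unfolding d2 norm_mult[of "of_real \<epsilon>"] norm_of_real
        using \<epsilon>(1) by (intro mult_mono norm_triangle_le add_mono a b c order_refl) auto
      also have "\<dots> = S\<^sup>2 * (1/\<epsilon> + 2 + \<epsilon>)"
        using \<epsilon>(1) by (simp add: field_simps power2_eq_square)
      also have "\<dots> \<le> S\<^sup>2 * (4 / \<epsilon>)"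
      proof (rule mult_left_mono)
        have "1 \<le> 1/\<epsilon>" using \<epsilon> by simp
        then show "1/\<epsilon> + 2 + \<epsilon> \<le> 4 / \<epsilon>" using \<epsilon>(2) by simp
      qed simp
      finally show ?thesis by (simp add: mult.commute)
    qed
  qed
  moreover have "((\<omega> + 2 * \<epsilon>) - (\<omega> - 2 * \<epsilon>)) * (\<epsilon> * S\<^sup>2 + \<epsilon>\<^sup>2 * (4 * S\<^sup>2 / \<epsilon>)) = 20 * S\<^sup>2 * \<epsilon>\<^sup>2"
    using \<epsilon>(1) by (simp add: power2_eq_square algebra_simps)
  ultimately have decay: "norm (fourier \<theta> t) \<le> (20 * S\<^sup>2 * \<epsilon>\<^sup>2) / (1 + (\<epsilon> * t)\<^sup>2)" for t
    by (simp only:)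
  have "norm (smoothing \<theta> u s) \<le> e" for s
  proof -
    have "norm (smoothing \<theta> u s) \<le> (20 * S\<^sup>2 * \<epsilon>\<^sup>2) * (M * norm u) * pi / \<epsilon>"
      by (rule smoothing_bound(2)[OF \<theta> _ \<epsilon>(1) decay]) simp
    also have "\<dots> = Q * \<epsilon>" using \<epsilon>(1) by (simp add: Q_def power2_eq_square)
    finally show ?thesis using \<epsilon>(3) by simp
  qed
  moreover have "smoothing (\<lambda>\<xi>. ?v \<xi> * \<phi> \<xi>) u s - smoothing \<psi> u s = smoothing \<theta> u s" for s
  proof -
    have "\<psi> \<in> test_functions J" using \<psi> test_functions_mono[of "J - {\<omega>}" J] by blast
    then show ?thesis unfolding split by (simp add: smoothing_add[OF _ \<theta>])
  qed
  moreover have "relatively_compact (smoothing \<psi> u ` {0..})"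
    using off[OF \<psi>] by (simp add: smooth_precompact_def)
  ultimately show "\<exists>g. relatively_compact (g ` {0..}) \<and>
      (\<forall>s\<in>{0..}. norm (smoothing (\<lambda>\<xi>. ?v \<xi> * \<phi> \<xi>) u s - g s) \<le> e)"
    by (intro exI[of _ "smoothing \<psi> u"]) simp
qed

end


section \<open>The ergodic condition removes isolated points\<close>

text \<open>Without isolated points every \<open>F - {x}\<close> would be open and dense in \<open>F\<close>, and by Baire's theorem the
  empty intersection of these countably many sets would be dense as well.\<close>

lemma countable_closed_isolated_point:
  fixes F :: "real set"
  assumes "closed F" "countable F" "F \<noteq> {}"
  obtains x J where "x \<in> F" "open J" "x \<in> J" "J \<inter> F = {x}"
proof (rule ccontr)
  assume "\<not> thesis"
  with that have no: "J \<inter> F \<noteq> {x}" if "x \<in> F" "open J" "x \<in> J" for x J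
    using that by blast
  define \<G> where "\<G> = (\<lambda>x. F - {x}) ` F"
  have "F \<subseteq> closure (\<Inter>\<G>)"
  proof (rule Baire[OF assms(1)])
    show "countable \<G>" unfolding \<G>_def using assms(2) by simp
    fix G assume "G \<in> \<G>"
    then obtain x where x: "x \<in> F" "G = F - {x}" unfolding \<G>_def by blast
    have "openin (top_of_set F) G"
      unfolding x(2) by (simp add: openin_delete)
    moreover have "y \<in> closure G" if "y \<in> F" for y
    proof (cases "y = x")
      case True
      have "x islimpt F"
        unfolding islimpt_def
      proof (intro allI impI)
        fix J assume "x \<in> J" "open J"
        then have "J \<inter> F \<noteq> {x}" using no x(1) by blast
        then show "\<exists>y\<in>F. y \<in> J \<and> y \<noteq> x" using \<open>x \<in> J\<close> x(1) by blast
      qed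
      then show ?thesis
        using True x(2) by (simp add: islimpt_in_closure)
    next
      case False
      then have "y \<in> G" using x(2) that by simp
      then show ?thesis using closure_subset by blast
    qed
    ultimately show "openin (top_of_set F) G \<and> F \<subseteq> closure G" by blast
  qed
  moreover have "\<Inter>\<G> = {}" unfolding \<G>_def using assms(3) by blast
  ultimately show False using assms(3) by simp
qed

context bounded_C0_semigroup
begin

text \<open>Integrate the equation \<open>V' = z V - T(t) u\<close> for \<open>V(t) = T(t) R(z) u\<close> against the transform of \<open>\<phi>\<close>, by parts.
  Differentiating the transform multiplies \<open>\<phi>\<close> by \<open>-\<i>\<xi>\<close>, and the part \<open>\<i>\<omega>\<close> of \<open>z\<close> turns \<open>\<xi>\<close> into \<open>\<xi> - \<omega>\<close>.\<close>

lemma smoothing_R_identity: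
  assumes \<phi>: "\<phi> \<in> test_functions I" and \<alpha>: "\<alpha> > 0" and z: "z = of_real \<alpha> + \<i> * of_real \<omega>"
  shows "smoothing \<phi> u s = of_real \<alpha> *\<^sub>C smoothing \<phi> (R z u) s
    - \<i> *\<^sub>C smoothing (\<lambda>\<xi>. (of_real \<xi> - of_real \<omega>) * \<phi> \<xi>) (R z u) s + fourier \<phi> (- s) *\<^sub>C R z u"
proof -
  have Rez: "Re z > 0" using \<alpha> z by simp
  define V where "V = (\<lambda>t. T t (R z u))"
  define \<psi> where "\<psi> = (\<lambda>\<xi>. of_real \<xi> * \<phi> \<xi>)"
  have \<psi>: "\<psi> \<in> test_functions I"
    unfolding \<psi>_def by (rule test_functions_mult[OF \<phi> smooth_of_real])
  have i\<psi>: "(\<lambda>\<xi>. (- \<i>) * \<psi> \<xi>) \<in> test_functions I"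
    by (rule test_functions_mult[OF \<psi> smooth_const])
  let ?k = "\<lambda>t. fourier \<phi> (t - s)"
  let ?k' = "\<lambda>t. fourier (\<lambda>\<xi>. (- \<i>) * \<psi> \<xi>) (t - s)"
  let ?h = "\<lambda>t. ?k t *\<^sub>C (z *\<^sub>C V t - T t u) + ?k' t *\<^sub>C V t"
  have V: "(V has_vector_derivative z *\<^sub>C V t - T t u) (at t within {0..N})" if "t \<in> {0..N}" for t N
    unfolding V_def by (rule orbit_R_derivative[OF Rez that])
  have k': "(?k has_vector_derivative ?k' t) (at t within S)" for t S
  proof -
    have "((\<lambda>t. t - s) has_vector_derivative 1) (at t)" by (auto intro!: derivative_eq_intros)
    from vector_diff_chain_at[OF this fourier_has_vector_derivative[OF \<phi>]]
    show ?thesis unfolding \<psi>_def by (auto simp: o_def intro: has_vector_derivative_at_within)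
  qed
  have parts: "(?h has_integral ?k N *\<^sub>C V N - ?k 0 *\<^sub>C V 0) {0..N}" if "N \<ge> 0" for N
    by (rule fundamental_theorem_of_calculus[OF that]) (rule scaleC.has_vector_derivative[OF k' V])
  have "((\<lambda>t. z *\<^sub>C (?k t *\<^sub>C V t) - ?k t *\<^sub>C T t u + ?k' t *\<^sub>C V t) has_integral
      z *\<^sub>C smoothing \<phi> (R z u) s - smoothing \<phi> u s + smoothing (\<lambda>\<xi>. (- \<i>) * \<psi> \<xi>) (R z u) s) {0..}"
    unfolding V_def
    using has_integral_linear[OF smoothing_has_integral[OF \<phi>, of s "R z u"] scaleC.bounded_linear_right[of z]]
    by (intro has_integral_add has_integral_diff smoothing_has_integral[OF \<phi>] smoothing_has_integral[OF i\<psi>])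
       (simp add: o_def)
  moreover have "(\<lambda>t. z *\<^sub>C (?k t *\<^sub>C V t) - ?k t *\<^sub>C T t u + ?k' t *\<^sub>C V t) = ?h"
    by (simp add: scaleC.diff_right scaleC_scaleC mult.commute)
  ultimately have I: "(?h has_integral
      z *\<^sub>C smoothing \<phi> (R z u) s - smoothing \<phi> u s + smoothing (\<lambda>\<xi>. (- \<i>) * \<psi> \<xi>) (R z u) s) {0..}"
    by simp
  obtain C where C: "C \<ge> 0" "\<And>t. norm (fourier \<phi> t) \<le> C / (1 + t\<^sup>2)"
    using fourier_quadratic_decay[OF \<phi>] by blast
  have "((\<lambda>N. ?k N *\<^sub>C V N - ?k 0 *\<^sub>C V 0) \<longlongrightarrow> 0 - ?k 0 *\<^sub>C V 0) at_top"
  proof (intro tendsto_diff tendsto_const)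
    show "((\<lambda>N. ?k N *\<^sub>C V N) \<longlongrightarrow> 0) at_top"
    proof (rule Lim_null_comparison)
      show "\<forall>\<^sub>F N in at_top. norm (?k N *\<^sub>C V N) \<le> C / (1 + (N - s)\<^sup>2) * (M * norm (R z u))"
        using eventually_ge_at_top[of 0]
      proof eventually_elim
        case (elim N)
        show ?case
          unfolding norm_scaleC V_def
          using C(2)[of "N - s"] norm_T[OF elim, of "R z u"] C(1)
          by (intro mult_mono divide_nonneg_nonneg) auto
      qed
      have "filterlim (\<lambda>N::real. 1 + (N - s)\<^sup>2) at_top at_top"
        by (intro filterlim_tendsto_add_at_top[OF tendsto_const] filterlim_pow_at_top
            filterlim_tendsto_add_at_top[of "\<lambda>_. - s" "- s" _ "\<lambda>N. N", simplified]) (auto simp: filterlim_ident)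
      then have "((\<lambda>N. C / (1 + (N - s)\<^sup>2)) \<longlongrightarrow> 0) at_top"
        by (intro real_tendsto_divide_at_top[OF tendsto_const])
      then show "((\<lambda>N. C / (1 + (N - s)\<^sup>2) * (M * norm (R z u))) \<longlongrightarrow> 0) at_top"
        by (rule tendsto_mult_left_zero)
    qed
  qed
  then have "((\<lambda>N. integral {0..N} ?h) \<longlongrightarrow> 0 - ?k 0 *\<^sub>C V 0) at_top"
  proof (rule Lim_transform_eventually)
    show "\<forall>\<^sub>F N in at_top. ?k N *\<^sub>C V N - ?k 0 *\<^sub>C V 0 = integral {0..N} ?h"
      using eventually_ge_at_top[of 0] by eventually_elim (rule integral_unique[OF parts, symmetric])
  qed
  with tendsto_integral_half_line[OF has_integral_integrable[OF I]]
  have "integral {0..} ?h = 0 - ?k 0 *\<^sub>C V 0"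
    by (intro tendsto_unique) auto
  with integral_unique[OF I]
  have "z *\<^sub>C smoothing \<phi> (R z u) s - smoothing \<phi> u s + smoothing (\<lambda>\<xi>. (- \<i>) * \<psi> \<xi>) (R z u) s
      = - (fourier \<phi> (- s) *\<^sub>C R z u)" by (simp add: V_def)
  then have *: "smoothing \<phi> u s = z *\<^sub>C smoothing \<phi> (R z u) s - \<i> *\<^sub>C smoothing \<psi> (R z u) s
      + fourier \<phi> (- s) *\<^sub>C R z u"
    unfolding smoothing_mult[OF \<psi>] by (simp add: scaleC.minus_left algebra_simps eq_neg_iff_add_eq_0)
  have "smoothing \<psi> (R z u) s = smoothing (\<lambda>\<xi>. (of_real \<xi> - of_real \<omega>) * \<phi> \<xi>) (R z u) s
      + of_real \<omega> *\<^sub>C smoothing \<phi> (R z u) s"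
  proof -
    have c: "(\<lambda>\<xi>. of_real \<omega> * \<phi> \<xi>) \<in> test_functions I"
      by (rule test_functions_mult[OF \<phi> smooth_const])
    have "(\<lambda>\<xi>. (of_real \<xi> + (- of_real \<omega>)) * \<phi> \<xi>) \<in> test_functions I"
      by (rule test_functions_mult[OF \<phi>]) (intro smooth_add smooth_of_real smooth_const)
    then have d: "(\<lambda>\<xi>. (of_real \<xi> - of_real \<omega>) * \<phi> \<xi>) \<in> test_functions I" by simp
    have "\<psi> = (\<lambda>\<xi>. (of_real \<xi> - of_real \<omega>) * \<phi> \<xi> + of_real \<omega> * \<phi> \<xi>)"
      by (simp add: \<psi>_def algebra_simps)
    then show ?thesis by (simp add: smoothing_add[OF d c] smoothing_mult[OF \<phi>])
  qed
  then show ?thesis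
    unfolding * z by (simp add: scaleC.add_right scaleC.add_left scaleC_scaleC)
qed

text \<open>By \<open>T_R_eq\<close>, \<open>T s\<close> acts on the Abel mean as multiplication by \<open>exp (z s)\<close>, up to an integral over \<open>[0, s]\<close>
  that the factor \<open>a n\<close> sends to \<open>0\<close>. The filter is arbitrary because the means are only known to
  converge along a subsequence when this is used for the mean ergodic theorem.\<close>

lemma ergodic_limit_eigenvector:
  assumes F: "F \<noteq> bot" and a: "(a \<longlongrightarrow> 0) F" "\<forall>\<^sub>F n in F. a n > (0::real)"
    and y: "((\<lambda>n. a n *\<^sub>R R (of_real (a n) + \<i> * of_real \<omega>) u) \<longlongrightarrow> y) F" and s: "s \<ge> 0"
  shows "T s y = exp (\<i> * of_real (\<omega> * s)) *\<^sub>C y"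
proof -
  let ?z = "\<lambda>n. complex_of_real (a n) + \<i> * of_real \<omega>"
  let ?v = "\<lambda>n. a n *\<^sub>R R (?z n) u"
  let ?J = "\<lambda>n. integral {0..s} (\<lambda>r. exp (- ?z n * of_real r) *\<^sub>C T r u)"
  interpret Ts: bounded_linear "T s" by (rule T_linear[OF s])
  have J: "norm (?J n) \<le> M * norm u * s" if "a n > 0" for n
  proof -
    have "norm (?J n) \<le> integral {0..s} (\<lambda>r. M * norm u)"
    proof (rule norm_integral_dominated)
      show "continuous_on {0..s} (\<lambda>r. exp (- ?z n * of_real r) *\<^sub>C T r u)"
        by (intro scaleC.continuous_on continuous_intros continuous_on_subset[OF orbit_continuous]) auto
      fix r assume "r \<in> {0..s}"
      then have "exp (- a n * r) * norm (T r u) \<le> 1 * (M * norm u)"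
        using that norm_T[of r u] by (intro mult_mono) auto
      then show "norm (exp (- ?z n * of_real r) *\<^sub>C T r u) \<le> M * norm u"
        by (simp add: norm_scaleC)
    qed (auto simp: is_interval_cc)
    then show ?thesis using s by (simp add: mult_ac)
  qed
  have "((\<lambda>n. a n *\<^sub>R ?J n) \<longlongrightarrow> 0) F"
  proof (rule Lim_null_comparison)
    show "\<forall>\<^sub>F n in F. norm (a n *\<^sub>R ?J n) \<le> a n * (M * norm u * s)"
      using a(2) by eventually_elim (simp only: norm_scaleR abs_of_pos, rule mult_left_mono[OF J], auto)
    show "((\<lambda>n. a n * (M * norm u * s)) \<longlongrightarrow> 0) F"
      using tendsto_mult_left_zero[OF a(1)] .
  qed
  moreover have "((\<lambda>n. exp (?z n * of_real s)) \<longlongrightarrow> exp ((of_real 0 + \<i> * of_real \<omega>) * of_real s)) F"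
    by (intro tendsto_intros a)
  ultimately have "((\<lambda>n. exp (?z n * of_real s) *\<^sub>C (?v n - a n *\<^sub>R ?J n)) \<longlongrightarrow>
      exp ((of_real 0 + \<i> * of_real \<omega>) * of_real s) *\<^sub>C (y - 0)) F"
    by (intro scaleC.tendsto tendsto_diff y)
  then have "((\<lambda>n. T s (?v n)) \<longlongrightarrow> exp (\<i> * of_real (\<omega> * s)) *\<^sub>C y) F"
  proof (rule Lim_transform_eventually[THEN tendsto_eq_rhs])
    show "\<forall>\<^sub>F n in F. exp (?z n * of_real s) *\<^sub>C (?v n - a n *\<^sub>R ?J n) = T s (?v n)"
      using a(2) by eventually_elim
        (simp add: Ts.scaleR T_R_eq[OF _ s] scaleC.scaleR_right scaleR_right_diff_distrib[symmetric])
  qed (simp add: mult.assoc)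
  with Ts.tendsto[OF y] show ?thesis using F by (intro tendsto_unique[of F]) auto
qed

text \<open>Smoothing multiplies an eigenvector by bounded scalars.\<close>

lemma smooth_precompact_eigenvector:
  assumes \<phi>: "\<phi> \<in> test_functions I" and y: "\<And>s. s \<ge> 0 \<Longrightarrow> T s y = exp (\<i> * of_real (\<omega> * s)) *\<^sub>C y"
  shows "smooth_precompact y \<phi>"
proof -
  obtain C where C: "C \<ge> 0" "\<And>t. norm (fourier \<phi> t) \<le> C / (1 + t\<^sup>2)"
    using fourier_quadratic_decay[OF \<phi>] by blast
  define c where "c = (\<lambda>s. integral {0..} (\<lambda>t. fourier \<phi> (t - s) *\<^sub>C exp (\<i> * of_real (\<omega> * t))))"
  have c: "(\<lambda>t. fourier \<phi> (t - s) *\<^sub>C exp (\<i> * of_real (\<omega> * t))) integrable_on {0..}"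
    "norm (c s) \<le> C * 1 * pi / 1" for s
    unfolding c_def
    by (rule weighted_integral[OF half_line continuous_on_fourier_shift[OF \<phi>] _ zero_less_one,
        where C = C and B = 1 and s = s]; use C in \<open>auto intro!: continuous_intros\<close>)+
  have "smoothing \<phi> y s = c s *\<^sub>C y" for s
  proof -
    have "((\<lambda>t. (fourier \<phi> (t - s) *\<^sub>C exp (\<i> * of_real (\<omega> * t))) *\<^sub>C y) has_integral c s *\<^sub>C y) {0..}"
      using has_integral_linear[OF integrable_integral[OF c(1)] scaleC.bounded_linear_left]
      by (simp add: o_def c_def)
    then have "((\<lambda>t. fourier \<phi> (t - s) *\<^sub>C T t y) has_integral c s *\<^sub>C y) {0..}"
      by (rule has_integral_eq[rotated]) (simp add: y scaleC_complex_def scaleC_scaleC)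
    then show ?thesis unfolding smoothing_def by (rule integral_unique)
  qed
  then show ?thesis
    unfolding smooth_precompact_def
    using relatively_compact_scaleC[OF c(2) relatively_compact_const[of y "{0..}"]] by simp
qed

text \<open>In \<open>smoothing_R_identity\<close> for \<open>w = \<alpha> R(\<alpha> + \<i>\<omega>) u\<close> the middle term is the image of a relatively compact
  set under the resolvent, and the last one lies on a line. The first one is uniformly close to
  the smoothed orbit of the eigenvector \<open>y\<close>.\<close>

lemma smooth_precompact_ergodic:
  assumes \<phi>: "\<phi> \<in> test_functions I"
    and van: "smooth_precompact u (\<lambda>\<xi>. (of_real \<xi> - of_real \<omega>) * \<phi> \<xi>)"
    and y: "((\<lambda>\<alpha>. \<alpha> *\<^sub>R R (of_real \<alpha> + \<i> * of_real \<omega>) u) \<longlongrightarrow> y) (at_right 0)"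
  shows "smooth_precompact u \<phi>"
  unfolding smooth_precompact_def
proof (rule relatively_compact_approx)
  fix e :: real assume "e > 0"
  obtain D where D: "D \<ge> 0" "\<And>u s. norm (smoothing \<phi> u s) \<le> D * norm u"
    using smoothing_uniform_bound[OF \<phi>] by blast
  have "e / (D + 1) > 0" using \<open>e > 0\<close> D by simp
  from tendstoD[OF y this]
  obtain \<alpha> where \<alpha>: "\<alpha> > 0" "norm (\<alpha> *\<^sub>R R (of_real \<alpha> + \<i> * of_real \<omega>) u - y) < e / (D + 1)"
    unfolding eventually_at_right_field dist_norm by (meson dense)
  define z where "z = complex_of_real \<alpha> + \<i> * of_real \<omega>"
  have z: "Re z > 0" using \<alpha> by (simp add: z_def)
  define v where "v = R z u"
  let ?\<psi> = "\<lambda>\<xi>. (complex_of_real \<xi> - of_real \<omega>) * \<phi> \<xi>"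
  have "(\<lambda>\<xi>. (of_real \<xi> + (- of_real \<omega>)) * \<phi> \<xi>) \<in> test_functions I"
    by (rule test_functions_mult[OF \<phi>]) (intro smooth_add smooth_of_real smooth_const)
  then have \<psi>: "?\<psi> \<in> test_functions I" by simp
  obtain C where C: "C \<ge> 0" "\<And>t. norm (fourier \<phi> t) \<le> C / (1 + t\<^sup>2)"
    using fourier_quadratic_decay[OF \<phi>] by blast
  have bd: "norm (fourier \<phi> t) \<le> C" for t
  proof -
    have "C / (1 + t\<^sup>2) \<le> C / 1" using C(1) by (intro divide_left_mono) (auto simp: add_pos_nonneg)
    then show ?thesis using C(2)[of t] by simp
  qed
  define g where "g = (\<lambda>s. (smoothing \<phi> y s + (- \<i>) *\<^sub>C R z (smoothing ?\<psi> u s)) + fourier \<phi> (- s) *\<^sub>C v)"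
  have "relatively_compact (smoothing \<phi> y ` {0..})"
    using smooth_precompact_eigenvector[OF \<phi> ergodic_limit_eigenvector[OF _ _ _ y]]
    by (simp add: smooth_precompact_def eventually_at_right_less tendsto_ident_at)
  moreover have "relatively_compact ((\<lambda>s. R z (smoothing ?\<psi> u s)) ` {0..})"
    using relatively_compact_continuous_image[OF van[unfolded smooth_precompact_def]
        bounded_linear.continuous_on[OF R_bounded_linear[OF z] continuous_on_id]]
    by (simp add: image_image)
  then have "relatively_compact ((\<lambda>s. (- \<i>) *\<^sub>C R z (smoothing ?\<psi> u s)) ` {0..})"
    by (intro relatively_compact_scaleC[where C = 1]) auto
  moreover have "relatively_compact ((\<lambda>s. fourier \<phi> (- s) *\<^sub>C v) ` {0..})"
    by (intro relatively_compact_scaleC[where C = C] bd relatively_compact_const)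
  ultimately have "relatively_compact (g ` {0..})"
    unfolding g_def by (intro relatively_compact_add)
  moreover have "norm (smoothing \<phi> u s - g s) \<le> e" for s
  proof -
    have "smoothing \<phi> u s - g s = smoothing \<phi> (of_real \<alpha> *\<^sub>C v - y) s"
      unfolding g_def smoothing_R_identity[OF \<phi> \<alpha>(1) z_def, of u s]
      by (simp add: smoothing_R[OF \<psi> z] smoothing_diff[OF \<phi>] smoothing_scaleC[OF \<phi>] v_def
          scaleC.minus_left)
    also have "norm \<dots> \<le> D * norm (of_real \<alpha> *\<^sub>C v - y)" by (rule D)
    also have "\<dots> \<le> (D + 1) * (e / (D + 1))"
      using \<alpha>(2) D(1) by (intro mult_mono) (auto simp: v_def z_def scaleR_scaleC)
    also have "\<dots> = e" using D(1) by simp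
    finally show ?thesis .
  qed
  ultimately show "\<exists>g. relatively_compact (g ` {0..}) \<and> (\<forall>s\<in>{0..}. norm (smoothing \<phi> u s - g s) \<le> e)"
    by blast
qed

text \<open>If the largest open set on which all test functions have relatively compact smoothings were not
  the whole line, then its complement, a closed subset of the countable spectrum, would have an
  isolated point, and the convergence of the Abel means puts this point into the open set.\<close>

lemma smooth_precompact_everywhere:
  assumes spec: "countable (sing_supp_PF (boundary_resolvent (generator T) u))"
    and lim: "\<And>\<omega>. \<omega> \<in> sing_supp_PF (boundary_resolvent (generator T) u) \<Longrightarrow>
      \<exists>y. ((\<lambda>\<alpha>. \<alpha> *\<^sub>R R (of_real \<alpha> + \<i> * of_real \<omega>) u) \<longlongrightarrow> y) (at_right 0)"
    and \<phi>: "\<phi> \<in> test_functions UNIV"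
  shows "smooth_precompact u \<phi>"
proof -
  define U where "U = \<Union>{J. open J \<and> (\<forall>\<phi>\<in>test_functions J. smooth_precompact u \<phi>)}"
  have global: "smooth_precompact u \<psi>" if "\<psi> \<in> test_functions U" for \<psi>
    by (rule test_functions_localize[where P = "smooth_precompact u", OF that smooth_precompact_zero])
       (auto simp: U_def intro: smooth_precompact_add)
  let ?\<Lambda> = "sing_supp_PF (boundary_resolvent (generator T) u)"
  have sub: "- U \<subseteq> ?\<Lambda>"
    using smooth_precompact_off_spectrum unfolding U_def by blast
  have "U = UNIV"
  proof (rule ccontr)
    assume "U \<noteq> UNIV"
    have "closed (- U)" unfolding U_def by (intro closed_Compl open_Union) auto
    moreover have "countable (- U)" using sub spec by (rule countable_subset)
    moreover have "- U \<noteq> {}" using \<open>U \<noteq> UNIV\<close> by auto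
    ultimately obtain \<omega> J where J: "\<omega> \<in> - U" "open J" "\<omega> \<in> J" "J \<inter> - U = {\<omega>}"
      by (rule countable_closed_isolated_point)
    obtain y where y: "((\<lambda>\<alpha>. \<alpha> *\<^sub>R R (of_real \<alpha> + \<i> * of_real \<omega>) u) \<longlongrightarrow> y) (at_right 0)"
      using lim J(1) sub by blast
    have "smooth_precompact u \<psi>" if \<psi>: "\<psi> \<in> test_functions J" for \<psi>
    proof (rule smooth_precompact_ergodic[OF \<psi> smooth_precompact_vanishing[OF \<psi>] y])
      fix \<eta>1 assume "\<eta>1 \<in> test_functions (J - {\<omega>})"
      moreover have "J - {\<omega>} \<subseteq> U" using J(4) by blast
      ultimately show "smooth_precompact u \<eta>1"
        using global test_functions_mono by blast
    qed
    then have "J \<subseteq> U" using J(2) unfolding U_def by blast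
    with J(1,3) show False by blast
  qed
  with global \<phi> show ?thesis by simp
qed

end


section \<open>From smoothed orbits back to the orbit\<close>

context bounded_C0_semigroup
begin

text \<open>The transforms of the dilated cutoffs \<open>cutoff (\<xi> / n)\<close>, divided by their total mass \<open>c\<close>, are an
  approximate identity: they satisfy \<open>\<bar>\<phi>^(t)\<bar> \<le> n C / (1 + (n t)\<^sup>2)\<close> with the same \<open>C\<close> for all \<open>n \<ge> 1\<close>. By uniform
  continuity the smoothed orbits approximate the orbit uniformly.\<close>

lemma orbit_relatively_compact:
  assumes good: "\<And>\<phi>. \<phi> \<in> test_functions UNIV \<Longrightarrow> smooth_precompact u \<phi>"
  shows "relatively_compact ((\<lambda>t. T t u) ` {0..})"
proof (rule relatively_compact_approx)
  fix e :: real assume "e > 0"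
  define B where "B = 2 * M * norm u"
  have B: "B \<ge> 0" using M_nonneg by (simp add: B_def)
  \<comment> \<open>Extending the orbit by the constant \<open>u\<close> keeps it uniformly continuous on the whole line; the extension
    contributes multiples of \<open>u\<close> to the smoothing.\<close>
  define f where "f = (\<lambda>t. T (max t 0) u)"
  have fc: "continuous_on S f" for S
    unfolding f_def by (rule continuous_on_compose2[OF orbit_continuous]) (auto intro!: continuous_intros)
  have fdiff: "norm (f s - f t) \<le> B" for s t
    using norm_triangle_ineq4[of "f s" "f t"] norm_T[of "max s 0" u] norm_T[of "max t 0" u]
    by (simp add: f_def B_def)
  let ?\<theta> = "\<lambda>\<xi>. complex_of_real (cutoff \<xi>)"
  have \<theta>: "smooth ?\<theta>" using smooth_cutoff[of 1 0] by simp
  have \<theta>t: "?\<theta> \<in> test_functions UNIV"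
    by (rule test_functionsI[OF \<theta>, of "{-2..2}"]) (use cutoff_values(4) in force)+
  have "nth_deriv 2 ?\<theta> \<in> test_functions UNIV"
    by (simp add: numeral_2_eq_2 nth_deriv_Suc test_functions_deriv \<theta>t)
  then obtain D where D: "D \<ge> 0" "\<And>\<xi>. norm (nth_deriv 2 ?\<theta> \<xi>) \<le> D"
    using test_function_bounded by blast
  define C where "C = 4 * (1 + D)"
  have C: "C \<ge> 4" using D(1) by (simp add: C_def)
  define \<eta> where "\<eta> = e / (2 * C)"
  have \<eta>: "\<eta> > 0" "\<eta> * C = e / 2" using C \<open>e > 0\<close> by (auto simp: \<eta>_def)
  obtain d where d: "d > 0" "\<And>s t. s \<ge> 0 \<Longrightarrow> t \<ge> 0 \<Longrightarrow> \<bar>s - t\<bar> < d \<Longrightarrow> norm (T s u - T t u) \<le> \<eta>"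
    using orbit_uniformly_continuous[OF \<eta>(1), of u] by blast
  have near: "norm (f s - f t) \<le> \<eta>" if "\<bar>s - t\<bar> < d" for s t
    unfolding f_def by (rule d(2)) (use that in auto)
  \<comment> \<open>At distance at least \<open>d\<close> from \<open>s\<close> the kernel \<open>n C / (1 + (n (t - s))\<^sup>2)\<close> is \<open>O(1 / n)\<close> times the kernel
    with \<open>n = 1\<close>; the constant \<open>E\<close> includes the bound \<open>B\<close> for differences of \<open>f\<close>.\<close>
  define E where "E = B * C * (1 + 1 / d\<^sup>2)"
  have E: "E \<ge> 0" using B C by (simp add: E_def)
  define n where "n = 2 * E / e + 1"
  have n1: "n \<ge> 1" using E \<open>e > 0\<close> by (simp add: n_def)
  have En: "E / n \<le> e / 2"
  proof -
    have "n * e = 2 * E + e" using \<open>e > 0\<close> by (simp add: n_def field_simps)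
    then have "E \<le> e / 2 * n" using \<open>e > 0\<close> by (simp add: mult.commute)
    then show ?thesis using n1 by (simp add: pos_divide_le_eq)
  qed
  define \<phi> where "\<phi> = (\<lambda>\<xi>. complex_of_real (cutoff ((1 / n) * \<xi> + 0)))"
  have s\<phi>: "smooth \<phi>" unfolding \<phi>_def by (rule smooth_cutoff)
  have \<phi>0: "\<phi> \<xi> = 0" if "2 * n \<le> \<bar>\<xi>\<bar>" for \<xi>
    unfolding \<phi>_def using that n1 by (subst cutoff_values(4)) (auto simp: field_simps abs_mult)
  have \<phi>: "\<phi> \<in> test_functions UNIV"
    by (rule test_functionsI[OF s\<phi>, of "{- (2 * n)..2 * n}"]) (use \<phi>0 in force)+
  have decay: "norm (fourier \<phi> t) \<le> (n * C) / (1 + (n * t)\<^sup>2)" for t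
  proof -
    have "norm (fourier \<phi> t) \<le> (2 * n - (- (2 * n))) * (1 + n\<^sup>2 * (D / n\<^sup>2)) / (1 + (n * t)\<^sup>2)"
    proof (rule fourier_decay[OF \<phi>])
      show "\<phi> \<xi> = 0" if "\<xi> \<notin> {- (2 * n)<..<2 * n}" for \<xi>
        using \<phi>0[of \<xi>] that by auto
      show "norm (\<phi> \<xi>) \<le> 1" for \<xi>
        using cutoff_values(1,2) by (simp add: \<phi>_def)
      show "norm (nth_deriv 2 \<phi> \<xi>) \<le> D / n\<^sup>2" for \<xi>
        unfolding \<phi>_def nth_deriv_2_affine[OF \<theta>]
        using D(2) n1 by (simp add: norm_mult norm_power norm_divide power_divide divide_right_mono)
    qed (use n1 in auto)
    then show ?thesis using n1 by (simp add: C_def algebra_simps)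
  qed
  have mass: "1 \<le> cutoff ((1 / n) * \<xi> + 0)" if "\<bar>\<xi>\<bar> \<le> 1" for \<xi>
  proof -
    have "\<bar>\<xi>\<bar> / n \<le> 1" using that n1 by (simp add: divide_le_eq)
    then show ?thesis using n1 by (subst cutoff_values(3)) (auto simp: abs_mult)
  qed
  obtain c where c: "c \<ge> pi" "\<And>s. ((\<lambda>t. fourier \<phi> (t - s)) has_integral of_real c) UNIV"
    using fourier_total_mass[OF \<phi>[unfolded \<phi>_def] cutoff_values(1) mass] unfolding \<phi>_def by blast
  have c0: "c > 0" using c(1) pi_gt_zero by linarith
  have nC: "0 \<le> n * C" "n > 0" using n1 C by auto
  have left: "(\<lambda>t. fourier \<phi> (t - s) *\<^sub>C (1::complex)) integrable_on {..0}"
    "norm (integral {..0} (\<lambda>t. fourier \<phi> (t - s) *\<^sub>C (1::complex))) \<le> (n * C) * 1 * pi / n" for s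
    by (rule weighted_integral[OF _ _ continuous_on_fourier_shift[OF \<phi>] _ nC(2),
        where C = "n * C" and B = 1 and s = s];
        use decay nC in \<open>auto simp: is_interval_ic\<close>)+
  define m where "m = (\<lambda>s. integral {..0} (\<lambda>t. fourier \<phi> (t - s)))"
  have m: "((\<lambda>t. fourier \<phi> (t - s)) has_integral m s) {..0}" "norm (m s) \<le> C * pi" for s
    using left[of s] n1 by (auto simp: m_def scaleC_complex_def integrable_integral)
  define g where "g = (\<lambda>s. of_real (1 / c) *\<^sub>C (smoothing \<phi> u s + m s *\<^sub>C u))"
  have "relatively_compact (g ` {0..})"
    unfolding g_def using good[OF \<phi>] m(2)
    by (intro relatively_compact_scaleC[where C = "norm (complex_of_real (1 / c))"] relatively_compact_add
        relatively_compact_scaleC[where C = "C * pi"] relatively_compact_const)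
       (auto simp: smooth_precompact_def)
  moreover have "norm (T s u - g s) \<le> e" if s: "s \<in> {0..}" for s
  proof -
    let ?k = "\<lambda>t. fourier \<phi> (t - s)"
    have "((\<lambda>t. ?k t *\<^sub>C f t) has_integral m s *\<^sub>C u) {..0}"
      using has_integral_linear[OF m(1) scaleC.bounded_linear_left[of u]]
      by (rule has_integral_eq[rotated]) (simp add: f_def o_def max_def)
    moreover have "((\<lambda>t. ?k t *\<^sub>C f t) has_integral smoothing \<phi> u s) {0..}"
      using smoothing_has_integral[OF \<phi>, of s u]
      by (rule has_integral_eq[rotated]) (simp add: f_def max_def)
    ultimately have "((\<lambda>t. ?k t *\<^sub>C f t) has_integral m s *\<^sub>C u + smoothing \<phi> u s) ({..0} \<union> {0..})"
      by (rule has_integral_Un) (auto intro: negligible_subset[of "{0}"])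
    moreover have "{..0::real} \<union> {0..} = UNIV" by auto
    ultimately have 1: "((\<lambda>t. ?k t *\<^sub>C f t) has_integral of_real c *\<^sub>C g s) UNIV"
      using c0 by (simp add: g_def scaleC_scaleC add.commute)
    have 2: "((\<lambda>t. ?k t *\<^sub>C T s u) has_integral of_real c *\<^sub>C T s u) UNIV"
      using has_integral_linear[OF c(2) scaleC.bounded_linear_left[of "T s u"]] by (simp add: o_def)
    have 3: "((\<lambda>t. ?k t *\<^sub>C (f s - f t)) has_integral of_real c *\<^sub>C (T s u - g s)) UNIV"
      using has_integral_diff[OF 2 1] s by (simp add: scaleC.diff_right f_def)
    define K where "K = (\<lambda>t::real. (\<eta> * (n * C)) * (1 / (1 + (n * (t - s))\<^sup>2)) + (E / n) * (1 / (1 + (1 * (t - s))\<^sup>2)))"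
    have K: "(K has_integral (\<eta> * (n * C)) * (pi / n) + (E / n) * (pi / 1)) UNIV"
      unfolding K_def
      by (intro has_integral_add has_integral_mult_right has_integral_cauchy_kernel) (use n1 in auto)
    have bound: "norm (?k t *\<^sub>C (f s - f t)) \<le> K t" for t
    proof (cases "\<bar>s - t\<bar> < d")
      case True
      have "norm (?k t) * norm (f s - f t) \<le> (n * C) / (1 + (n * (t - s))\<^sup>2) * \<eta>"
        using nC by (intro mult_mono decay near True divide_nonneg_nonneg) auto
      moreover have "0 \<le> (E / n) * (1 / (1 + (1 * (t - s))\<^sup>2))" using E n1 by (simp add: add_nonneg_nonneg)
      ultimately show ?thesis unfolding K_def norm_scaleC by (simp add: mult_ac)
    next
      case False
      define r where "r = (t - s)\<^sup>2"
      have r: "r \<ge> d\<^sup>2" "r > 0"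
      proof -
        have "d\<^sup>2 \<le> \<bar>t - s\<bar>\<^sup>2" using False d(1) by (intro power_mono) auto
        then show "r \<ge> d\<^sup>2" by (simp add: r_def)
        then show "r > 0" using d(1) by (meson less_le_trans zero_less_power)
      qed
      have "norm (?k t) \<le> (n * C) / (1 + (n * (t - s))\<^sup>2)" by (rule decay)
      also have "\<dots> \<le> (n * C) / (n\<^sup>2 * r)"
        using nC r by (intro divide_left_mono) (auto simp: r_def power_mult_distrib add_pos_nonneg)
      also have "\<dots> = (C / n) * (1 / r)" using nC by (simp add: power2_eq_square)
      also have "\<dots> \<le> (C / n) * ((1 + 1 / d\<^sup>2) * (1 / (1 + r)))"
      proof (rule mult_left_mono)
        have "1 + r \<le> (1 + 1 / d\<^sup>2) * r"
          using r d(1) by (simp add: field_simps)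
        then show "1 / r \<le> (1 + 1 / d\<^sup>2) * (1 / (1 + r))"
          using r by (simp add: field_simps)
      qed (use C n1 in auto)
      finally have "norm (?k t) * norm (f s - f t) \<le> ((C / n) * ((1 + 1 / d\<^sup>2) * (1 / (1 + r)))) * B"
        using r C n1 by (intro mult_mono fdiff mult_nonneg_nonneg divide_nonneg_nonneg add_nonneg_nonneg) auto
      also have "\<dots> = (E / n) * (1 / (1 + r))" by (simp add: E_def)
      also have "\<dots> \<le> K t"
        using \<eta> nC unfolding K_def r_def by simp
      finally show ?thesis by (simp add: norm_scaleC)
    qed
    have "c * norm (T s u - g s) = norm (integral UNIV (\<lambda>t. ?k t *\<^sub>C (f s - f t)))"
      using c0 by (simp add: integral_unique[OF 3] norm_scaleC)
    also have "\<dots> \<le> integral UNIV K"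
      using 3 K bound by (intro Henstock_Kurzweil_Integration.integral_norm_bound_integral) auto
    also have "\<dots> = (e / 2 + E / n) * pi"
      using n1 integral_unique[OF K] by (simp add: \<eta>(2)[symmetric] algebra_simps)
    also have "\<dots> \<le> e * c"
    proof (rule mult_mono)
      show "e / 2 + E / n \<le> e" using En by linarith
    qed (use c(1) \<open>e > 0\<close> in auto)
    finally show ?thesis using c0 by (simp add: mult.commute)
  qed
  ultimately show "\<exists>g. relatively_compact (g ` {0..}) \<and> (\<forall>s\<in>{0..}. norm (T s u - g s) \<le> e)"
    by blast
qed


section \<open>The mean ergodic theorem\<close>

lemma R_eigenvector:
  assumes z: "Re z > 0" and y: "\<And>s. s \<ge> 0 \<Longrightarrow> T s y = exp (\<i> * of_real (\<omega> * s)) *\<^sub>C y"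
  shows "R z y = (1 / (z - \<i> * of_real \<omega>)) *\<^sub>C y"
proof -
  have "R z y = laplace (\<lambda>t. exp (\<i> * of_real (\<omega> * t)) *\<^sub>C y) z"
    unfolding laplace_def by (rule integral_cong) (simp add: y)
  then show ?thesis by (simp only: laplace_exponential[OF z])
qed

text \<open>The Abel means lie in a relatively compact set of averages of the orbit. They have a cluster
  point \<open>y\<close> as \<open>\<alpha> \<rightarrow> 0\<close>, and \<open>y\<close> is fixed by all Abel means. The Abel mean at \<open>\<alpha>\<close> of the difference
  between \<open>u\<close> and its own Abel mean \<open>v\<close> at a fixed \<open>\<beta>\<close> is \<open>O(\<alpha>)\<close> by the resolvent identity, and
  \<open>v\<close> can be chosen close to \<open>y\<close>.\<close>

lemma mean_ergodic:
  assumes orbit: "relatively_compact ((\<lambda>t. T t u) ` {0..})"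
  shows "\<exists>y. ((\<lambda>\<alpha>. \<alpha> *\<^sub>R R (of_real \<alpha> + \<i> * of_real \<omega>) u) \<longlongrightarrow> y) (at_right 0)"
proof -
  let ?z = "\<lambda>\<alpha>. complex_of_real \<alpha> + \<i> * of_real \<omega>"
  let ?E = "\<lambda>\<alpha> v. \<alpha> *\<^sub>R R (?z \<alpha>) v"
  have Rez: "Re (?z \<alpha>) > 0" if "\<alpha> > 0" for \<alpha> using that by simp
  have contr: "norm (?E \<alpha> v) \<le> M * norm v" if "\<alpha> > 0" for \<alpha> v
    using norm_R[OF _ Rez[OF that], of v] that by (simp add: field_simps)
  have "relatively_compact ((\<lambda>\<alpha>. integral {0..} (\<lambda>t. (of_real \<alpha> * exp (- ?z \<alpha> * of_real t)) *\<^sub>C T t u)) ` {0<..})"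
  proof (rule relatively_compact_averages[OF half_line orbit_continuous orbit,
        where g = "\<lambda>\<alpha> t. \<alpha> * exp (- \<alpha> * t)" and C = 1])
    fix \<alpha> :: real assume "\<alpha> \<in> {0<..}"
    then have \<alpha>: "\<alpha> > 0" by simp
    have "((\<lambda>t. \<alpha> * exp (- \<alpha> * t)) has_integral \<alpha> * (exp (- \<alpha> * 0) / \<alpha>)) {0..}"
      by (rule has_integral_mult_right) (rule has_integral_exp_minus_to_infinity[OF \<alpha>])
    from has_integral_integrable[OF this] integral_unique[OF this]
    show "(\<lambda>t. \<alpha> * exp (- \<alpha> * t)) integrable_on {0..}" "integral {0..} (\<lambda>t. \<alpha> * exp (- \<alpha> * t)) \<le> 1"
      using \<alpha> by simp_all
    show "continuous_on {0..} (\<lambda>t. of_real \<alpha> * exp (- ?z \<alpha> * of_real t))"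
      by (intro continuous_intros)
    show "norm (of_real \<alpha> * exp (- ?z \<alpha> * of_real t)) \<le> \<alpha> * exp (- \<alpha> * t)" for t
      using \<alpha> by (simp add: norm_mult)
  qed
  moreover have "integral {0..} (\<lambda>t. (of_real \<alpha> * exp (- ?z \<alpha> * of_real t)) *\<^sub>C T t u) = ?E \<alpha> u"
    if "\<alpha> > 0" for \<alpha>
  proof -
    have "((\<lambda>t. of_real \<alpha> *\<^sub>C (exp (- ?z \<alpha> * of_real t) *\<^sub>C T t u)) has_integral of_real \<alpha> *\<^sub>C R (?z \<alpha>) u) {0..}"
      using has_integral_linear[OF R_has_integral[OF _ Rez[OF that]] scaleC.bounded_linear_right]
      by (simp add: o_def)
    then show ?thesis by (simp add: scaleC_scaleC scaleR_scaleC integral_unique)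
  qed
  ultimately have "relatively_compact ((\<lambda>\<alpha>. ?E \<alpha> u) ` {0<..})" by (simp cong: image_cong_simp)
  then obtain K where K: "compact K" "(\<lambda>\<alpha>. ?E \<alpha> u) ` {0<..} \<subseteq> K"
    unfolding relatively_compact_def by blast
  define a where "a = (\<lambda>n. inverse (real (Suc n)))"
  have a0: "a n > 0" for n by (simp add: a_def)
  have "\<forall>n. ?E (a n) u \<in> K" using K(2) a0 by blast
  with K(1) obtain y r where r: "strict_mono r" "((\<lambda>n. ?E (a n) u) \<circ> r) \<longlonglongrightarrow> y"
    unfolding compact_def by meson
  define b where "b = a \<circ> r"
  have b: "\<And>n. b n > 0" "b \<longlonglongrightarrow> 0" "(\<lambda>n. ?E (b n) u) \<longlonglongrightarrow> y"
    using a0 r LIMSEQ_subseq_LIMSEQ[OF LIMSEQ_inverse_real_of_nat r(1)]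
    by (auto simp: b_def a_def o_def)
  have y: "T s y = exp (\<i> * of_real (\<omega> * s)) *\<^sub>C y" if "s \<ge> 0" for s
    by (rule ergodic_limit_eigenvector[OF sequentially_bot b(2) _ b(3) that]) (simp add: b(1))
  have Ey: "?E \<alpha> y = y" if "\<alpha> > 0" for \<alpha>
    using that by (simp add: R_eigenvector[OF Rez[OF that] y] scaleR_scaleC scaleC_scaleC)
  have "((\<lambda>\<alpha>. ?E \<alpha> u) \<longlongrightarrow> y) (at_right 0)"
  proof (rule tendstoI)
    fix e :: real assume "e > 0"
    then have "e / (2 * (M + 1)) > 0" using M_nonneg by simp
    from tendstoD[OF b(3) this] obtain n where n: "norm (?E (b n) u - y) < e / (2 * (M + 1))"
      unfolding eventually_sequentially dist_norm by blast
    define \<beta> where "\<beta> = b n"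
    define v where "v = ?E \<beta> u"
    have \<beta>: "\<beta> > 0" using b(1) by (simp add: \<beta>_def)
    have "((\<lambda>\<alpha>. \<alpha> * (2 * M * norm u / (\<beta> - \<alpha>))) \<longlongrightarrow> 0 * (2 * M * norm u / (\<beta> - 0))) (at_right 0)"
      by (intro tendsto_intros) (use \<beta> in auto)
    then have "\<forall>\<^sub>F \<alpha> in at_right 0. \<alpha> * (2 * M * norm u / (\<beta> - \<alpha>)) < e / 2"
      using \<open>e > 0\<close> by (intro order_tendstoD(2)) auto
    moreover have "\<forall>\<^sub>F \<alpha> in at_right 0. \<alpha> < \<beta>"
      using \<beta> by (intro order_tendstoD(2)[OF tendsto_ident_at]) auto
    moreover have "\<forall>\<^sub>F \<alpha> in at_right 0. (0::real) < \<alpha>" by (rule eventually_at_right_less)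
    ultimately show "\<forall>\<^sub>F \<alpha> in at_right 0. dist (?E \<alpha> u) y < e"
    proof eventually_elim
      case (elim \<alpha>)
      interpret Ra: bounded_linear "R (?z \<alpha>)" by (rule R_bounded_linear[OF Rez[OF elim(3)]])
      have id: "R (?z \<beta>) u - R (?z \<alpha>) u = (\<alpha> - \<beta>) *\<^sub>R R (?z \<alpha>) (R (?z \<beta>) u)"
        using resolvent_identity[OF Rez[OF elim(3)] Rez[OF \<beta>], of u] by (simp add: scaleR_scaleC)
      have "(\<beta> - \<alpha>) *\<^sub>R ?E \<alpha> (u - v) = \<alpha> *\<^sub>R (?E \<beta> u - ?E \<alpha> u)"
      proof -
        have "R (?z \<alpha>) u - R (?z \<beta>) u = (\<beta> - \<alpha>) *\<^sub>R R (?z \<alpha>) (R (?z \<beta>) u)"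
          using id by (simp add: algebra_simps)
        then have "(\<beta> - \<alpha>) *\<^sub>R R (?z \<alpha>) v = \<beta> *\<^sub>R (R (?z \<alpha>) u - R (?z \<beta>) u)"
          by (simp add: v_def Ra.scaleR mult.commute)
        then have "(\<beta> - \<alpha>) *\<^sub>R R (?z \<alpha>) (u - v) = ?E \<beta> u - ?E \<alpha> u"
          by (simp add: Ra.diff algebra_simps)
        then show ?thesis by (simp only: scaleR_left_commute[of "\<beta> - \<alpha>" \<alpha>])
      qed
      from arg_cong[OF this, of norm]
      have "(\<beta> - \<alpha>) * norm (?E \<alpha> (u - v)) = \<alpha> * norm (?E \<beta> u - ?E \<alpha> u)"
        unfolding norm_scaleR[of "\<beta> - \<alpha>"] norm_scaleR[of \<alpha> "?E \<beta> u - ?E \<alpha> u"]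
        using elim(2,3) by simp
      also have "\<dots> \<le> \<alpha> * (2 * M * norm u)"
        using norm_triangle_ineq4[of "?E \<beta> u" "?E \<alpha> u"] contr[OF \<beta>, of u] contr[OF elim(3), of u] elim(3)
        by (intro mult_left_mono) auto
      finally have 1: "norm (?E \<alpha> (u - v)) \<le> \<alpha> * (2 * M * norm u / (\<beta> - \<alpha>))"
        using elim(2) by (simp add: field_simps)
      have "norm (?E \<alpha> (v - y)) \<le> M * norm (v - y)" by (rule contr[OF elim(3)])
      also have "\<dots> \<le> (M + 1) * (e / (2 * (M + 1)))"
        using n M_nonneg by (intro mult_mono) (auto simp: v_def \<beta>_def)
      also have "\<dots> = e / 2" using M_nonneg by (simp add: divide_simps)
      finally have 2: "norm (?E \<alpha> (v - y)) \<le> e / 2" .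
      have "?E \<alpha> u - y = ?E \<alpha> (u - v) + ?E \<alpha> (v - y)"
        using Ey[OF elim(3)] by (simp add: Ra.diff algebra_simps)
      then have "norm (?E \<alpha> u - y) \<le> norm (?E \<alpha> (u - v)) + norm (?E \<alpha> (v - y))"
        by (simp only: norm_triangle_ineq)
      then show ?case using 1 2 elim(1) by (simp add: dist_norm)
    qed
  qed
  then show ?thesis by blast
qed

end


section \<open>Relatively compact orbits and the local pseudofunction spectrum\<close>

theorem theorem1p6:
  fixes T :: "real \<Rightarrow> 'a::complex_banach \<Rightarrow> 'a" and A :: "'a \<rightharpoonup> 'a" and x :: 'a
  assumes "C0_semigroup T"
    and "bounded_semigroup T"
    and "A = generator T"
    and "countable (sigma_PF A x)"
  shows "compact (closure ((\<lambda>t. T t x) ` {0..})) \<longleftrightarrow>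
    (\<forall>\<xi>::real. \<i> * of_real \<xi> \<in> sigma_PF A x \<longrightarrow>
      (\<exists>y. ((\<lambda>\<alpha>::real. \<alpha> *\<^sub>R resolvent (of_real \<alpha> + \<i> * of_real \<xi>) A x) \<longlongrightarrow> y) (at_right 0)))"
proof -
  obtain M where "bounded_C0_semigroup T M"
    using bounded_C0_semigroup_exists_bound assms(1,2) by blast
  then interpret bounded_C0_semigroup T M .
  let ?\<Lambda> = "sing_supp_PF (boundary_resolvent A x)"
  have spec: "\<i> * of_real \<xi> \<in> sigma_PF A x \<longleftrightarrow> \<xi> \<in> ?\<Lambda>" for \<xi>
    unfolding sigma_PF_def by auto
  have "inj_on (\<lambda>\<xi>. \<i> * complex_of_real \<xi>) ?\<Lambda>" by (auto intro: inj_onI)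
  with assms(4) have countable: "countable ?\<Lambda>"
    unfolding sigma_PF_def by (rule countable_image_inj_on)
  have means: "((\<lambda>\<alpha>::real. \<alpha> *\<^sub>R resolvent (of_real \<alpha> + \<i> * of_real \<xi>) A x) \<longlongrightarrow> y) (at_right 0) \<longleftrightarrow>
      ((\<lambda>\<alpha>. \<alpha> *\<^sub>R R (of_real \<alpha> + \<i> * of_real \<xi>) x) \<longlongrightarrow> y) (at_right 0)" for \<xi> y
  proof (rule tendsto_cong)
    show "\<forall>\<^sub>F \<alpha> in at_right 0. \<alpha> *\<^sub>R resolvent (of_real \<alpha> + \<i> * of_real \<xi>) A x =
        \<alpha> *\<^sub>R R (of_real \<alpha> + \<i> * of_real \<xi>) x"
      using eventually_at_right_less[of "0::real"]
      by eventually_elim (simp add: assms(3) resolvent_eq_R)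
  qed
  show ?thesis
    unfolding relatively_compact_iff_compact_closure[symmetric] spec means
  proof
    assume "relatively_compact ((\<lambda>t. T t x) ` {0..})"
    then show "\<forall>\<xi>. \<xi> \<in> ?\<Lambda> \<longrightarrow> (\<exists>y. ((\<lambda>\<alpha>. \<alpha> *\<^sub>R R (of_real \<alpha> + \<i> * of_real \<xi>) x) \<longlongrightarrow> y) (at_right 0))"
      using mean_ergodic by blast
  next
    assume "\<forall>\<xi>. \<xi> \<in> ?\<Lambda> \<longrightarrow> (\<exists>y. ((\<lambda>\<alpha>. \<alpha> *\<^sub>R R (of_real \<alpha> + \<i> * of_real \<xi>) x) \<longlongrightarrow> y) (at_right 0))"
    then show "relatively_compact ((\<lambda>t. T t x) ` {0..})"
      using countable unfolding assms(3)
      by (intro orbit_relatively_compact smooth_precompact_everywhere) auto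
  qed
qed

end
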